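(* Let $(X,.)$ be an $n$-space. For every continuous linear functional $\varphi\colon C^*(X,.)\to\mathbb{C}$ there exists a unique $\mu\in\mathcal{M}(X,.)$ such that $\varphi(f)=\int f\,d\mu$ for all $f\in C^*(X,.)$.
   Context: $M_n$ = complex $n\times n$ matrices, $\mathcal{U}_n$ its unitary group, $\mathbb{U}_n=\mathcal{U}_n/(\mathbb{T}I)$; for $\mathfrak{u}\in\mathbb{U}_n$, $A\in M_n$, $\mathfrak{u}.A=UAU^{-1}$ with $U$ a representative of $\mathfrak{u}$. An $n$-space is a locally compact Hausdorff space $X$ with a continuous free action $(\mathfrak{u},x)\mapsto\mathfrak{u}.x$ of $\mathbb{U}_n$. $C^*(X,.)$ is the $C^*$-algebra of continuous $f\colon X\to M_n$ vanishing at infinity with $f(\mathfrak{u}.x)=\mathfrak{u}.f(x)$. For a Borel set $A$, $\mathfrak{u}.A=\{\mathfrak{u}.a:a\in A\}$. An $n$-measure is a matrix $\mu=[\mu_{jk}]$ of regular complex Borel measures on $X$ with $\mu(\mathfrak{u}.A)=\mathfrak{u}.\mu(A)$ for all $\mathfrak{u}$ and Borel $A$, where $\mu(A)=[\mu_{jk}(A)]$; $\mathcal{M}(X,.)$ is the set of all $n$-measures. For bounded Borel $f=[f_{jk}]\colon X\to M_n$, $\int f\,d\mu=\sum_{j,k}\int_X f_{jk}\,d\mu_{kj}$. *)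

theory Defs
  imports "HOL-Analysis.Analysis"
begin

definition cadj :: "complex^'n^'n \<Rightarrow> complex^'n^'n" where
  "cadj U = (\<chi> i j. cnj (U $ j $ i))"

definition unitary :: "complex^'n^'n \<Rightarrow> bool" where
  "unitary U \<longleftrightarrow> U ** cadj U = mat 1 \<and> cadj U ** U = mat 1"

definition cscale :: "complex \<Rightarrow> complex^'n^'n \<Rightarrow> complex^'n^'n" where
  "cscale c A = (\<chi> i j. c * A $ i $ j)"

text \<open>A continuous free action of the projective unitary group U_n / (T I) on X,
  given through its lift to U_n: act U x is the action of the class of U.
  It is a group action of U_n that is trivial on scalar unitaries c I (|c| = 1),
  hence an action of the quotient; freeness means only the scalar unitaries
  fix a point. X is a locally compact Hausdorff space (type class t2_space).\<close>

definition n_space :: "(complex^'n^'n \<Rightarrow> 'x::t2_space \<Rightarrow> 'x) \<Rightarrow> bool" where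
  "n_space act \<longleftrightarrow>
     locally_compact_space (euclidean :: 'x topology) \<and>
     continuous_on ({U. unitary U} \<times> UNIV) (\<lambda>(U, x). act U x) \<and>
     (\<forall>x. act (mat 1) x = x) \<and>
     (\<forall>U V x. unitary U \<and> unitary V \<longrightarrow> act (U ** V) x = act U (act V x)) \<and>
     (\<forall>U c x. unitary U \<and> cmod c = 1 \<longrightarrow> act (mat c ** U) x = act U x) \<and>
     (\<forall>U x. unitary U \<and> act U x = x \<longrightarrow> (\<exists>c. cmod c = 1 \<and> U = mat c))"

definition vanishes_at_infinity :: "('x::topological_space \<Rightarrow> 'b::real_normed_vector) \<Rightarrow> bool" where
  "vanishes_at_infinity f \<longleftrightarrow>
     (\<forall>e>0. \<exists>K. compact K \<and> (\<forall>x. x \<notin> K \<longrightarrow> norm (f x) < e))"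

definition cstar :: "(complex^'n^'n \<Rightarrow> 'x::t2_space \<Rightarrow> 'x) \<Rightarrow> ('x \<Rightarrow> complex^'n^'n) set" where
  "cstar act = {f. continuous_on UNIV f \<and> vanishes_at_infinity f \<and>
      (\<forall>U x. unitary U \<longrightarrow> f (act U x) = U ** f x ** cadj U)}"

definition cstar_norm :: "('x \<Rightarrow> complex^'n^'n) \<Rightarrow> real" where
  "cstar_norm f = (SUP x. onorm (\<lambda>v. f x *v v))"

definition cont_lin_functional ::
  "(complex^'n^'n \<Rightarrow> 'x::t2_space \<Rightarrow> 'x) \<Rightarrow> (('x \<Rightarrow> complex^'n^'n) \<Rightarrow> complex) \<Rightarrow> bool" where
  "cont_lin_functional act \<phi> \<longleftrightarrow>
     (\<forall>f\<in>cstar act. \<forall>g\<in>cstar act. \<phi> (\<lambda>x. f x + g x) = \<phi> f + \<phi> g) \<and>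
     (\<forall>c. \<forall>f\<in>cstar act. \<phi> (\<lambda>x. cscale c (f x)) = c * \<phi> f) \<and>
     (\<forall>f\<in>cstar act. \<forall>e>0. \<exists>d>0. \<forall>g\<in>cstar act.
         cstar_norm (\<lambda>x. g x - f x) < d \<longrightarrow> cmod (\<phi> g - \<phi> f) < e)"

text \<open>A complex Borel measure: a countably additive complex function on the Borel
  sets (normalised to 0 on non-Borel sets, so that it is determined by its values
  on Borel sets).\<close>
definition complex_borel_measure :: "('x::topological_space set \<Rightarrow> complex) \<Rightarrow> bool" where
  "complex_borel_measure \<nu> \<longleftrightarrow>
     (\<forall>A. A \<notin> sets borel \<longrightarrow> \<nu> A = 0) \<and>
     (\<forall>A::nat \<Rightarrow> 'x set. range A \<subseteq> sets borel \<and> disjoint_family A \<longrightarrow>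
         (\<lambda>i. \<nu> (A i)) sums \<nu> (\<Union>i. A i))"

definition cm_var :: "('x::topological_space set \<Rightarrow> complex) \<Rightarrow> 'x set \<Rightarrow> ennreal" where
  "cm_var \<nu> E = (SUP P \<in> {P::nat \<Rightarrow> 'x set. range P \<subseteq> sets borel \<and> disjoint_family P \<and>
                              (\<Union>i. P i) = E}.
                   (\<Sum>i. ennreal (cmod (\<nu> (P i)))))"

definition regular_complex_borel_measure :: "('x::topological_space set \<Rightarrow> complex) \<Rightarrow> bool" where
  "regular_complex_borel_measure \<nu> \<longleftrightarrow>
     complex_borel_measure \<nu> \<and>
     (\<forall>E \<in> sets borel.
        cm_var \<nu> E = (INF U \<in> {U. open U \<and> E \<subseteq> U}. cm_var \<nu> U) \<and>
        cm_var \<nu> E = (SUP K \<in> {K. compact K \<and> K \<subseteq> E}. cm_var \<nu> K))"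

text \<open>Integral of a bounded Borel function against a complex measure nu, defined via
  any decomposition nu = M1 - M2 + i (M3 - M4) into finite positive Borel measures
  (e.g. the Jordan decomposition); the value does not depend on the decomposition.\<close>
definition cm_integral :: "('x::topological_space set \<Rightarrow> complex) \<Rightarrow> ('x \<Rightarrow> complex) \<Rightarrow> complex" where
  "cm_integral \<nu> f = (THE c. \<forall>M1 M2 M3 M4 :: 'x measure.
      (\<forall>M\<in>{M1, M2, M3, M4}. sets M = sets borel \<and> finite_measure M) \<and>
      (\<forall>A\<in>sets borel. \<nu> A = complex_of_real (measure M1 A - measure M2 A)
                               + \<i> * complex_of_real (measure M3 A - measure M4 A))
      \<longrightarrow> c = (integral\<^sup>L M1 f - integral\<^sup>L M2 f) + \<i> * (integral\<^sup>L M3 f - integral\<^sup>L M4 f))"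

definition cm_mat :: "('n \<Rightarrow> 'n \<Rightarrow> 'x set \<Rightarrow> complex) \<Rightarrow> 'x set \<Rightarrow> complex^'n^'n" where
  "cm_mat \<mu> A = (\<chi> j k. \<mu> j k A)"

definition n_measure ::
  "(complex^'n^'n \<Rightarrow> 'x::t2_space \<Rightarrow> 'x) \<Rightarrow> ('n \<Rightarrow> 'n \<Rightarrow> 'x set \<Rightarrow> complex) \<Rightarrow> bool" where
  "n_measure act \<mu> \<longleftrightarrow>
     (\<forall>j k. regular_complex_borel_measure (\<mu> j k)) \<and>
     (\<forall>U A. unitary U \<and> A \<in> sets borel \<longrightarrow>
        cm_mat \<mu> (act U ` A) = U ** cm_mat \<mu> A ** cadj U)"

definition n_integral ::
  "('x::topological_space \<Rightarrow> complex^'n^'n) \<Rightarrow> ('n \<Rightarrow> 'n \<Rightarrow> 'x set \<Rightarrow> complex) \<Rightarrow> complex" where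
  "n_integral f \<mu> = (\<Sum>j\<in>UNIV. \<Sum>k\<in>UNIV. cm_integral (\<mu> k j) (\<lambda>x. f x $ j $ k))"

end

theory Submission
  imports Defs
begin

text \<open>The unitary group acts on \<open>C_0(X, M_n)\<close> by \<open>(translate U F) x = U\<^sup>* F(U.x) U\<close>, with fixed
  space \<open>C\<^sup>*(X,.)\<close>, and averaging projects onto it. A functional \<open>\<phi>\<close> on \<open>C\<^sup>*(X,.)\<close> is extended by
  \<open>\<Phi> F = \<phi> (average F)\<close>; applying the Riesz theorem to the matrix entries of \<open>\<Phi>\<close> gives \<open>\<mu>\<close>, and
  invariance of \<open>\<Phi>\<close> together with uniqueness in the Riesz theorem makes \<open>\<mu>\<close> an n-measure.
  Conversely the integral against an n-measure is invariant, so it takes the same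
  value on \<open>F\<close> and on \<open>average F\<close> and is determined by its restriction to \<open>C\<^sup>*(X,.)\<close>.

  No Haar measure is needed: averaging a continuous function over a finite
  \<open>\<delta>\<close>-net of translates contracts the diameter of its range, because the Frobenius
  distance is bi-invariant, and iterating yields a Banach space valued mean.\<close>

section \<open>The invariant mean on the unitary group\<close>

text \<open>A pointwise average of \<open>F\<close> would leave open whether the result is
  continuous and vanishes at infinity, and whether integration against a measure commutes with
  averaging. So the orbit \<open>U \<mapsto> translate U F\<close> is treated as one norm-continuous
  map into the bounded continuous functions: the closed subspace of functions in \<open>C0\<close>
  retains its mean, and evaluation and integration pass through the mean as bounded linear maps.
  Both invariances of the mean are used. Invariance under \<open>U \<mapsto> U ** V\<close> makes
  the average equivariant, invariance under \<open>U \<mapsto> V ** U\<close> makes \<Phi>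
  invariant. The mean is identified as a value approached by averages of left translates and also by
  averages of right translates; it is unique because a double average over both is close to each. A
  second obstacle is that regularity of a complex measure is phrased through its total variation,
  whereas the Riesz construction yields positive measures. Decompositions into four positive
  measures, each approximable between compact and open sets, translate between the two
  forms.\<close>

lemma cadj_cadj [simp]: "cadj (cadj U) = U"
  by (simp add: cadj_def vec_eq_iff)

lemma cadj_mult: "cadj (U ** V) = cadj V ** cadj U"
  by (simp add: cadj_def vec_eq_iff matrix_matrix_mult_def mult.commute)

lemma cadj_mat_1 [simp]: "cadj (mat 1) = mat 1"
  by (simp add: cadj_def vec_eq_iff mat_def)

lemma unitary_1 [simp]: "unitary (mat 1)"
  by (simp add: unitary_def)

lemma unitary_cadj [simp]: "unitary (cadj U) \<longleftrightarrow> unitary U"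
  by (auto simp: unitary_def)

lemma unitaryD: "unitary U \<Longrightarrow> U ** cadj U = mat 1" "unitary U \<Longrightarrow> cadj U ** U = mat 1"
  by (auto simp: unitary_def)

lemma unitary_mult: "unitary U \<Longrightarrow> unitary V \<Longrightarrow> unitary (U ** V)"
  unfolding unitary_def cadj_mult
  by (metis matrix_mul_assoc matrix_mul_rid)

text \<open>The norm on matrices is the Frobenius norm, and writing its square as the trace of
  \<open>A ** cadj A\<close> turns unitary invariance into the cancellation of
  \<open>V ** cadj V\<close>.\<close>

lemma norm_matrix_power2: "of_real ((norm A)\<^sup>2) = (\<Sum>i\<in>UNIV. (A ** cadj A) $ i $ i)"
  for A :: "complex^'n^'n"
proof -
  have "(norm A)\<^sup>2 = (\<Sum>i\<in>UNIV. \<Sum>j\<in>UNIV. (cmod (A $ i $ j))\<^sup>2)"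
    by (simp add: norm_vec_def L2_set_def sum_nonneg)
  then show ?thesis
    by (simp add: matrix_matrix_mult_def cadj_def complex_mult_cnj cmod_power2)
qed

lemma norm_cadj [simp]: "norm (cadj A) = norm A" for A :: "complex^'n^'n"
proof -
  have "(norm (cadj A))\<^sup>2 = (norm A)\<^sup>2"
    by (simp add: norm_vec_def L2_set_def sum_nonneg cadj_def) (rule sum.swap)
  then show ?thesis by simp
qed

lemma norm_mult_unitary_right:
  fixes A :: "complex^'n^'n" assumes "unitary V" shows "norm (A ** V) = norm A"
proof -
  have "(A ** V) ** cadj (A ** V) = A ** (V ** cadj V) ** cadj A"
    by (simp add: cadj_mult matrix_mul_assoc)
  also have "\<dots> = A ** cadj A"
    by (simp add: unitaryD[OF assms])
  finally have "complex_of_real ((norm (A ** V))\<^sup>2) = of_real ((norm A)\<^sup>2)"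
    unfolding norm_matrix_power2 by simp
  then have "(norm (A ** V))\<^sup>2 = (norm A)\<^sup>2"
    using of_real_eq_iff by blast
  then show ?thesis by simp
qed

lemma norm_mult_unitary_left:
  fixes A :: "complex^'n^'n" assumes "unitary V" shows "norm (V ** A) = norm A"
  by (metis assms cadj_mult norm_cadj norm_mult_unitary_right unitary_cadj)

lemma continuous_on_matrix_mult [continuous_intros]:
  fixes f :: "'a::topological_space \<Rightarrow> complex^'n^'m" and g :: "'a \<Rightarrow> complex^'p^'n"
  assumes "continuous_on S f" "continuous_on S g"
  shows "continuous_on S (\<lambda>x. f x ** g x)"
  unfolding matrix_matrix_mult_def
  by (intro continuous_intros assms)

lemma continuous_on_cadj [continuous_intros]:
  assumes "continuous_on S f"
  shows "continuous_on S (\<lambda>x. cadj (f x))"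
  unfolding cadj_def by (intro continuous_intros assms)

lemma matrix_sub_ldistrib: "A ** (B - C) = A ** B - A ** C"
  for A :: "complex^'n^'m" and B C :: "complex^'p^'n"
  by (simp add: matrix_matrix_mult_def vec_eq_iff sum_subtractf right_diff_distrib)

lemma matrix_sub_rdistrib: "(B - C) ** A = B ** A - C ** A"
  for B C :: "complex^'n^'m" and A :: "complex^'p^'n"
  by (simp add: matrix_matrix_mult_def vec_eq_iff sum_subtractf left_diff_distrib)

text \<open>All unitary matrices have the Frobenius norm of the identity, and the defining equations
  are closed conditions; in finite dimension this is enough.\<close>

lemma compact_unitary: "compact {U :: complex^'n^'n. unitary U}"
proof -
  have "norm U = norm (mat 1 :: complex^'n^'n)" if "unitary U" for U :: "complex^'n^'n"
    using norm_mult_unitary_right[OF that, of "mat 1"] by simp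
  then have "bounded {U :: complex^'n^'n. unitary U}"
    by (metis (mono_tags, lifting) boundedI mem_Collect_eq order_refl)
  moreover have "closed {U :: complex^'n^'n. unitary U}"
    unfolding unitary_def
    by (intro closed_Collect_conj closed_Collect_eq continuous_intros)
  ultimately show ?thesis
    using compact_eq_bounded_closed by blast
qed

section \<open>Averages over finite lists of left translates\<close>

definition lavg :: "(complex^'n^'n) list \<Rightarrow> (complex^'n^'n \<Rightarrow> 'v::real_normed_vector) \<Rightarrow> complex^'n^'n \<Rightarrow> 'v" where
  "lavg l f = (\<lambda>w. (\<Sum>u\<leftarrow>l. f (u ** w)) /\<^sub>R real (length l))"

definition ulist :: "(complex^'n^'n) list \<Rightarrow> bool" where
  "ulist l \<longleftrightarrow> l \<noteq> [] \<and> (\<forall>u\<in>set l. unitary u)"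

lemma norm_sum_list_le: "(\<And>u. u \<in> set l \<Longrightarrow> norm (f u) \<le> B) \<Longrightarrow> norm (\<Sum>u\<leftarrow>l. f u) \<le> real (length l) * B"
  by (induction l) (auto simp: algebra_simps intro: norm_triangle_le add_mono)

lemma norm_mean_list_le:
  assumes "l \<noteq> []" "\<And>u. u \<in> set l \<Longrightarrow> norm (f u) \<le> B"
  shows "norm ((\<Sum>u\<leftarrow>l. f u) /\<^sub>R real (length l)) \<le> B"
proof -
  have "norm (\<Sum>u\<leftarrow>l. f u) / real (length l) \<le> B"
    using norm_sum_list_le[of l f B] assms by (simp add: divide_le_eq mult.commute)
  then show ?thesis by (simp add: divide_inverse mult.commute)
qed

lemma mean_list_diff:
  "(\<Sum>u\<leftarrow>l. f u) /\<^sub>R real (length l) - (\<Sum>u\<leftarrow>l. g u) /\<^sub>R real (length l)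
     = (\<Sum>u\<leftarrow>l. f u - g u) /\<^sub>R real (length l)"
  for f g :: "'a \<Rightarrow> 'v::real_normed_vector"
  by (simp add: sum_list_subtractf scaleR_right_diff_distrib)

lemma mean_list_const: "l \<noteq> [] \<Longrightarrow> (\<Sum>u\<leftarrow>l. c) /\<^sub>R real (length l) = c"
  for c :: "'v::real_normed_vector"
proof -
  assume "l \<noteq> []"
  moreover have "(\<Sum>u\<leftarrow>l. c) = real (length l) *\<^sub>R c"
    by (induction l) (auto simp: algebra_simps)
  ultimately show ?thesis by simp
qed

lemma mean_list_approx:
  fixes f :: "'a \<Rightarrow> 'v::real_normed_vector"
  assumes "l \<noteq> []" "\<And>u. u \<in> set l \<Longrightarrow> norm (f u - c) \<le> B"
  shows "norm ((\<Sum>u\<leftarrow>l. f u) /\<^sub>R real (length l) - c) \<le> B"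
proof -
  have "(\<Sum>u\<leftarrow>l. f u) /\<^sub>R real (length l) - c = (\<Sum>u\<leftarrow>l. f u - c) /\<^sub>R real (length l)"
    using mean_list_diff[of l f "\<lambda>_. c"] mean_list_const[OF assms(1), of c] by simp
  then show ?thesis using norm_mean_list_le[OF assms] by simp
qed

text \<open>Lists, unlike sets, keep the multiplicity of products \<open>v ** u\<close> that
  coincide, so an iterated average is again a uniform average over one list.\<close>

lemma lavg_lavg: "lavg l (lavg l' f) = lavg (concat (map (\<lambda>u. map (\<lambda>v. v ** u) l') l)) f"
proof -
  have len: "length (concat (map (\<lambda>u. map (\<lambda>v. v ** u) l') l)) = length l * length l'"
    by (induction l) auto
  have "(\<Sum>u\<leftarrow>concat (map (\<lambda>u. map (\<lambda>v. v ** u) l') l). f (u ** w)) = (\<Sum>u\<leftarrow>l. \<Sum>v\<leftarrow>l'. f (v ** (u ** w)))" for w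
    by (induction l) (auto simp: o_def matrix_mul_assoc)
  moreover have "(\<Sum>u\<leftarrow>l. h u /\<^sub>R c) = (\<Sum>u\<leftarrow>l. h u) /\<^sub>R c" for h :: "complex^'a^'a \<Rightarrow> 'b" and c
    by (induction l) (auto simp: algebra_simps)
  ultimately show ?thesis
    unfolding lavg_def len by (simp add: mult.commute)
qed

lemma ulist_concat:
  "ulist l \<Longrightarrow> ulist l' \<Longrightarrow> ulist (concat (map (\<lambda>u. map (\<lambda>v. v ** u) l') l))"
  by (auto simp: ulist_def unitary_mult)

lemma sum_list_diff_le:
  fixes f g :: "'a \<Rightarrow> 'v::real_normed_vector"
  assumes "length xs = length ys" "\<And>x y. x \<in> set xs \<Longrightarrow> y \<in> set ys \<Longrightarrow> norm (f x - g y) \<le> D"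
  shows "norm ((\<Sum>x\<leftarrow>xs. f x) - (\<Sum>y\<leftarrow>ys. g y)) \<le> real (length xs) * D"
  using assms
proof (induction xs ys rule: list_induct2)
  case Nil then show ?case by simp
next
  case (Cons x xs y ys)
  have "norm ((f x - g y) + (sum_list (map f xs) - sum_list (map g ys))) \<le> D + real (length xs) * D"
    by (intro norm_triangle_mono Cons) (auto intro: Cons.prems)
  then show ?case by (simp add: algebra_simps)
qed

text \<open>Pairing each translate \<open>u w\<close> with a translate \<open>v w'\<close> along a permutation of the net that
  makes one pair close shows that averaging contracts the diameter of the range.\<close>

lemma lavg_contract:
  fixes f :: "complex^'n^'n \<Rightarrow> 'v::real_normed_vector"
  assumes l: "ulist l" and net: "\<And>g. unitary g \<Longrightarrow> \<exists>u\<in>set l. norm (u - g) < \<delta>"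
    and diam: "\<And>w w'. unitary w \<Longrightarrow> unitary w' \<Longrightarrow> norm (f w - f w') \<le> D"
    and modulus: "\<And>w w'. unitary w \<Longrightarrow> unitary w' \<Longrightarrow> norm (w - w') < \<delta> \<Longrightarrow> norm (f w - f w') \<le> \<epsilon>"
    and w: "unitary w" "unitary w'"
  shows "norm (lavg l f w - lavg l f w') \<le> ((real (length l) - 1) * D + \<epsilon>) / real (length l)"
proof -
  obtain u0 r where l': "l = u0 # r" using l by (cases l) (auto simp: ulist_def)
  have ul: "\<And>u. u \<in> set l \<Longrightarrow> unitary u" using l by (auto simp: ulist_def)
  have u0: "unitary u0" using ul l' by simp
  \<comment> \<open>The net element \<open>v\<close> is near \<open>u0 ** w ** cadj w'\<close>;
    multiplying by the unitary \<open>w'\<close> on the right keeps the distance, so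
    \<open>v ** w'\<close> is within \<delta> of \<open>u0 ** w\<close>.\<close>
  obtain v where v: "v \<in> set l" "norm (v - u0 ** w ** cadj w') < \<delta>"
    using net[of "u0 ** w ** cadj w'"] u0 w unitary_mult unitary_cadj by metis
  have "norm (v ** w' - u0 ** w) = norm ((v - u0 ** w ** cadj w') ** w')"
    by (simp add: matrix_sub_rdistrib flip: matrix_mul_assoc) (simp add: unitaryD w)
  also have "\<dots> < \<delta>" using v w by (simp add: norm_mult_unitary_right)
  finally have close: "norm (f (u0 ** w) - f (v ** w')) \<le> \<epsilon>"
    by (intro modulus unitary_mult u0 w ul v) (simp add: norm_minus_commute)
  have rest: "norm ((\<Sum>u\<leftarrow>r. f (u ** w)) - (\<Sum>u\<leftarrow>remove1 v l. f (u ** w'))) \<le> real (length r) * D"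
  proof (rule sum_list_diff_le)
    have "length l = Suc (length r)" by (simp add: l')
    then show "length r = length (remove1 v l)" using v by (simp add: length_remove1)
    show "norm (f (x ** w) - f (y ** w')) \<le> D" if "x \<in> set r" "y \<in> set (remove1 v l)" for x y
      using that l' ul notin_set_remove1[of y l v] by (intro diam unitary_mult w) auto
  qed
  have "(\<Sum>u\<leftarrow>l. f (u ** w)) - (\<Sum>u\<leftarrow>l. f (u ** w'))
      = (f (u0 ** w) - f (v ** w')) + ((\<Sum>u\<leftarrow>r. f (u ** w)) - (\<Sum>u\<leftarrow>remove1 v l. f (u ** w')))"
    using sum_list_map_remove1[OF v(1), of "\<lambda>u. f (u ** w')"] by (simp add: l')
  then have "norm ((\<Sum>u\<leftarrow>l. f (u ** w)) - (\<Sum>u\<leftarrow>l. f (u ** w'))) \<le> \<epsilon> + real (length r) * D"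
    using close rest norm_triangle_mono by metis
  moreover have "real (length r) = real (length l) - 1" by (simp add: l')
  moreover have "lavg l f w - lavg l f w' = ((\<Sum>u\<leftarrow>l. f (u ** w)) - (\<Sum>u\<leftarrow>l. f (u ** w'))) /\<^sub>R real (length l)"
    by (simp add: lavg_def scaleR_right_diff_distrib)
  ultimately show ?thesis
    by (simp add: divide_right_mono divide_inverse_commute mult_left_mono add.commute)
qed

text \<open>Left multiplication by a unitary is an isometry, so averaging does not spoil the modulus
  of continuity. This lets one \<delta> and one net serve every round of the iteration.\<close>

lemma lavg_modulus:
  fixes f :: "complex^'n^'n \<Rightarrow> 'v::real_normed_vector"
  assumes l: "ulist l"
    and modulus: "\<And>w w'. unitary w \<Longrightarrow> unitary w' \<Longrightarrow> norm (w - w') < \<delta> \<Longrightarrow> norm (f w - f w') \<le> \<epsilon>"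
    and w: "unitary w" "unitary w'" "norm (w - w') < \<delta>"
  shows "norm (lavg l f w - lavg l f w') \<le> \<epsilon>"
proof -
  have "norm (f (u ** w) - f (u ** w')) \<le> \<epsilon>" if "u \<in> set l" for u
  proof -
    have "unitary u" using that l by (auto simp: ulist_def)
    then show ?thesis
      using w by (intro modulus unitary_mult) (auto simp: norm_mult_unitary_left simp flip: matrix_sub_ldistrib)
  qed
  then show ?thesis
    unfolding lavg_def mean_list_diff using l by (intro norm_mean_list_le) (auto simp: ulist_def)
qed

lemma lavg_small_diameter:
  fixes f :: "complex^'n^'n \<Rightarrow> 'v::real_normed_vector"
  assumes cont: "continuous_on {U. unitary U} f" and e: "e > 0"
  shows "\<exists>l. ulist l \<and> (\<forall>w w'. unitary w \<and> unitary w' \<longrightarrow> norm (lavg l f w - lavg l f w') \<le> e)"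
proof -
  have "uniformly_continuous_on {U. unitary U} f"
    using compact_uniformly_continuous[OF cont compact_unitary] .
  then obtain \<delta> where \<delta>: "\<delta> > 0"
    and d: "\<And>w w'. unitary w \<Longrightarrow> unitary w' \<Longrightarrow> norm (w - w') < \<delta> \<Longrightarrow> norm (f w - f w') \<le> e/2"
    unfolding uniformly_continuous_on_def dist_norm using e
    by (metis (no_types, lifting) half_gt_zero less_imp_le mem_Collect_eq)
  obtain B where B: "\<And>w. unitary w \<Longrightarrow> norm (f w) \<le> B"
    using compact_imp_bounded[OF compact_continuous_image[OF cont compact_unitary]]
    unfolding bounded_iff by auto
  obtain k :: "(complex^'n^'n) set"
    where k: "finite k" "k \<subseteq> {U. unitary U}" "{U. unitary U} \<subseteq> (\<Union>x\<in>k. ball x \<delta>)"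
    using seq_compact_imp_totally_bounded[of "{U :: complex^'n^'n. unitary U}"] compact_unitary \<delta>
    unfolding compact_eq_seq_compact_metric by blast
  obtain l where l: "set l = k" using finite_list[OF k(1)] by auto
  have net: "\<exists>u\<in>set l. norm (u - g) < \<delta>" if "unitary g" for g
  proof -
    have "g \<in> (\<Union>x\<in>k. ball x \<delta>)" using k(3) that by blast
    then show ?thesis by (auto simp: l dist_norm)
  qed
  have "l \<noteq> []" using net[of "mat 1"] by auto
  then have ul: "ulist l" using k l by (auto simp: ulist_def)
  define N where "N = real (length l)"
  have N: "N \<ge> 1" using \<open>l \<noteq> []\<close> by (cases l) (auto simp: N_def)
  define q where "q = (N - 1) / N"
  have q: "0 \<le> q" "q < 1" using N by (auto simp: q_def)
  \<comment> \<open>The contraction maps a diameter bound \<open>D\<close> to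
    \<open>q * D + (1 - q) * e/2\<close>, whose fixed point is \<open>e/2\<close>. Starting from
    \<open>e/2 + 2*B\<close>, the excess over \<open>e/2\<close> shrinks by the factor
    \<open>q\<close> in each round.\<close>
  have "\<exists>m. ulist m \<and> (\<forall>w w'. unitary w \<and> unitary w' \<longrightarrow> norm (lavg m f w - lavg m f w') \<le> e/2 + q^n * (2*B))" for n
  proof (induction n)
    case 0
    have "norm (lavg [mat 1] f w - lavg [mat 1] f w') \<le> e/2 + 2*B" if "unitary w" "unitary w'" for w w'
      using norm_triangle_ineq4[of "f w" "f w'"] B[OF that(1)] B[OF that(2)] e by (simp add: lavg_def)
    then show ?case by (intro exI[of _ "[mat 1]"]) (auto simp: ulist_def)
  next
    case (Suc n)
    then obtain m where m: "ulist m"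
      "\<And>w w'. unitary w \<Longrightarrow> unitary w' \<Longrightarrow> norm (lavg m f w - lavg m f w') \<le> e/2 + q^n * (2*B)"
      by blast
    have "norm (lavg l (lavg m f) w - lavg l (lavg m f) w') \<le> e/2 + q^Suc n * (2*B)"
      if "unitary w" "unitary w'" for w w'
    proof -
      have "norm (lavg l (lavg m f) w - lavg l (lavg m f) w') \<le> ((N - 1) * (e/2 + q^n * (2*B)) + e/2) / N"
        unfolding N_def
        by (rule lavg_contract[OF ul net m(2) lavg_modulus[OF m(1) d] that])
      also have "\<dots> = e/2 + q^Suc n * (2*B)"
        using N by (simp add: q_def field_simps)
      finally show ?thesis .
    qed
    then show ?case
      unfolding lavg_lavg using ulist_concat[OF ul m(1)] by blast
  qed
  moreover have "(\<lambda>n. e/2 + q^n * (2*B)) \<longlonglongrightarrow> e/2 + 0 * (2*B)"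
    by (intro tendsto_intros LIMSEQ_power_zero) (use q in auto)
  then have "eventually (\<lambda>n. e/2 + q^n * (2*B) < e) sequentially"
    by (rule order_tendstoD) (use e in auto)
  then obtain n where "e/2 + q^n * (2*B) < e" by (auto simp: eventually_sequentially)
  ultimately show ?thesis by (meson less_imp_le order_trans)
qed

section \<open>Left and right means: existence, uniqueness, invariance\<close>

definition lmean :: "(complex^'n^'n \<Rightarrow> 'v::real_normed_vector) \<Rightarrow> 'v \<Rightarrow> bool" where
  "lmean f c \<longleftrightarrow> (\<forall>e>0. \<exists>l. ulist l \<and> (\<forall>w. unitary w \<longrightarrow> norm (lavg l f w - c) \<le> e))"

text \<open>Inversion turns averages over right translates into averages over left translates.\<close>

definition rmean :: "(complex^'n^'n \<Rightarrow> 'v::real_normed_vector) \<Rightarrow> 'v \<Rightarrow> bool" where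
  "rmean f c \<longleftrightarrow> lmean (\<lambda>w. f (cadj w)) c"

lemma lmeanE:
  assumes "lmean f c" "e > 0"
  obtains l where "ulist l" "\<And>w. unitary w \<Longrightarrow> norm (lavg l f w - c) \<le> e"
  using assms unfolding lmean_def by blast

lemma lmeanI:
  "(\<And>e. e > 0 \<Longrightarrow> \<exists>l. ulist l \<and> (\<forall>w. unitary w \<longrightarrow> norm (lavg l f w - c) \<le> e)) \<Longrightarrow> lmean f c"
  by (simp add: lmean_def)

text \<open>The double average of \<open>f (u ** cadj v)\<close> over \<open>u\<close> in
  \<open>l\<close> and \<open>v\<close> in \<open>r\<close> can be summed in either order. Summing
  over \<open>u\<close> first gives left averages, all near \<open>c\<close>; summing over
  \<open>v\<close> first gives right averages, all near \<open>d\<close>.\<close>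

lemma approx_means_close:
  fixes f :: "complex^'n^'n \<Rightarrow> 'v::real_normed_vector"
  assumes l: "ulist l" "\<And>w. unitary w \<Longrightarrow> norm (lavg l f w - c) \<le> e"
    and r: "ulist r" "\<And>w. unitary w \<Longrightarrow> norm (lavg r (\<lambda>w. f (cadj w)) w - d) \<le> e'"
  shows "norm (c - d) \<le> e + e'"
proof -
  let ?A = "(\<Sum>v\<leftarrow>r. lavg l f (cadj v)) /\<^sub>R real (length r)"
  have 1: "norm (?A - c) \<le> e"
    using l r(1) by (intro mean_list_approx) (auto simp: ulist_def)
  have 2: "norm ((\<Sum>u\<leftarrow>l. lavg r (\<lambda>w. f (cadj w)) (cadj u)) /\<^sub>R real (length l) - d) \<le> e'"
    using r l(1) by (intro mean_list_approx) (auto simp: ulist_def)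
  have *: "(\<Sum>u\<leftarrow>k. h u /\<^sub>R a) = (\<Sum>u\<leftarrow>k. h u) /\<^sub>R a" for h :: "complex^'n^'n \<Rightarrow> 'v" and a k
    by (induction k) (auto simp: algebra_simps)
  have "(\<Sum>u\<leftarrow>l. \<Sum>v\<leftarrow>r. f (u ** cadj v)) = (\<Sum>v\<leftarrow>r. \<Sum>u\<leftarrow>l. f (u ** cadj v))"
    by (induction l) (auto simp: sum_list_addf)
  then have "(\<Sum>u\<leftarrow>l. lavg r (\<lambda>w. f (cadj w)) (cadj u)) /\<^sub>R real (length l) = ?A"
    unfolding lavg_def * by (simp add: cadj_mult mult.commute)
  then show ?thesis
    using 1 2 norm_triangle_ineq4[of "?A - d" "?A - c"] by simp
qed

lemma lmean_limit:
  assumes L: "\<And>n. ulist (L n)"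
      "\<And>n w w'. unitary w \<Longrightarrow> unitary w' \<Longrightarrow> norm (lavg (L n) f w - lavg (L n) f w') \<le> inverse (real (Suc n))"
    and a: "(\<lambda>n. lavg (L n) f (mat 1)) \<longlonglongrightarrow> a"
  shows "lmean f a"
proof (rule lmeanI)
  fix e :: real assume "e > 0"
  then have e2: "e/2 > 0" by simp
  have "eventually (\<lambda>n. inverse (real (Suc n)) < e/2 \<and> dist (lavg (L n) f (mat 1)) a < e/2) sequentially"
    by (intro eventually_conj order_tendstoD(2)[OF LIMSEQ_inverse_real_of_nat e2] tendstoD[OF a e2])
  then obtain n where n: "inverse (real (Suc n)) < e/2" "norm (lavg (L n) f (mat 1) - a) < e/2"
    by (auto simp: eventually_sequentially dist_norm)
  have "norm (lavg (L n) f w - a) \<le> e" if "unitary w" for w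
    using L(2)[OF that unitary_1, of n] n
      norm_triangle_ineq[of "lavg (L n) f w - lavg (L n) f (mat 1)" "lavg (L n) f (mat 1) - a"] by simp
  then show "\<exists>l. ulist l \<and> (\<forall>w. unitary w \<longrightarrow> norm (lavg l f w - a) \<le> e)" using L(1) by blast
qed

lemma continuous_on_unitary_cadj:
  "continuous_on {U. unitary U} f \<Longrightarrow> continuous_on {U. unitary U} (\<lambda>w. f (cadj w))"
  by (erule continuous_on_compose2) (auto intro!: continuous_intros)

lemma two_sided_mean_exists:
  fixes f :: "complex^'n^'n \<Rightarrow> 'v::banach"
  assumes cont: "continuous_on {U. unitary U} f"
  shows "\<exists>c. lmean f c \<and> rmean f c"
proof -
  have ex: "\<exists>L. \<forall>n. ulist (L n) \<and> (\<forall>w w'. unitary w \<and> unitary w' \<longrightarrow> norm (lavg (L n) g w - lavg (L n) g w') \<le> inverse (real (Suc n)))"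
    if "continuous_on {U. unitary U} g" for g :: "complex^'n^'n \<Rightarrow> 'v"
    by (intro choice allI lavg_small_diameter[OF that]) simp
  let ?g = "\<lambda>w. f (cadj w)"
  obtain L where L: "\<And>n. ulist (L n)"
      "\<And>n w w'. unitary w \<Longrightarrow> unitary w' \<Longrightarrow> norm (lavg (L n) f w - lavg (L n) f w') \<le> inverse (real (Suc n))"
    using ex[OF cont] by blast
  obtain R where R: "\<And>n. ulist (R n)"
      "\<And>n w w'. unitary w \<Longrightarrow> unitary w' \<Longrightarrow> norm (lavg (R n) ?g w - lavg (R n) ?g w') \<le> inverse (real (Suc n))"
    using ex[OF continuous_on_unitary_cadj[OF cont]] by blast
  define c where "c n = lavg (L n) f (mat 1)" for n
  define d where "d n = lavg (R n) ?g (mat 1)" for n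
  have cd: "norm (c n - d m) \<le> inverse (real (Suc n)) + inverse (real (Suc m))" for n m
    unfolding c_def d_def by (rule approx_means_close[OF L(1) L(2) R(1) R(2)]) auto
  have inv0: "(\<lambda>n. inverse (real (Suc n))) \<longlonglongrightarrow> 0" by (rule LIMSEQ_inverse_real_of_nat)
  \<comment> \<open>Two left approximations are not compared directly; both are close to the right
    approximation \<open>d N\<close>, which gives four terms below \<open>e/4\<close>.\<close>
  have "Cauchy c"
  proof (rule metric_CauchyI)
    fix e :: real assume "e > 0"
    have "eventually (\<lambda>n. inverse (real (Suc n)) < e/4) sequentially"
      by (rule order_tendstoD(2)[OF inv0]) (use \<open>e > 0\<close> in simp)
    then obtain N where N: "\<And>n. n \<ge> N \<Longrightarrow> inverse (real (Suc n)) < e/4"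
      by (auto simp: eventually_sequentially)
    have "dist (c m) (c n) < e" if "m \<ge> N" "n \<ge> N" for m n
    proof -
      have "dist (c m) (c n) \<le> norm (c m - d N) + norm (c n - d N)"
        by (metis dist_norm dist_triangle2)
      then show ?thesis using cd[of m N] cd[of n N] N[of N] N[OF that(1)] N[OF that(2)] by simp
    qed
    then show "\<exists>M. \<forall>m\<ge>M. \<forall>n\<ge>M. dist (c m) (c n) < e" by blast
  qed
  then obtain a where a: "c \<longlonglongrightarrow> a" using Cauchy_convergent_iff convergent_def by blast
  have "(\<lambda>n. c n - d n) \<longlonglongrightarrow> 0"
  proof (rule Lim_null_comparison)
    show "\<forall>\<^sub>F n in sequentially. norm (c n - d n) \<le> inverse (real (Suc n)) + inverse (real (Suc n))"
      by (intro always_eventually allI cd)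
    show "(\<lambda>n. inverse (real (Suc n)) + inverse (real (Suc n))) \<longlonglongrightarrow> 0"
      using tendsto_add[OF inv0 inv0] by simp
  qed
  from tendsto_diff[OF a this] have b: "d \<longlonglongrightarrow> a" by simp
  have "lmean f a" by (rule lmean_limit[OF L]) (use a in \<open>simp_all add: c_def[abs_def]\<close>)
  moreover have "rmean f a"
    unfolding rmean_def by (rule lmean_limit[OF R]) (use b in \<open>simp_all add: d_def[abs_def]\<close>)
  ultimately show ?thesis by blast
qed

lemma lmean_rmean_unique:
  assumes "lmean f c" "rmean f d" shows "c = d"
proof -
  have "norm (c - d) \<le> 0 + e" if "e > 0" for e
  proof -
    have e2: "e/2 > 0" using that by simp
    obtain l where l: "ulist l" "\<And>w. unitary w \<Longrightarrow> norm (lavg l f w - c) \<le> e/2"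
      using assms(1) e2 unfolding lmean_def by blast
    obtain r where r: "ulist r" "\<And>w. unitary w \<Longrightarrow> norm (lavg r (\<lambda>w. f (cadj w)) w - d) \<le> e/2"
      using assms(2) e2 unfolding rmean_def lmean_def by blast
    from approx_means_close[OF l r] show ?thesis by simp
  qed
  then have "norm (c - d) \<le> 0" by (rule field_le_epsilon)
  then show ?thesis by simp
qed

lemma lmean_const: "lmean (\<lambda>_. c) c"
  by (rule lmeanI, rule exI[of _ "[mat 1]"]) (simp add: ulist_def lavg_def)

lemma lmean_cong:
  assumes "\<And>u. unitary u \<Longrightarrow> f u = g u" "lmean f c" shows "lmean g c"
proof (rule lmeanI)
  fix e :: real assume e: "e > 0"
  obtain l where l: "ulist l" "\<And>w. unitary w \<Longrightarrow> norm (lavg l f w - c) \<le> e"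
    using lmeanE[OF assms(2) e] by blast
  have "lavg l f w = lavg l g w" if "unitary w" for w
    unfolding lavg_def using that assms(1) l(1)
    by (auto simp: ulist_def unitary_mult intro!: arg_cong[where f = "\<lambda>x. x /\<^sub>R _"] arg_cong[where f = sum_list] map_cong)
  then show "\<exists>l. ulist l \<and> (\<forall>w. unitary w \<longrightarrow> norm (lavg l g w - c) \<le> e)" using l by metis
qed

lemma lmean_bounded_linear:
  assumes f: "lmean f c" and h: "bounded_linear h" shows "lmean (\<lambda>u. h (f u)) (h c)"
proof (rule lmeanI)
  interpret bounded_linear h by fact
  fix e :: real assume e: "e > 0"
  obtain K where K: "K > 0" "\<And>x. norm (h x) \<le> norm x * K" using pos_bounded by blast
  have eK: "e / K > 0" using e K(1) by simp
  obtain l where l: "ulist l" "\<And>w. unitary w \<Longrightarrow> norm (lavg l f w - c) \<le> e / K"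
    using lmeanE[OF f eK] by blast
  have "h (\<Sum>u\<leftarrow>l. g u) = (\<Sum>u\<leftarrow>l. h (g u))" for g :: "complex^'a^'a \<Rightarrow> 'b"
    by (induction l) (auto simp: zero add)
  then have avg: "lavg l (\<lambda>u. h (f u)) w = h (lavg l f w)" for w by (simp add: lavg_def scaleR)
  have "norm (lavg l (\<lambda>u. h (f u)) w - h c) \<le> e" if "unitary w" for w
  proof -
    have "norm (lavg l (\<lambda>u. h (f u)) w - h c) \<le> norm (lavg l f w - c) * K"
      using K(2)[of "lavg l f w - c"] by (simp add: avg diff)
    also have "\<dots> \<le> e" using l(2)[OF that] K(1) by (simp add: pos_le_divide_eq)
    finally show ?thesis .
  qed
  then show "\<exists>l. ulist l \<and> (\<forall>w. unitary w \<longrightarrow> norm (lavg l (\<lambda>u. h (f u)) w - h c) \<le> e)" using l(1) by blast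
qed

text \<open>Replacing each \<open>u\<close> in the list by \<open>cadj v ** u\<close> undoes the
  translation. For right translates the list can stay, since the estimate holds at every
  \<open>w\<close> and in particular at \<open>w ** v\<close>.\<close>

lemma lmean_translate_left:
  assumes f: "lmean f c" and v: "unitary v" shows "lmean (\<lambda>u. f (v ** u)) c"
proof (rule lmeanI)
  fix e :: real assume e: "e > 0"
  obtain l where l: "ulist l" "\<And>w. unitary w \<Longrightarrow> norm (lavg l f w - c) \<le> e"
    using lmeanE[OF f e] by blast
  have "lavg (map (\<lambda>u. cadj v ** u) l) (\<lambda>u. f (v ** u)) w = lavg l f w" for w
    by (simp add: lavg_def o_def matrix_mul_assoc unitaryD v)
  moreover have "ulist (map (\<lambda>u. cadj v ** u) l)" using l(1) v by (auto simp: ulist_def unitary_mult)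
  ultimately show "\<exists>l. ulist l \<and> (\<forall>w. unitary w \<longrightarrow> norm (lavg l (\<lambda>u. f (v ** u)) w - c) \<le> e)"
    using l(2) by metis
qed

lemma lmean_translate_right:
  assumes f: "lmean f c" and v: "unitary v" shows "lmean (\<lambda>u. f (u ** v)) c"
proof (rule lmeanI)
  fix e :: real assume e: "e > 0"
  obtain l where l: "ulist l" "\<And>w. unitary w \<Longrightarrow> norm (lavg l f w - c) \<le> e"
    using lmeanE[OF f e] by blast
  have "lavg l (\<lambda>u. f (u ** v)) w = lavg l f (w ** v)" for w
    by (simp add: lavg_def matrix_mul_assoc)
  then show "\<exists>l. ulist l \<and> (\<forall>w. unitary w \<longrightarrow> norm (lavg l (\<lambda>u. f (u ** v)) w - c) \<le> e)"
    using l v by (metis unitary_mult)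
qed

text \<open>Requiring both kinds of mean makes the description unique, because
  \<open>lmean_rmean_unique\<close> compares a left mean with a right mean.\<close>

definition umean :: "(complex^'n^'n \<Rightarrow> 'v::banach) \<Rightarrow> 'v" where
  "umean f = (THE c. lmean f c \<and> rmean f c)"

lemma umean_eqI: "lmean f c \<Longrightarrow> rmean f c \<Longrightarrow> umean f = c"
  unfolding umean_def by (rule the_equality) (auto dest: lmean_rmean_unique)

lemma umean_means:
  assumes "continuous_on {U. unitary U} f"
  shows "lmean f (umean f)" "rmean f (umean f)"
  using two_sided_mean_exists[OF assms] umean_eqI[of f] by auto

lemma umean_const: "umean (\<lambda>_. c) = c"
  by (intro umean_eqI) (simp_all add: rmean_def lmean_const)

lemma umean_cong:
  assumes "\<And>u. unitary u \<Longrightarrow> f u = g u" shows "umean f = umean g"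
proof -
  have "lmean f c = lmean g c" "rmean f c = rmean g c" for c
    unfolding rmean_def using assms by (auto intro: lmean_cong[of f g] lmean_cong[of g f]
        lmean_cong[of "\<lambda>w. f (cadj w)" "\<lambda>w. g (cadj w)"] lmean_cong[of "\<lambda>w. g (cadj w)" "\<lambda>w. f (cadj w)"])
  then show ?thesis by (simp add: umean_def)
qed

lemma umean_bounded_linear:
  assumes "continuous_on {U. unitary U} f" "bounded_linear h"
  shows "umean (\<lambda>u. h (f u)) = h (umean f)"
  using umean_means[OF assms(1)] unfolding rmean_def
  by (intro umean_eqI) (auto simp: rmean_def intro: lmean_bounded_linear assms(2))

text \<open>The lists that approximate the means of \<open>f\<close> and of \<open>g\<close> may
  differ. The mean of the pair in the product space comes with a common list, and addition is
  bounded linear there.\<close>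

lemma umean_add:
  assumes "continuous_on {U. unitary U} f" "continuous_on {U. unitary U} g"
  shows "umean (\<lambda>u. f u + g u) = umean f + umean g"
proof -
  let ?p = "\<lambda>u. (f u, g u)"
  have c: "continuous_on {U. unitary U} ?p" by (intro continuous_intros assms)
  have "umean (\<lambda>u. f u + g u) = umean (\<lambda>u. fst (?p u) + snd (?p u))" by simp
  also have "\<dots> = fst (umean ?p) + snd (umean ?p)"
    by (rule umean_bounded_linear[OF c]) (intro bounded_linear_add bounded_linear_fst bounded_linear_snd)
  also have "\<dots> = umean f + umean g"
    using umean_bounded_linear[OF c bounded_linear_fst] umean_bounded_linear[OF c bounded_linear_snd] by simp
  finally show ?thesis .
qed

lemma umean_translate_left:
  assumes "continuous_on {U. unitary U} f" and v: "unitary v"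
  shows "umean (\<lambda>u. f (v ** u)) = umean f"
proof (rule umean_eqI)
  show "lmean (\<lambda>u. f (v ** u)) (umean f)" by (rule lmean_translate_left[OF umean_means(1)[OF assms(1)] v])
  show "rmean (\<lambda>u. f (v ** u)) (umean f)"
    using lmean_translate_right[OF umean_means(2)[OF assms(1), unfolded rmean_def], of "cadj v"] v
    by (simp add: rmean_def cadj_mult)
qed

lemma umean_translate_right:
  assumes "continuous_on {U. unitary U} f" and v: "unitary v"
  shows "umean (\<lambda>u. f (u ** v)) = umean f"
proof (rule umean_eqI)
  show "lmean (\<lambda>u. f (u ** v)) (umean f)" by (rule lmean_translate_right[OF umean_means(1)[OF assms(1)] v])
  show "rmean (\<lambda>u. f (u ** v)) (umean f)"
    using lmean_translate_left[OF umean_means(2)[OF assms(1), unfolded rmean_def], of "cadj v"] v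
    by (simp add: rmean_def cadj_mult)
qed

lemma norm_umean_le:
  assumes cont: "continuous_on {U. unitary U} f" and B: "\<And>u. unitary u \<Longrightarrow> norm (f u) \<le> B"
  shows "norm (umean f) \<le> B"
proof (rule field_le_epsilon)
  fix e :: real assume "e > 0"
  obtain l where l: "ulist l" "\<And>w. unitary w \<Longrightarrow> norm (lavg l f w - umean f) \<le> e"
    using umean_means(1)[OF cont] \<open>e > 0\<close> unfolding lmean_def by blast
  have "norm (lavg l f (mat 1)) \<le> B"
    unfolding lavg_def using l(1) by (intro norm_mean_list_le) (auto simp: ulist_def B)
  with l(2)[OF unitary_1] show "norm (umean f) \<le> B + e"
    using norm_triangle_ineq4[of "lavg l f (mat 1)" "lavg l f (mat 1) - umean f"] by simp
qed

text \<open>Finite averages stay in a subspace and closedness keeps their limit; this is how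
  averages of orbits remain in \<open>C0\<close>.\<close>

lemma umean_closed_subspace:
  assumes cont: "continuous_on {U. unitary U} f" and S: "closed S" "subspace S"
    and f: "\<And>u. unitary u \<Longrightarrow> f u \<in> S"
  shows "umean f \<in> S"
proof -
  have "\<exists>y\<in>S. dist y (umean f) < e" if e: "e > 0" for e
  proof -
    obtain l where l: "ulist l" "\<And>w. unitary w \<Longrightarrow> norm (lavg l f w - umean f) \<le> e/2"
      using umean_means(1)[OF cont] half_gt_zero[OF e] unfolding lmean_def by blast
    have "(\<Sum>u\<leftarrow>l. f (u ** mat 1)) \<in> S"
      using l(1)[unfolded ulist_def, THEN conjunct2]
      by (induction l) (auto intro: subspace_0[OF S(2)] subspace_add[OF S(2)] f)
    then have "lavg l f (mat 1) \<in> S" unfolding lavg_def by (intro subspace_scale[OF S(2)])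
    moreover have "norm (lavg l f (mat 1) - umean f) < e" using l(2)[OF unitary_1] e by simp
    ultimately show ?thesis by (auto simp: dist_norm)
  qed
  then show ?thesis using S(1) closed_approachable by blast
qed

section \<open>Jordan decomposition of signed measures\<close>

locale vector_measure =
  fixes M :: "'a measure" and \<sigma> :: "'a set \<Rightarrow> 'b::real_normed_vector"
  assumes sums: "range A \<subseteq> sets M \<Longrightarrow> disjoint_family A \<Longrightarrow> (\<lambda>i::nat. \<sigma> (A i)) sums \<sigma> (\<Union>i. A i)"
begin

text \<open>Countable additivity on the constant family of empty sets makes a constant series
  converge, which forces its term to be 0.\<close>

lemma empty [simp]: "\<sigma> {} = 0"
proof -
  have "(\<lambda>i::nat. \<sigma> {}) sums \<sigma> (\<Union>i::nat. {})"
    by (rule sums) (auto simp: disjoint_family_on_def)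
  then have "(\<lambda>i::nat. \<sigma> {}) \<longlonglongrightarrow> 0" by (intro summable_LIMSEQ_zero sums_summable)
  then show ?thesis by (simp add: LIMSEQ_const_iff)
qed

lemma Un:
  assumes "A \<in> sets M" "B \<in> sets M" "A \<inter> B = {}"
  shows "\<sigma> (A \<union> B) = \<sigma> A + \<sigma> B"
proof -
  have "(\<lambda>i. \<sigma> (binaryset A B i)) sums \<sigma> (\<Union>i. binaryset A B i)"
    using assms by (intro sums) (auto simp: range_binaryset_eq disjoint_family_on_def binaryset_def)
  moreover have "(\<lambda>i. \<sigma> (binaryset A B i)) sums (\<Sum>i\<in>{0,1}. \<sigma> (binaryset A B i))"
    by (rule sums_finite) (auto simp: binaryset_def)
  ultimately show ?thesis
    by (simp add: UN_binaryset_eq sums_iff) (simp add: binaryset_def)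
qed

lemma Diff:
  assumes "A \<in> sets M" "B \<in> sets M" "A \<subseteq> B"
  shows "\<sigma> (B - A) = \<sigma> B - \<sigma> A"
  using Un[of A "B - A"] assms by (simp add: Un_absorb1)

end

lemma (in vector_measure) bounded_linear_image:
  assumes "bounded_linear h" shows "vector_measure M (\<lambda>A. h (\<sigma> A))"
  by unfold_locales (rule bounded_linear.sums[OF assms sums])

text \<open>Greedy exhaustion: successively removing sets of the family whose measure is at least
  half the supremum (capped at 1) leaves no set of positive measure, since the
  measures of the removed sets are summable.\<close>

lemma exhaustion:
  fixes M :: "'a measure" and \<tau> :: "'a set \<Rightarrow> real"
  assumes vm: "vector_measure M \<tau>" and F: "F \<subseteq> sets M" "{} \<in> F" and D: "D \<in> sets M"
  shows "\<exists>B :: nat \<Rightarrow> 'a set. range B \<subseteq> F \<and> disjoint_family B \<and> (\<forall>n. B n \<subseteq> D) \<and> (\<forall>n. 0 \<le> \<tau> (B n)) \<and>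
    (\<forall>C\<in>F. C \<subseteq> D - (\<Union>n. B n) \<longrightarrow> \<tau> C \<le> 0)"
proof -
  interpret t: vector_measure M \<tau> by fact
  \<comment> \<open>Nothing is known yet about the boundedness of \<tau>, so the supremum may be
    infinite. The cap at 1 lets any set of measure at least 1 serve in that case.\<close>
  have pick: "\<exists>B\<in>F. B \<subseteq> D \<and> 0 \<le> \<tau> B \<and> (\<forall>C\<in>F. C \<subseteq> D \<longrightarrow> min 1 (\<tau> C / 2) \<le> \<tau> B)" for D
  proof (cases "\<exists>C\<in>F. C \<subseteq> D \<and> 1 \<le> \<tau> C")
    case True
    then show ?thesis by (metis min.cobounded1 order_trans zero_le_one)
  next
    case False
    then have le1: "\<And>C. C \<in> F \<Longrightarrow> C \<subseteq> D \<Longrightarrow> \<tau> C \<le> 1" by (meson linear)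
    let ?S = "\<tau> ` {C\<in>F. C \<subseteq> D}"
    have bdd: "bdd_above ?S" using le1 by (intro bdd_aboveI[of _ 1]) auto
    have up: "\<And>C. C \<in> F \<Longrightarrow> C \<subseteq> D \<Longrightarrow> \<tau> C \<le> Sup ?S" by (intro cSup_upper bdd) auto
    show ?thesis
    proof (cases "Sup ?S > 0")
      case True
      have "\<exists>y\<in>?S. Sup ?S / 2 < y" using True F by (subst less_cSup_iff[symmetric]) (auto intro: bdd)
      then obtain B where B: "B \<in> F" "B \<subseteq> D" "Sup ?S / 2 < \<tau> B" by auto
      have "min 1 (\<tau> C / 2) \<le> \<tau> B" if "C \<in> F" "C \<subseteq> D" for C using up[OF that] B by linarith
      then show ?thesis using B True by (intro bexI[of _ B]) auto
    next
      case False
      have "min 1 (\<tau> C / 2) \<le> \<tau> {}" if "C \<in> F" "C \<subseteq> D" for C using up[OF that] False by simp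
      then show ?thesis using F by (intro bexI[of _ "{}"]) auto
    qed
  qed
  define b where "b D = (SOME B. B \<in> F \<and> B \<subseteq> D \<and> 0 \<le> \<tau> B \<and> (\<forall>C\<in>F. C \<subseteq> D \<longrightarrow> min 1 (\<tau> C / 2) \<le> \<tau> B))" for D
  have b: "b D \<in> F \<and> b D \<subseteq> D \<and> 0 \<le> \<tau> (b D) \<and> (\<forall>C\<in>F. C \<subseteq> D \<longrightarrow> min 1 (\<tau> C / 2) \<le> \<tau> (b D))" for D
    unfolding b_def by (rule someI_ex) (use pick[of D] in blast)
  define R where "R = rec_nat D (\<lambda>_ E. E - b E)"
  have R: "R 0 = D" "\<And>n. R (Suc n) = R n - b (R n)" by (auto simp: R_def)
  have dec: "R n \<subseteq> R m" if "m \<le> n" for m n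
    using that by (rule lift_Suc_antimono_le[rotated]) (auto simp: R)
  define B where "B n = b (R n)" for n
  have disj: "B m \<inter> B n = {}" if "m < n" for m n
  proof -
    have "B n \<subseteq> R (Suc m)" using b[of "R n"] dec[of "Suc m" n] that by (auto simp: B_def)
    then show ?thesis by (auto simp: R B_def)
  qed
  then have "disjoint_family B"
    unfolding disjoint_family_on_def by (metis Int_commute linorder_neqE_nat)
  moreover have BF: "range B \<subseteq> F" using b by (auto simp: B_def)
  moreover have "B n \<subseteq> D" for n using b[of "R n"] dec[of 0 n] by (auto simp: B_def R)
  moreover have "0 \<le> \<tau> (B n)" for n using b by (auto simp: B_def)
  moreover have "\<tau> C \<le> 0" if C: "C \<in> F" "C \<subseteq> D - (\<Union>n. B n)" for C
  proof (rule ccontr)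
    assume pos: "\<not> \<tau> C \<le> 0"
    have CR: "C \<subseteq> R n" for n
    proof (induction n)
      case 0 show ?case using C by (auto simp: R)
    next
      case (Suc n) then show ?case using C by (auto simp: R B_def)
    qed
    have "(\<lambda>n. \<tau> (B n)) sums \<tau> (\<Union>n. B n)"
      using \<open>disjoint_family B\<close> BF F by (intro t.sums) auto
    then have "(\<lambda>n. \<tau> (B n)) \<longlonglongrightarrow> 0" by (intro summable_LIMSEQ_zero sums_summable)
    \<comment> \<open>\<open>C\<close> was a candidate in every round, so each chosen set has at
      least this measure, although the measures of the chosen sets tend to 0.\<close>
    moreover have "min 1 (\<tau> C / 2) \<le> \<tau> (B n)" for n
      using b[of "R n"] C(1) CR[of n] by (auto simp: B_def)
    ultimately have "min 1 (\<tau> C / 2) \<le> 0" by (intro LIMSEQ_le_const) auto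
    then show False using pos by simp
  qed
  ultimately show ?thesis by (intro exI[of _ B] conjI allI ballI impI)
qed

locale signed_measure = vector_measure M \<sigma> for M and \<sigma> :: "'a set \<Rightarrow> real"
begin

text \<open>Exhausting \<open>D\<close> by sets of nonnegative measure can only lower the measure of
  the remainder, and leaves no subset of positive measure in it.\<close>

lemma negative_subset:
  assumes D: "D \<in> sets M"
  shows "\<exists>A\<in>sets M. A \<subseteq> D \<and> \<sigma> A \<le> \<sigma> D \<and> (\<forall>C\<in>sets M. C \<subseteq> A \<longrightarrow> \<sigma> C \<le> 0)"
proof -
  obtain B :: "nat \<Rightarrow> 'a set" where B: "range B \<subseteq> sets M" "disjoint_family B" "\<forall>n. B n \<subseteq> D" "\<forall>n. 0 \<le> \<sigma> (B n)"
    "\<forall>C\<in>sets M. C \<subseteq> D - (\<Union>n. B n) \<longrightarrow> \<sigma> C \<le> 0"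
    using exhaustion[OF vector_measure_axioms order_refl sets.empty_sets D] by (elim exE conjE)
  have "(\<lambda>n. \<sigma> (B n)) sums \<sigma> (\<Union>n. B n)" using B(1,2) by (rule sums)
  then have "0 \<le> \<sigma> (\<Union>n. B n)" using B(4) using suminf_nonneg[of "\<lambda>n. \<sigma> (B n)"] B(4) by (auto simp: sums_iff)
  moreover have U: "(\<Union>n. B n) \<in> sets M" using B(1) by auto
  ultimately have "\<sigma> (D - (\<Union>n. B n)) \<le> \<sigma> D" using B(3) D by (subst Diff) auto
  then show ?thesis using B(5) D U by (intro bexI[of _ "D - (\<Union>n. B n)"]) auto
qed

text \<open>The second exhaustion is measured by -\<sigma> and runs over the sets none of whose
  measurable subsets has positive measure. A set of negative measure outside their union
  \<open>N\<close> would contain, by \<open>negative_subset\<close>, a member of this family with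
  negative measure, and the exhaustion has left none. So the complement of \<open>N\<close> serves
  as \<open>P\<close>.\<close>

theorem Hahn_decomposition:
  obtains P where "P \<in> sets M" "\<And>C. C \<in> sets M \<Longrightarrow> C \<subseteq> P \<Longrightarrow> 0 \<le> \<sigma> C"
    "\<And>C. C \<in> sets M \<Longrightarrow> C \<inter> P = {} \<Longrightarrow> \<sigma> C \<le> 0"
proof -
  let ?F = "{A\<in>sets M. \<forall>C\<in>sets M. C \<subseteq> A \<longrightarrow> \<sigma> C \<le> 0}"
  have vm: "vector_measure M (\<lambda>A. - \<sigma> A)"
    by (rule bounded_linear_image) (intro bounded_linear_minus bounded_linear_ident)
  have F: "?F \<subseteq> sets M" "{} \<in> ?F" "space M \<in> sets M" by auto
  obtain B :: "nat \<Rightarrow> 'a set" where B: "range B \<subseteq> ?F" "disjoint_family B" "\<forall>n. B n \<subseteq> space M" "\<forall>n. 0 \<le> - \<sigma> (B n)"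
    "\<forall>C\<in>?F. C \<subseteq> space M - (\<Union>n. B n) \<longrightarrow> - \<sigma> C \<le> 0"
    using exhaustion[OF vm F] by (elim exE conjE)
  have Bs: "\<And>n. B n \<in> sets M" and Bneg: "\<And>n C. C \<in> sets M \<Longrightarrow> C \<subseteq> B n \<Longrightarrow> \<sigma> C \<le> 0"
    using B(1) by (auto simp: image_subset_iff)
  define N where "N = (\<Union>n. B n)"
  have N: "N \<in> sets M" unfolding N_def using Bs by auto
  have neg: "\<sigma> C \<le> 0" if C: "C \<in> sets M" "C \<subseteq> N" for C
  proof -
    have "(\<lambda>n. \<sigma> (C \<inter> B n)) sums \<sigma> (\<Union>n. C \<inter> B n)"
      using B(2) Bs C by (intro sums) (auto simp: disjoint_family_on_def)
    moreover have "(\<Union>n. C \<inter> B n) = C" using C by (auto simp: N_def)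
    moreover have "\<sigma> (C \<inter> B n) \<le> 0" for n using Bs C by (intro Bneg[of _ n]) auto
    ultimately show ?thesis using sums_le[of "\<lambda>n. \<sigma> (C \<inter> B n)" "\<lambda>_. 0"] by (metis sums_zero)
  qed
  have pos: "0 \<le> \<sigma> C" if C: "C \<in> sets M" "C \<subseteq> space M - N" for C
  proof (rule ccontr)
    assume "\<not> 0 \<le> \<sigma> C"
    moreover obtain A where A: "A \<in> sets M" "A \<subseteq> C" "\<sigma> A \<le> \<sigma> C" "\<forall>C\<in>sets M. C \<subseteq> A \<longrightarrow> \<sigma> C \<le> 0"
      using negative_subset[OF C(1)] by blast
    moreover have "- \<sigma> A \<le> 0" using A C by (intro B(5)[rule_format]) (auto simp: N_def)
    ultimately show False by simp
  qed
  show thesis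
  proof (rule that[of "space M - N"])
    show "\<sigma> C \<le> 0" if "C \<in> sets M" "C \<inter> (space M - N) = {}" for C
      using sets.sets_into_space[OF that(1)] that by (intro neg) auto
  qed (use N pos in auto)
qed

lemma nonneg_measure:
  assumes nonneg: "\<And>A. A \<in> sets M \<Longrightarrow> 0 \<le> \<sigma> A"
  obtains N where "sets N = sets M" "finite_measure N" "\<And>A. A \<in> sets M \<Longrightarrow> measure N A = \<sigma> A"
proof -
  define N where "N = measure_of (space M) (sets M) (\<lambda>A. ennreal (\<sigma> A))"
  have s: "sets N = sets M" by (simp add: N_def)
  have e: "emeasure N A = ennreal (\<sigma> A)" if "A \<in> sets M" for A
    unfolding N_def
  proof (rule emeasure_measure_of_sigma)
    show "positive (sets M) (\<lambda>A. ennreal (\<sigma> A))" by (simp add: positive_def)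
    show "countably_additive (sets M) (\<lambda>A. ennreal (\<sigma> A))"
      unfolding countably_additive_def
    proof (intro allI impI)
      fix A :: "nat \<Rightarrow> 'a set" assume A: "range A \<subseteq> sets M" "disjoint_family A"
      have "(\<lambda>i. \<sigma> (A i)) sums \<sigma> (\<Union>i. A i)" by (rule sums[OF A])
      then show "(\<Sum>i. ennreal (\<sigma> (A i))) = ennreal (\<sigma> (\<Union>i. A i))"
        using A nonneg by (intro suminf_ennreal_eq) auto
    qed
  qed (use that sets.sigma_algebra_axioms in auto)
  have "space N = space M" using s by (rule sets_eq_imp_space_eq)
  then have "finite_measure N" by (intro finite_measureI) (simp add: e)
  then show thesis using that[of N] s e nonneg by (auto simp: measure_def)
qed

text \<open>Being dominated by the variation of \<open>\<sigma>\<close>, both parts inherit its regularity.\<close>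

lemma Jordan_decomposition:
  "\<exists>N1 N2. sets N1 = sets M \<and> finite_measure N1 \<and> sets N2 = sets M \<and> finite_measure N2 \<and>
     (\<forall>A\<in>sets M. \<sigma> A = measure N1 A - measure N2 A) \<and>
     (\<forall>A\<in>sets M. \<exists>B\<in>sets M. B \<subseteq> A \<and> measure N1 A \<le> \<bar>\<sigma> B\<bar>) \<and>
     (\<forall>A\<in>sets M. \<exists>B\<in>sets M. B \<subseteq> A \<and> measure N2 A \<le> \<bar>\<sigma> B\<bar>)"
proof -
  obtain P where P: "P \<in> sets M" "\<And>C. C \<in> sets M \<Longrightarrow> C \<subseteq> P \<Longrightarrow> 0 \<le> \<sigma> C"
    "\<And>C. C \<in> sets M \<Longrightarrow> C \<inter> P = {} \<Longrightarrow> \<sigma> C \<le> 0"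
    using Hahn_decomposition by blast
  have sub: "(\<lambda>i::nat. \<sigma> (h (A i))) sums \<sigma> (h (\<Union>i. A i))"
    if "range A \<subseteq> sets M" "disjoint_family A" "\<And>A. A \<in> sets M \<Longrightarrow> h A \<in> sets M" "\<And>A. h A \<subseteq> A"
      "h (\<Union>i. A i) = (\<Union>i. h (A i))" for h and A :: "nat \<Rightarrow> 'a set"
    unfolding that(5) using that(1,3) disjoint_family_subset[OF that(2), of "\<lambda>i. h (A i)"] that(4)
    by (intro sums) auto
  interpret p: signed_measure M "\<lambda>A. \<sigma> (A \<inter> P)"
    by unfold_locales (rule sub[where h = "\<lambda>A. A \<inter> P"], use P(1) in auto)
  interpret n: signed_measure M "\<lambda>A. - \<sigma> (A - P)"
    by unfold_locales (rule sums_minus, rule sub[where h = "\<lambda>A. A - P"], use P(1) in auto)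
  obtain N1 where N1: "sets N1 = sets M" "finite_measure N1" "\<And>A. A \<in> sets M \<Longrightarrow> measure N1 A = \<sigma> (A \<inter> P)"
    using p.nonneg_measure P(1) P(2) by blast
  have "0 \<le> - \<sigma> (A - P)" if "A \<in> sets M" for A
    using P(3)[of "A - P"] P(1) that by auto
  then obtain N2 where N2: "sets N2 = sets M" "finite_measure N2" "\<And>A. A \<in> sets M \<Longrightarrow> measure N2 A = - \<sigma> (A - P)"
    using n.nonneg_measure by blast
  have "\<sigma> A = \<sigma> (A \<inter> P) + \<sigma> (A - P)" if "A \<in> sets M" for A
    using Un[of "A \<inter> P" "A - P"] that P(1) by (auto simp: Int_Diff_Un)
  then have eq: "\<forall>A\<in>sets M. \<sigma> A = measure N1 A - measure N2 A" by (simp add: N1(3) N2(3))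
  have d1: "\<exists>B\<in>sets M. B \<subseteq> A \<and> measure N1 A \<le> \<bar>\<sigma> B\<bar>" if "A \<in> sets M" for A
    using that P(1) by (intro bexI[of _ "A \<inter> P"]) (auto simp: N1(3))
  have d2: "\<exists>B\<in>sets M. B \<subseteq> A \<and> measure N2 A \<le> \<bar>\<sigma> B\<bar>" if "A \<in> sets M" for A
    using that P(1) by (intro bexI[of _ "A - P"]) (auto simp: N2(3))
  show ?thesis using N1(1,2) N2(1,2) eq d1 d2 by (intro exI[of _ N1] exI[of _ N2] conjI ballI) auto
qed

end

section \<open>Complex Borel measures: integrals and regularity\<close>

definition bounded_borel :: "('x::topological_space \<Rightarrow> complex) \<Rightarrow> bool" where
  "bounded_borel f \<longleftrightarrow> f \<in> borel_measurable borel \<and> (\<exists>B. \<forall>x. cmod (f x) \<le> B)"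

lemma bounded_borel_const [simp]: "bounded_borel (\<lambda>_. c)"
  by (auto simp: bounded_borel_def)

lemma bounded_borel_add:
  assumes "bounded_borel f" "bounded_borel g" shows "bounded_borel (\<lambda>x. f x + g x)"
proof -
  obtain A B where "\<And>x. cmod (f x) \<le> A" "\<And>x. cmod (g x) \<le> B"
    using assms unfolding bounded_borel_def by blast
  then have "\<And>x. cmod (f x + g x) \<le> A + B" by (meson norm_triangle_mono)
  then show ?thesis using assms unfolding bounded_borel_def by (blast intro: borel_measurable_add)
qed

lemma bounded_borel_mult:
  assumes "bounded_borel f" "bounded_borel g" shows "bounded_borel (\<lambda>x. f x * g x)"
proof -
  obtain A B where AB: "\<And>x. cmod (f x) \<le> A" "\<And>x. cmod (g x) \<le> B"
    using assms unfolding bounded_borel_def by blast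
  have "cmod (f x * g x) \<le> A * B" for x
    unfolding norm_mult using AB[of x] by (intro mult_mono) (auto intro: order_trans[OF norm_ge_zero])
  then show ?thesis using assms unfolding bounded_borel_def by (blast intro: borel_measurable_times)
qed

lemma bounded_borel_cmult: "bounded_borel f \<Longrightarrow> bounded_borel (\<lambda>x. c * f x)"
  by (rule bounded_borel_mult) auto

lemma bounded_borel_diff:
  assumes "bounded_borel f" "bounded_borel g" shows "bounded_borel (\<lambda>x. f x - g x)"
  using bounded_borel_add[OF assms(1) bounded_borel_cmult[OF assms(2), of "-1"]] by simp

lemma bounded_borel_indicator: "A \<in> sets borel \<Longrightarrow> bounded_borel (indicator A)"
  unfolding bounded_borel_def by (auto intro!: exI[of _ 1] simp: indicator_def)

lemma bounded_borel_sum: "(\<And>i. i \<in> I \<Longrightarrow> bounded_borel (f i)) \<Longrightarrow> bounded_borel (\<lambda>x. \<Sum>i\<in>I. f i x)"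
  by (induction I rule: infinite_finite_induct) (auto intro: bounded_borel_add)

lemma bounded_borel_compose:
  assumes "bounded_borel f" "continuous_on UNIV t" shows "bounded_borel (\<lambda>x. f (t x))"
proof -
  have "t \<in> borel_measurable borel" using assms(2) by (rule borel_measurable_continuous_onI)
  then have "(\<lambda>x. f (t x)) \<in> borel_measurable borel"
    using assms(1) unfolding bounded_borel_def by (auto intro: measurable_compose)
  then show ?thesis using assms(1) by (auto simp: bounded_borel_def)
qed

text \<open>Integrals against complex measures, their linear combinations and their compositions
  with continuous maps all have this form. Every identity between them is thereby reduced to
  indicators, without reference to the measures behind.\<close>

locale bounded_borel_functional =
  fixes J :: "('x::topological_space \<Rightarrow> complex) \<Rightarrow> complex"
  assumes add: "bounded_borel f \<Longrightarrow> bounded_borel g \<Longrightarrow> J (\<lambda>x. f x + g x) = J f + J g"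
    and cmult: "bounded_borel f \<Longrightarrow> J (\<lambda>x. c * f x) = c * J f"
    and bounded: "\<exists>C. \<forall>f B. bounded_borel f \<longrightarrow> (\<forall>x. cmod (f x) \<le> B) \<longrightarrow> cmod (J f) \<le> C * B"
begin

lemma bound: obtains C where "C > 0" "\<And>f B. bounded_borel f \<Longrightarrow> (\<And>x. cmod (f x) \<le> B) \<Longrightarrow> cmod (J f) \<le> C * B"
proof -
  obtain C where C: "\<And>f B. bounded_borel f \<Longrightarrow> (\<And>x. cmod (f x) \<le> B) \<Longrightarrow> cmod (J f) \<le> C * B"
    using bounded by blast
  have "cmod (J f) \<le> (\<bar>C\<bar> + 1) * B" if "bounded_borel f" "\<And>x. cmod (f x) \<le> B" for f B
  proof -
    have "0 \<le> B" using that(2) order_trans[OF norm_ge_zero] by blast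
    have "C * B \<le> (\<bar>C\<bar> + 1) * B" by (intro mult_right_mono \<open>0 \<le> B\<close>) auto
    with C[OF that] show ?thesis by simp
  qed
  then show thesis using that[of "\<bar>C\<bar> + 1"] by simp
qed

lemma zero: "J (\<lambda>_. 0) = 0"
  using cmult[of "\<lambda>_. 0" 0] by simp

lemma diff: "bounded_borel f \<Longrightarrow> bounded_borel g \<Longrightarrow> J (\<lambda>x. f x - g x) = J f - J g"
  using add[OF _ bounded_borel_cmult, of f g "-1"] cmult[of g "-1"] by simp

lemma sum:
  assumes "\<And>i. i \<in> I \<Longrightarrow> bounded_borel (f i)"
  shows "J (\<lambda>x. \<Sum>i\<in>I. f i x) = (\<Sum>i\<in>I. J (f i))"
  using assms
  by (induction I rule: infinite_finite_induct) (simp_all add: zero add bounded_borel_sum)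

lemma finite_range_zero:
  assumes J0: "\<And>A. A \<in> sets borel \<Longrightarrow> J (indicator A) = 0"
    and f: "f \<in> borel_measurable borel" "finite (range f)"
  shows "J f = 0"
proof -
  have A: "f -` {y} \<in> sets borel" for y
    using measurable_sets[OF f(1), of "{y}"] by simp
  have "f x = (\<Sum>y\<in>range f. y * indicator (f -` {y}) x)" for x
    using f(2) by (simp add: indicator_def if_distrib sum.delta cong: if_cong)
  then have "f = (\<lambda>x. \<Sum>y\<in>range f. y * indicator (f -` {y}) x)" by (rule ext)
  then have "J f = J (\<lambda>x. \<Sum>y\<in>range f. y * indicator (f -` {y}) x)" by (rule arg_cong)
  also have "\<dots> = (\<Sum>y\<in>range f. J (\<lambda>x. y * indicator (f -` {y}) x))"
    by (intro sum bounded_borel_cmult bounded_borel_indicator A)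
  also have "\<dots> = 0"
    by (simp add: cmult bounded_borel_indicator A J0)
  finally show ?thesis .
qed

text \<open>Rounding the real and imaginary parts of \<open>f\<close> down to multiples of
  \<open>1 / N\<close> gives a finite-valued function uniformly close to \<open>f\<close>, and the
  functional is continuous for the supremum norm.\<close>

lemma eq_0_if_zero_on_indicators:
  assumes J0: "\<And>A. A \<in> sets borel \<Longrightarrow> J (indicator A) = 0" and f: "bounded_borel f"
  shows "J f = 0"
proof -
  obtain C where C: "C > 0" "\<And>f B. bounded_borel f \<Longrightarrow> (\<And>x. cmod (f x) \<le> B) \<Longrightarrow> cmod (J f) \<le> C * B"
    using bound by blast
  obtain B where B: "\<And>x. cmod (f x) \<le> B" and fm: "f \<in> borel_measurable borel"
    using f unfolding bounded_borel_def by blast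
  have "cmod (J f) \<le> 0 + e" if "e > 0" for e
  proof -
    \<comment> \<open>Each of the two parts is rounded by at most \<open>1 / N\<close>, so the error
      is at most \<open>C * (2 / N)\<close>, which equals \<open>e\<close> for this real number
      \<open>N\<close>.\<close>
    define N where "N = 2 * C / e"
    have N: "N > 0" using that C(1) by (simp add: N_def)
    define r where "r t = of_int \<lfloor>N * t\<rfloor> / N" for t :: real
    have r1: "\<bar>t - r t\<bar> \<le> 1 / N" for t
    proof -
      have "t - r t = (N * t - of_int \<lfloor>N * t\<rfloor>) / N" using N by (simp add: r_def field_simps)
      moreover have "\<bar>N * t - of_int \<lfloor>N * t\<rfloor>\<bar> \<le> 1" by linarith
      ultimately show ?thesis using N by (simp add: divide_right_mono)
    qed
    have rfin: "finite (r ` {-B..B})"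
    proof -
      have "\<lfloor>N * t\<rfloor> \<in> {\<lfloor>- (N * B)\<rfloor>..\<lfloor>N * B\<rfloor>}" if "t \<in> {-B..B}" for t
      proof -
        have "N * t \<le> N * B" by (rule mult_left_mono) (use that N in auto)
        moreover have "N * (-B) \<le> N * t" by (rule mult_left_mono) (use that N in auto)
        ultimately have "N * t \<le> N * B" "- (N * B) \<le> N * t" by auto
        then show ?thesis by (auto intro!: floor_mono)
      qed
      then have "r ` {-B..B} \<subseteq> (\<lambda>k. of_int k / N) ` {\<lfloor>- (N * B)\<rfloor>..\<lfloor>N * B\<rfloor>}" by (auto simp: r_def)
      then show ?thesis by (rule finite_subset) simp
    qed
    define g where "g x = Complex (r (Re (f x))) (r (Im (f x)))" for x
    have rm: "r \<in> borel_measurable borel" unfolding r_def[abs_def] by measurable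
    have gm: "g \<in> borel_measurable borel"
      unfolding g_def[abs_def] borel_measurable_complex_iff using fm rm by (simp add: measurable_compose)
    have "range g \<subseteq> (\<lambda>(a, b). Complex a b) ` (r ` {-B..B} \<times> r ` {-B..B})"
    proof
      fix y assume "y \<in> range g"
      then obtain x where x: "y = g x" by blast
      have "Re (f x) \<in> {-B..B}" "Im (f x) \<in> {-B..B}"
        using B[of x] abs_Re_le_cmod[of "f x"] abs_Im_le_cmod[of "f x"] by auto
      then show "y \<in> (\<lambda>(a, b). Complex a b) ` (r ` {-B..B} \<times> r ` {-B..B})"
        unfolding x g_def by (intro image_eqI[where x = "(r (Re (f x)), r (Im (f x)))"]) auto
    qed
    then have gfin: "finite (range g)" by (rule finite_subset) (use rfin in blast)
    have fg: "cmod (f x - g x) \<le> 2 / N" for x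
      using cmod_le[of "f x - g x"] r1[of "Re (f x)"] r1[of "Im (f x)"] by (simp add: g_def)
    have gb: "bounded_borel g"
      unfolding bounded_borel_def using gm finite_imp_bounded[OF gfin] by (auto simp: bounded_iff)
    have "J f = J (\<lambda>x. f x - g x)" using diff[OF f gb] finite_range_zero[OF J0 gm gfin] by simp
    also have "cmod \<dots> \<le> C * (2 / N)" by (intro C(2) bounded_borel_diff f gb fg)
    also have "\<dots> = e" using that C(1) by (simp add: N_def)
    finally show ?thesis by simp
  qed
  then have "cmod (J f) \<le> 0" by (rule field_le_epsilon)
  then show ?thesis by simp
qed

end

lemma bounded_borel_functional_lincomb:
  fixes J :: "'i \<Rightarrow> ('x::topological_space \<Rightarrow> complex) \<Rightarrow> complex"
  assumes "\<And>i. i \<in> I \<Longrightarrow> bounded_borel_functional (J i)"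
  shows "bounded_borel_functional (\<lambda>f. \<Sum>i\<in>I. c i * J i f)"
proof
  fix f g :: "'x \<Rightarrow> complex" assume "bounded_borel f" "bounded_borel g"
  then show "(\<Sum>i\<in>I. c i * J i (\<lambda>x. f x + g x)) = (\<Sum>i\<in>I. c i * J i f) + (\<Sum>i\<in>I. c i * J i g)"
    using assms by (simp add: bounded_borel_functional.add distrib_left sum.distrib)
next
  fix f :: "'x \<Rightarrow> complex" and d assume "bounded_borel f"
  then show "(\<Sum>i\<in>I. c i * J i (\<lambda>x. d * f x)) = d * (\<Sum>i\<in>I. c i * J i f)"
    using assms by (simp add: bounded_borel_functional.cmult sum_distrib_left mult.left_commute)
next
  have "\<forall>i\<in>I. \<exists>C. \<forall>f B. bounded_borel f \<longrightarrow> (\<forall>x. cmod (f x) \<le> B) \<longrightarrow> cmod (J i f) \<le> C * B"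
    using assms bounded_borel_functional.bounded by blast
  then obtain C where C: "\<And>i f B. i \<in> I \<Longrightarrow> bounded_borel f \<Longrightarrow> (\<And>x. cmod (f x) \<le> B) \<Longrightarrow> cmod (J i f) \<le> C i * B"
    by metis
  have "cmod (\<Sum>i\<in>I. c i * J i f) \<le> (\<Sum>i\<in>I. cmod (c i) * C i) * B"
    if "bounded_borel f" "\<forall>x. cmod (f x) \<le> B" for f B
    unfolding sum_distrib_right
    by (rule sum_norm_le) (use that in \<open>auto simp: norm_mult mult.assoc intro!: mult_left_mono C\<close>)
  then show "\<exists>C. \<forall>f B. bounded_borel f \<longrightarrow> (\<forall>x. cmod (f x) \<le> B) \<longrightarrow> cmod (\<Sum>i\<in>I. c i * J i f) \<le> C * B"
    by blast
qed

lemma bounded_borel_functional_diff: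
  assumes "bounded_borel_functional J" "bounded_borel_functional J'"
  shows "bounded_borel_functional (\<lambda>f. J f - J' f)"
  using bounded_borel_functional_lincomb[of "{True, False}" "\<lambda>b. if b then J else J'" "\<lambda>b. if b then 1 else -1"] assms
  by simp

lemma bounded_borel_functional_eqI:
  assumes "bounded_borel_functional J" "bounded_borel_functional J'"
    and "\<And>A. A \<in> sets borel \<Longrightarrow> J (indicator A) = J' (indicator A)" and "bounded_borel f"
  shows "J f = J' f"
  using bounded_borel_functional.eq_0_if_zero_on_indicators[OF bounded_borel_functional_diff[OF assms(1,2)] _ assms(4)]
    assms(3) by simp

lemma bounded_borel_functional_compose:
  assumes "bounded_borel_functional J" and t: "continuous_on UNIV t"
  shows "bounded_borel_functional (\<lambda>f. J (\<lambda>x. f (t x)))"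
proof -
  interpret bounded_borel_functional J by fact
  obtain C where "\<And>f B. bounded_borel f \<Longrightarrow> (\<And>x. cmod (f x) \<le> B) \<Longrightarrow> cmod (J f) \<le> C * B"
    using bound by blast
  then show ?thesis
    by unfold_locales (auto simp: add cmult bounded_borel_compose[OF _ t] intro!: exI[of _ C])
qed

lemma bounded_borel_functional_integral:
  assumes M: "sets M = sets borel" "finite_measure M"
  shows "bounded_borel_functional (integral\<^sup>L M)"
proof -
  interpret finite_measure M by fact
  have int: "integrable M f" if f: "bounded_borel f" for f
  proof -
    obtain B where "\<And>x. cmod (f x) \<le> B" using f by (auto simp: bounded_borel_def)
    moreover have "f \<in> borel_measurable M" using f measurable_cong_sets[OF M(1) refl] by (auto simp: bounded_borel_def)
    ultimately show ?thesis by (intro integrable_const_bound[of _ B]) auto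
  qed
  show ?thesis
  proof
    show "\<exists>C. \<forall>f B. bounded_borel f \<longrightarrow> (\<forall>x. cmod (f x) \<le> B) \<longrightarrow> cmod (integral\<^sup>L M f) \<le> C * B"
    proof (intro exI allI impI)
      fix f :: "'a \<Rightarrow> complex" and B assume f: "bounded_borel f" "\<forall>x. cmod (f x) \<le> B"
      have "cmod (integral\<^sup>L M f) \<le> (\<integral>x. cmod (f x) \<partial>M)" by (rule integral_norm_bound)
      also have "\<dots> \<le> (\<integral>x. B \<partial>M)" using f int by (intro integral_mono) auto
      finally show "cmod (integral\<^sup>L M f) \<le> measure M (space M) * B" by simp
    qed
  qed (use int in auto)
qed

section \<open>Integrals through decompositions into four positive measures\<close>

lemma sum_powers_ii: "(\<Sum>i<4. \<i> ^ i * f i) = (f 0 - f 2) + \<i> * (f 1 - f 3)"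
  by (simp add: eval_nat_numeral algebra_simps flip: mult.assoc)

text \<open>The weights \<open>\<i> ^ i\<close> turn the four positive measures of
  \<open>cm_integral\<close> into one indexed sum: indices 0 and 2 give the real part as a
  difference, indices 1 and 3 the imaginary part.\<close>

definition decomposes :: "('x::topological_space set \<Rightarrow> complex) \<Rightarrow> (nat \<Rightarrow> 'x measure) \<Rightarrow> bool" where
  "decomposes \<nu> N \<longleftrightarrow> (\<forall>i<4. sets (N i) = sets borel \<and> finite_measure (N i)) \<and>
     (\<forall>A\<in>sets borel. \<nu> A = (\<Sum>i<4. \<i> ^ i * of_real (measure (N i) A)))"

lemma bounded_borel_functional_decomposition:
  assumes "decomposes \<nu> N"
  shows "bounded_borel_functional (\<lambda>f. \<Sum>i<4. \<i> ^ i * integral\<^sup>L (N i) f)"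
  using assms
  by (intro bounded_borel_functional_lincomb bounded_borel_functional_integral) (auto simp: decomposes_def)

lemma integral_indicator_complex:
  assumes "sets M = sets borel" "finite_measure M" "A \<in> sets borel"
  shows "integral\<^sup>L M (indicator A :: 'x::topological_space \<Rightarrow> complex) = of_real (measure M A)"
proof -
  interpret finite_measure M by fact
  have "integral\<^sup>L M (\<lambda>x. indicator A x *\<^sub>R (1 :: complex)) = measure M A *\<^sub>R 1"
    using assms sets_eq_imp_space_eq[OF assms(1)]
    by (subst integral_scaleR_left) (auto simp: emeasure_eq_measure)
  moreover have "(\<lambda>x. indicator A x *\<^sub>R (1 :: complex)) = indicator A" by (auto simp: indicator_def)
  ultimately have "integral\<^sup>L M (indicator A) = measure M A *\<^sub>R (1 :: complex)" by metis
  then show ?thesis by (simp add: scaleR_conv_of_real)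
qed

lemma decomposition_indicator:
  assumes "decomposes \<nu> N" "A \<in> sets borel"
  shows "(\<Sum>i<4. \<i> ^ i * integral\<^sup>L (N i) (indicator A)) = \<nu> A"
  using assms by (simp add: decomposes_def integral_indicator_complex)

text \<open>Two decompositions of \<nu> give functionals that agree on indicators, hence on all
  bounded Borel functions. So the definite description in \<open>cm_integral\<close> has exactly one
  solution, which any decomposition computes.\<close>

lemma cm_integral_eq:
  assumes N: "decomposes \<nu> N" and f: "bounded_borel f"
  shows "cm_integral \<nu> f = (\<Sum>i<4. \<i> ^ i * integral\<^sup>L (N i) f)"
proof -
  have *: "(\<Sum>i<4. \<i> ^ i * integral\<^sup>L (N i) f) = (\<Sum>i<4. \<i> ^ i * integral\<^sup>L (N' i) f)"
    if "decomposes \<nu> N'" for N'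
    by (rule bounded_borel_functional_eqI[OF bounded_borel_functional_decomposition[OF N]
          bounded_borel_functional_decomposition[OF that] _ f])
      (simp add: decomposition_indicator[OF N] decomposition_indicator[OF that])
  \<comment> \<open>The middle two are exchanged: weight \<open>\<i>\<close> belongs to the third
    measure of \<open>cm_integral\<close> and weight -1 to its second.\<close>
  let ?N = "\<lambda>M1 M2 M3 M4 i. [M1, M3, M2, M4] ! i"
  have dec: "decomposes \<nu> (?N M1 M2 M3 M4)"
    if "\<forall>M\<in>{M1, M2, M3, M4}. sets M = sets borel \<and> finite_measure M"
      "\<forall>A\<in>sets borel. \<nu> A = complex_of_real (measure M1 A - measure M2 A)
                               + \<i> * complex_of_real (measure M3 A - measure M4 A)" for M1 M2 M3 M4
    unfolding decomposes_def sum_powers_ii using that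
    by (auto simp: eval_nat_numeral less_Suc_eq)
  have N': "\<forall>M\<in>{N 0, N 2, N 1, N 3}. sets M = sets borel \<and> finite_measure M"
      "\<forall>A\<in>sets borel. \<nu> A = complex_of_real (measure (N 0) A - measure (N 2) A)
                               + \<i> * complex_of_real (measure (N 1) A - measure (N 3) A)"
    using N unfolding decomposes_def sum_powers_ii by auto
  show ?thesis
    unfolding cm_integral_def
  proof (rule the_equality)
    show "\<forall>M1 M2 M3 M4. (\<forall>M\<in>{M1, M2, M3, M4}. sets M = sets borel \<and> finite_measure M) \<and>
        (\<forall>A\<in>sets borel. \<nu> A = complex_of_real (measure M1 A - measure M2 A)
                               + \<i> * complex_of_real (measure M3 A - measure M4 A)) \<longrightarrow>
        (\<Sum>i<4. \<i> ^ i * integral\<^sup>L (N i) f)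
          = integral\<^sup>L M1 f - integral\<^sup>L M2 f + \<i> * (integral\<^sup>L M3 f - integral\<^sup>L M4 f)"
    proof (intro allI impI, elim conjE)
      fix M1 M2 M3 M4
      assume "\<forall>M\<in>{M1, M2, M3, M4}. sets M = sets borel \<and> finite_measure M"
        "\<forall>A\<in>sets borel. \<nu> A = complex_of_real (measure M1 A - measure M2 A)
                               + \<i> * complex_of_real (measure M3 A - measure M4 A)"
      from *[OF dec[OF this]] show "(\<Sum>i<4. \<i> ^ i * integral\<^sup>L (N i) f)
          = integral\<^sup>L M1 f - integral\<^sup>L M2 f + \<i> * (integral\<^sup>L M3 f - integral\<^sup>L M4 f)"
        unfolding sum_powers_ii by simp
    qed
  next
    fix c assume "\<forall>M1 M2 M3 M4. (\<forall>M\<in>{M1, M2, M3, M4}. sets M = sets borel \<and> finite_measure M) \<and>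
        (\<forall>A\<in>sets borel. \<nu> A = complex_of_real (measure M1 A - measure M2 A)
                               + \<i> * complex_of_real (measure M3 A - measure M4 A)) \<longrightarrow>
        c = integral\<^sup>L M1 f - integral\<^sup>L M2 f + \<i> * (integral\<^sup>L M3 f - integral\<^sup>L M4 f)"
    then have "c = integral\<^sup>L (N 0) f - integral\<^sup>L (N 2) f + \<i> * (integral\<^sup>L (N 1) f - integral\<^sup>L (N 3) f)"
      using N' by blast
    then show "c = (\<Sum>i<4. \<i> ^ i * integral\<^sup>L (N i) f)" unfolding sum_powers_ii .
  qed
qed

lemma complex_borel_measure_vector_measure:
  "complex_borel_measure \<nu> \<Longrightarrow> vector_measure borel \<nu>"
  unfolding complex_borel_measure_def by unfold_locales blast

lemma decomposes_imp_complex_borel_measure: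
  assumes N: "decomposes \<nu> N" and 0: "\<And>A. A \<notin> sets borel \<Longrightarrow> \<nu> A = 0"
  shows "complex_borel_measure \<nu>"
  unfolding complex_borel_measure_def
proof (intro conjI allI impI 0, assumption)
  fix A :: "nat \<Rightarrow> 'a set" assume A: "range A \<subseteq> sets borel \<and> disjoint_family A"
  have "(\<lambda>k. of_real (measure (N i) (A k)) :: complex) sums of_real (measure (N i) (\<Union>k. A k))" if "i < 4" for i
  proof -
    have "sets (N i) = sets borel" "finite_measure (N i)" using N that by (auto simp: decomposes_def)
    then show ?thesis using A by (intro sums_of_real finite_measure.finite_measure_UNION) auto
  qed
  then have "(\<lambda>k. \<Sum>i<4. \<i> ^ i * of_real (measure (N i) (A k))) sums (\<Sum>i<4. \<i> ^ i * of_real (measure (N i) (\<Union>k. A k)))"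
    by (intro sums_sum sums_mult) auto
  moreover have "\<nu> (A k) = (\<Sum>i<4. \<i> ^ i * of_real (measure (N i) (A k)))" for k
    using N A unfolding decomposes_def by blast
  moreover have "\<nu> (\<Union>k. A k) = (\<Sum>i<4. \<i> ^ i * of_real (measure (N i) (\<Union>k. A k)))"
    using N A unfolding decomposes_def by blast
  ultimately show "(\<lambda>k. \<nu> (A k)) sums \<nu> (\<Union>k. A k)" by simp
qed

text \<open>The second conclusion bounds each part by the total variation, since
  \<open>\<bar>Re z\<bar>\<close> and \<open>\<bar>Im z\<bar>\<close> are at most
  \<open>cmod z\<close>; regularity will descend along this bound.\<close>

lemma complex_Jordan_decomposition:
  assumes "complex_borel_measure \<nu>"
  obtains N where "decomposes \<nu> N"
    "\<And>i A. i < 4 \<Longrightarrow> A \<in> sets borel \<Longrightarrow> \<exists>B\<in>sets borel. B \<subseteq> A \<and> measure (N i) A \<le> cmod (\<nu> B)"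
proof -
  interpret vector_measure borel \<nu> using assms by (rule complex_borel_measure_vector_measure)
  interpret re: signed_measure borel "\<lambda>A. Re (\<nu> A)"
    unfolding signed_measure_def by (rule bounded_linear_image[OF bounded_linear_Re])
  interpret im: signed_measure borel "\<lambda>A. Im (\<nu> A)"
    unfolding signed_measure_def by (rule bounded_linear_image[OF bounded_linear_Im])
  obtain N0 N2 where re: "sets N0 = sets borel" "finite_measure N0" "sets N2 = sets borel" "finite_measure N2"
    "\<forall>A\<in>sets borel. Re (\<nu> A) = measure N0 A - measure N2 A"
    "\<forall>A\<in>sets borel. \<exists>B\<in>sets borel. B \<subseteq> A \<and> measure N0 A \<le> \<bar>Re (\<nu> B)\<bar>"
    "\<forall>A\<in>sets borel. \<exists>B\<in>sets borel. B \<subseteq> A \<and> measure N2 A \<le> \<bar>Re (\<nu> B)\<bar>"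
    using re.Jordan_decomposition by (elim exE conjE)
  obtain N1 N3 where im: "sets N1 = sets borel" "finite_measure N1" "sets N3 = sets borel" "finite_measure N3"
    "\<forall>A\<in>sets borel. Im (\<nu> A) = measure N1 A - measure N3 A"
    "\<forall>A\<in>sets borel. \<exists>B\<in>sets borel. B \<subseteq> A \<and> measure N1 A \<le> \<bar>Im (\<nu> B)\<bar>"
    "\<forall>A\<in>sets borel. \<exists>B\<in>sets borel. B \<subseteq> A \<and> measure N3 A \<le> \<bar>Im (\<nu> B)\<bar>"
    using im.Jordan_decomposition by (elim exE conjE)
  define N where "N i = [N0, N1, N2, N3] ! i" for i
  have "decomposes \<nu> N"
    unfolding decomposes_def sum_powers_ii
    using re(1-5) im(1-5) by (auto simp: N_def eval_nat_numeral less_Suc_eq complex_eq_iff)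
  moreover have "\<exists>B\<in>sets borel. B \<subseteq> A \<and> measure (N i) A \<le> cmod (\<nu> B)" if "i < 4" and A: "A \<in> sets borel" for i A
  proof -
    have "i = 0 \<or> i = 1 \<or> i = 2 \<or> i = 3" using \<open>i < 4\<close> by auto
    moreover have "N 0 = N0" "N 1 = N1" "N 2 = N2" "N 3 = N3" by (auto simp: N_def)
    ultimately show ?thesis
      using re(6,7) im(6,7) A order_trans[OF _ abs_Re_le_cmod] order_trans[OF _ abs_Im_le_cmod] by metis
  qed
  ultimately show thesis using that by blast
qed

section \<open>Total variation, regularity and Radon measures\<close>

definition radon :: "'x::topological_space measure \<Rightarrow> bool" where
  "radon M \<longleftrightarrow> sets M = sets borel \<and> finite_measure M \<and>
     (\<forall>E\<in>sets borel. \<forall>e>0. \<exists>K U. compact K \<and> open U \<and> K \<subseteq> E \<and> E \<subseteq> U \<and> measure M (U - K) < e)"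

lemma cm_var_upper:
  "range P \<subseteq> sets borel \<Longrightarrow> disjoint_family P \<Longrightarrow> (\<Sum>i::nat. ennreal (cmod (\<nu> (P i)))) \<le> cm_var \<nu> (\<Union>i. P i)"
  unfolding cm_var_def by (intro SUP_upper) auto

lemma cm_var_least:
  "(\<And>P::nat \<Rightarrow> _. range P \<subseteq> sets borel \<Longrightarrow> disjoint_family P \<Longrightarrow> (\<Union>i. P i) = E \<Longrightarrow>
     (\<Sum>i. ennreal (cmod (\<nu> (P i)))) \<le> b) \<Longrightarrow> cm_var \<nu> E \<le> b"
  unfolding cm_var_def by (intro SUP_least) auto

lemma norm_le_cm_var:
  assumes "B \<in> sets borel" shows "ennreal (cmod (\<nu> B)) \<le> cm_var \<nu> B"
proof -
  let ?P = "\<lambda>i::nat. if i = 0 then B else {}"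
  have "ennreal (cmod (\<nu> B)) = (\<Sum>i\<in>{0}. ennreal (cmod (\<nu> (?P i))))" by simp
  also have "\<dots> \<le> (\<Sum>i. ennreal (cmod (\<nu> (?P i))))" by (rule sum_le_suminf) auto
  also have "\<dots> \<le> cm_var \<nu> (\<Union>i. ?P i)"
    using assms by (intro cm_var_upper) (auto simp: disjoint_family_on_def)
  also have "(\<Union>i. ?P i) = B" by (auto split: if_splits)
  finally show ?thesis .
qed

text \<open>A partition of \<open>A\<close> and one of \<open>B\<close> interleave, on even and odd
  indices, into a partition of the union whose sum is the sum of both.\<close>

lemma cm_var_superadditive:
  assumes "A \<in> sets borel" "B \<in> sets borel" "A \<inter> B = {}"
  shows "cm_var \<nu> A + cm_var \<nu> B \<le> cm_var \<nu> (A \<union> B)"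
proof -
  let ?S = "\<lambda>E. {P::nat \<Rightarrow> _. range P \<subseteq> sets borel \<and> disjoint_family P \<and> (\<Union>i. P i) = E}"
  let ?s = "\<lambda>P::nat \<Rightarrow> _. \<Sum>i. ennreal (cmod (\<nu> (P i)))"
  have ne: "?S E \<noteq> {}" if "E \<in> sets borel" for E
  proof -
    have "(\<lambda>i. if i = 0 then E else {}) \<in> ?S E"
      using that by (auto simp: disjoint_family_on_def split: if_splits)
    then show ?thesis by blast
  qed
  have PQ: "?s P + ?s Q \<le> cm_var \<nu> (A \<union> B)" if P: "P \<in> ?S A" and Q: "Q \<in> ?S B" for P Q
  proof -
    define R where "R i = (if even i then P (i div 2) else Q (i div 2))" for i
    have "(\<Sum>i<n. ennreal (cmod (\<nu> (P i))) + ennreal (cmod (\<nu> (Q i)))) = (\<Sum>i<2*n. ennreal (cmod (\<nu> (R i))))" for n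
      by (induction n) (auto simp: R_def add.assoc)
    then have "(\<Sum>i<n. ennreal (cmod (\<nu> (P i))) + ennreal (cmod (\<nu> (Q i)))) \<le> ?s R" for n
      by (simp only:) (rule sum_le_suminf, auto)
    then have "(\<Sum>i. ennreal (cmod (\<nu> (P i))) + ennreal (cmod (\<nu> (Q i)))) \<le> ?s R"
      by (intro suminf_le_const summableI)
    then have "?s P + ?s Q \<le> ?s R" by (simp add: suminf_add)
    also have "\<dots> \<le> cm_var \<nu> (\<Union>i. R i)"
    proof (rule cm_var_upper)
      show "range R \<subseteq> sets borel" using P Q by (auto simp: R_def)
      have PQ0: "P i \<inter> Q j = {}" for i j using P Q assms(3) by blast
      have "P i \<inter> P j = {}" "Q i \<inter> Q j = {}" if "i \<noteq> j" for i j
        using P Q that by (auto simp: disjoint_family_on_def)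
      moreover have "i div 2 \<noteq> j div 2" if "i \<noteq> j" "even i = even j" for i j :: nat
        using that by presburger
      ultimately have "R i \<inter> R j = {}" if "i \<noteq> j" for i j
        using that PQ0[of "i div 2" "j div 2"] PQ0[of "j div 2" "i div 2"]
        by (cases "even i"; cases "even j") (simp_all add: R_def Int_commute)
      then show "disjoint_family R" by (simp add: disjoint_family_on_def)
    qed
    also have "(\<Union>i. R i) = A \<union> B"
    proof -
      have "(\<Union>i. R i) = (\<Union>i. P i) \<union> (\<Union>i. Q i)"
      proof (intro equalityI subsetI)
        fix x assume "x \<in> (\<Union>i. P i) \<union> (\<Union>i. Q i)"
        then obtain i where "x \<in> P i \<or> x \<in> Q i" by blast
        then have "x \<in> R (2 * i) \<or> x \<in> R (2 * i + 1)" by (simp add: R_def)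
        then show "x \<in> (\<Union>i. R i)" by blast
      qed (auto simp: R_def split: if_splits)
      then show ?thesis using P Q by simp
    qed
    finally show ?thesis .
  qed
  have "cm_var \<nu> A + cm_var \<nu> B = (SUP P\<in>?S A. ?s P + cm_var \<nu> B)"
    unfolding cm_var_def[of \<nu> A] using ne assms by (subst ennreal_SUP_add_left) auto
  also have "\<dots> = (SUP P\<in>?S A. SUP Q\<in>?S B. ?s P + ?s Q)"
    unfolding cm_var_def[of \<nu> B] using ne assms by (subst ennreal_SUP_add_right) auto
  also have "\<dots> \<le> cm_var \<nu> (A \<union> B)" by (intro SUP_least PQ)
  finally show ?thesis .
qed


text \<open>Every partition of the union is cut by \<open>A\<close> and by \<open>B\<close> into a
  partition of each, and the triangle inequality splits its sum.\<close>

lemma cm_var_subadditive: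
  assumes \<nu>: "complex_borel_measure \<nu>" and AB: "A \<in> sets borel" "B \<in> sets borel" "A \<inter> B = {}"
  shows "cm_var \<nu> (A \<union> B) \<le> cm_var \<nu> A + cm_var \<nu> B"
proof (rule cm_var_least)
  interpret vector_measure borel \<nu> using \<nu> by (rule complex_borel_measure_vector_measure)
  fix P :: "nat \<Rightarrow> 'a set" assume P: "range P \<subseteq> sets borel" "disjoint_family P" "(\<Union>i. P i) = A \<union> B"
  have Pb: "P i \<in> sets borel" for i using P by auto
  have "\<nu> (P i) = \<nu> (P i \<inter> A) + \<nu> (P i \<inter> B)" for i
  proof -
    have "P i = (P i \<inter> A) \<union> (P i \<inter> B)" using P(3) by blast
    then show ?thesis using Un[of "P i \<inter> A" "P i \<inter> B"] Pb AB by auto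
  qed
  then have "ennreal (cmod (\<nu> (P i))) \<le> ennreal (cmod (\<nu> (P i \<inter> A))) + ennreal (cmod (\<nu> (P i \<inter> B)))" for i
    by (simp add: norm_triangle_ineq ennreal_plus[symmetric] ennreal_leI del: ennreal_plus)
  then have "(\<Sum>i. ennreal (cmod (\<nu> (P i)))) \<le> (\<Sum>i. ennreal (cmod (\<nu> (P i \<inter> A))) + ennreal (cmod (\<nu> (P i \<inter> B))))"
    by (intro suminf_le summableI)
  also have "\<dots> = (\<Sum>i. ennreal (cmod (\<nu> (P i \<inter> A)))) + (\<Sum>i. ennreal (cmod (\<nu> (P i \<inter> B))))"
    by (simp add: suminf_add)
  also have "\<dots> \<le> cm_var \<nu> (\<Union>i. P i \<inter> A) + cm_var \<nu> (\<Union>i. P i \<inter> B)"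
    by (intro add_mono cm_var_upper) (use P(2) Pb AB in \<open>auto simp: disjoint_family_on_def\<close>)
  also have "(\<Union>i. P i \<inter> A) = A" using P(3) by blast
  also have "(\<Union>i. P i \<inter> B) = B" using P(3) by blast
  finally show "(\<Sum>i. ennreal (cmod (\<nu> (P i)))) \<le> cm_var \<nu> A + cm_var \<nu> B" .
qed

lemma cm_var_mono:
  assumes "A \<in> sets borel" "B \<in> sets borel" "A \<subseteq> B" shows "cm_var \<nu> A \<le> cm_var \<nu> B"
proof -
  have "cm_var \<nu> A \<le> cm_var \<nu> A + cm_var \<nu> (B - A)" by simp
  also have "\<dots> \<le> cm_var \<nu> (A \<union> (B - A))" using assms by (intro cm_var_superadditive) auto
  also have "A \<union> (B - A) = B" using assms(3) by blast
  finally show ?thesis .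
qed

lemma cm_var_split:
  assumes \<nu>: "complex_borel_measure \<nu>" and AB: "A \<in> sets borel" "B \<in> sets borel" "A \<subseteq> B"
  shows "cm_var \<nu> B = cm_var \<nu> A + cm_var \<nu> (B - A)"
proof -
  have "A \<union> (B - A) = B" using AB by blast
  then show ?thesis
    using cm_var_superadditive[of A "B - A" \<nu>] cm_var_subadditive[OF \<nu>, of A "B - A"] AB
    by (auto intro!: antisym)
qed

text \<open>Besides the estimate, this is where finiteness of the variation comes from, and
  finiteness is what allows variations to be cancelled in \<open>ennreal\<close>.\<close>

lemma cm_var_le_decomposition:
  assumes N: "decomposes \<nu> N" and A: "A \<in> sets borel"
  shows "cm_var \<nu> A \<le> ennreal (\<Sum>i<4. measure (N i) A)"
proof (rule cm_var_least)
  fix P :: "nat \<Rightarrow> 'a set" assume P: "range P \<subseteq> sets borel" "disjoint_family P" "(\<Union>k. P k) = A"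
  have Pb: "P k \<in> sets borel" for k using P by auto
  have "cmod (\<nu> (P k)) \<le> (\<Sum>i<4. measure (N i) (P k))" for k
  proof -
    have "\<nu> (P k) = (\<Sum>i<4. \<i> ^ i * of_real (measure (N i) (P k)))"
      using N Pb unfolding decomposes_def by blast
    also have "cmod \<dots> \<le> (\<Sum>i<4. measure (N i) (P k))"
      by (rule sum_norm_le) (simp add: norm_mult norm_power)
    finally show ?thesis .
  qed
  then have "(\<Sum>k. ennreal (cmod (\<nu> (P k)))) \<le> (\<Sum>k. ennreal (\<Sum>i<4. measure (N i) (P k)))"
    by (intro suminf_le summableI ennreal_leI)
  also have "\<dots> = ennreal (\<Sum>i<4. measure (N i) A)"
  proof (rule suminf_ennreal_eq)
    show "(\<lambda>k. \<Sum>i<4. measure (N i) (P k)) sums (\<Sum>i<4. measure (N i) A)"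
    proof (rule sums_sum)
      fix i :: nat assume "i \<in> {..<4}"
      then have "sets (N i) = sets borel" "finite_measure (N i)" using N by (auto simp: decomposes_def)
      then show "(\<lambda>k. measure (N i) (P k)) sums measure (N i) A"
        unfolding P(3)[symmetric] using P by (intro finite_measure.finite_measure_UNION) auto
    qed
  qed (simp add: sum_nonneg)
  finally show "(\<Sum>k. ennreal (cmod (\<nu> (P k)))) \<le> ennreal (\<Sum>i<4. measure (N i) A)" .
qed

text \<open>Unions of the compact sets inside and intersections of the open sets outside only shrink
  the gap, so finitely many measures can share one pair.\<close>

lemma radon_common:
  fixes N :: "'i \<Rightarrow> 'x::t2_space measure"
  assumes I: "finite I" "\<And>i. i \<in> I \<Longrightarrow> radon (N i)" and E: "E \<in> sets borel" and e: "e > 0"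
  shows "\<exists>K U. compact K \<and> open U \<and> K \<subseteq> E \<and> E \<subseteq> U \<and> (\<forall>i\<in>I. measure (N i) (U - K) < e)"
  using I
proof (induction I rule: finite_induct)
  case empty then show ?case by (intro exI[of _ "{}"] exI[of _ UNIV]) auto
next
  case (insert j I)
  obtain K U where 1: "compact K" "open U" "K \<subseteq> E" "E \<subseteq> U" "\<And>i. i \<in> I \<Longrightarrow> measure (N i) (U - K) < e"
    using insert by auto
  have r: "radon (N j)" using insert.prems by simp
  then obtain K' U' where 2: "compact K'" "open U'" "K' \<subseteq> E" "E \<subseteq> U'" "measure (N j) (U' - K') < e"
    using E e unfolding radon_def by metis
  have "measure (N i) ((U \<inter> U') - (K \<union> K')) < e" if "i \<in> insert j I" for i
  proof -
    have ri: "sets (N i) = sets borel" "finite_measure (N i)" using insert.prems that unfolding radon_def by auto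
    have b: "(U - K) \<in> sets borel" "(U' - K') \<in> sets borel"
      using 1 2 by (auto intro: borel_open borel_closed compact_imp_closed)
    have "measure (N i) ((U \<inter> U') - (K \<union> K')) \<le> measure (N i) (U - K)"
      "measure (N i) ((U \<inter> U') - (K \<union> K')) \<le> measure (N i) (U' - K')"
      using b ri(1) by (auto intro!: finite_measure.finite_measure_mono[OF ri(2)])
    then show ?thesis using 1(5) 2(5) that by fastforce
  qed
  then show ?case using 1 2 by (intro exI[of _ "K \<union> K'"] exI[of _ "U \<inter> U'"]) auto
qed

definition radon_decomposes :: "('x::topological_space set \<Rightarrow> complex) \<Rightarrow> (nat \<Rightarrow> 'x measure) \<Rightarrow> bool" where
  "radon_decomposes \<nu> N \<longleftrightarrow> decomposes \<nu> N \<and> (\<forall>i<4. radon (N i))"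

text \<open>Additivity of the variation turns the two regularity conditions into small variation of
  \<open>U - E\<close> and of \<open>E - K\<close>, and each Jordan part is bounded by the
  variation.\<close>

lemma regular_imp_radon_decomposes:
  fixes \<nu> :: "'x::t2_space set \<Rightarrow> complex"
  assumes "regular_complex_borel_measure \<nu>" shows "\<exists>N. radon_decomposes \<nu> N"
proof -
  have cb: "complex_borel_measure \<nu>" using assms by (simp add: regular_complex_borel_measure_def)
  obtain N where N: "decomposes \<nu> N"
    "\<And>i A. i < 4 \<Longrightarrow> A \<in> sets borel \<Longrightarrow> \<exists>B\<in>sets borel. B \<subseteq> A \<and> measure (N i) A \<le> cmod (\<nu> B)"
    using complex_Jordan_decomposition[OF cb] by blast
  have dom: "ennreal (measure (N i) A) \<le> cm_var \<nu> A" if i: "i < 4" and A: "A \<in> sets borel" for i A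
  proof -
    obtain B where B: "B \<in> sets borel" "B \<subseteq> A" "measure (N i) A \<le> cmod (\<nu> B)" using N(2)[OF i A] by blast
    have "ennreal (measure (N i) A) \<le> ennreal (cmod (\<nu> B))" using B(3) by (rule ennreal_leI)
    also have "\<dots> \<le> cm_var \<nu> A" using norm_le_cm_var[OF B(1)] cm_var_mono[OF B(1) A B(2)] by (rule order_trans)
    finally show ?thesis .
  qed
  have fin: "cm_var \<nu> A < top" if "A \<in> sets borel" for A
    using cm_var_le_decomposition[OF N(1) that] by (rule order.strict_trans1) simp
  have "radon (N i)" if i: "i < 4" for i
    unfolding radon_def
  proof (intro conjI ballI allI impI)
    show "sets (N i) = sets borel" "finite_measure (N i)" using N(1) i by (auto simp: decomposes_def)
    fix E :: "'x set" and e :: real assume E: "E \<in> sets borel" and e: "e > 0"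
    have e2: "ennreal (e/2) > 0" using e by simp
    have "(INF U \<in> {U. open U \<and> E \<subseteq> U}. cm_var \<nu> U) < cm_var \<nu> E + ennreal (e/2)"
    proof -
      have "cm_var \<nu> E < cm_var \<nu> E + ennreal (e/2)"
        using fin[OF E] e by (cases "cm_var \<nu> E") (auto simp: ennreal_plus[symmetric] ennreal_less_iff simp del: ennreal_plus)
      then show ?thesis using assms E unfolding regular_complex_borel_measure_def by metis
    qed
    then obtain U where U: "open U" "E \<subseteq> U" "cm_var \<nu> U < cm_var \<nu> E + ennreal (e/2)"
      unfolding INF_less_iff by blast
    have Ub: "U \<in> sets borel" using U(1) by simp
    have UE: "cm_var \<nu> (U - E) < ennreal (e/2)"
      using U(3) fin[OF E] unfolding cm_var_split[OF cb E Ub U(2)] by (simp add: ennreal_add_left_cancel_less)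
    have "\<exists>K. compact K \<and> K \<subseteq> E \<and> cm_var \<nu> E < cm_var \<nu> K + ennreal (e/2)"
    \<comment> \<open>Conversion to \<open>ennreal\<close> truncates \<open>v - e/2\<close> at 0, so
      it lies strictly below \<open>v\<close> only if \<open>v > 0\<close>. For variation 0 the
      empty compact set does.\<close>
    proof (cases "cm_var \<nu> E = 0")
      case True
      have "0 < cm_var \<nu> {} + ennreal (e/2)" using e2 by (rule less_le_trans) simp
      with True show ?thesis by (intro exI[of _ "{}"]) auto
    next
      case False
      obtain v where v: "cm_var \<nu> E = ennreal v" "v > 0"
        using fin[OF E] False by (cases "cm_var \<nu> E") (auto simp: order_less_le)
      have "ennreal (v - e/2) < cm_var \<nu> E" unfolding v using v e by (simp add: ennreal_less_iff ennreal_lessI)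
      also have "\<dots> = (SUP K \<in> {K. compact K \<and> K \<subseteq> E}. cm_var \<nu> K)"
        using assms E unfolding regular_complex_borel_measure_def by blast
      finally obtain K where K: "compact K" "K \<subseteq> E" "ennreal (v - e/2) < cm_var \<nu> K"
        unfolding less_SUP_iff by blast
      have "K \<in> sets borel" using K(1) by (simp add: borel_closed compact_imp_closed)
      obtain k where k: "cm_var \<nu> K = ennreal k" "k \<ge> 0"
        using fin[OF \<open>K \<in> sets borel\<close>] by (cases "cm_var \<nu> K") auto
      have "v - e/2 < k" using K(3) k by (cases "v - e/2 \<ge> 0") (auto simp: ennreal_less_iff)
      then have "cm_var \<nu> E < cm_var \<nu> K + ennreal (e/2)"
        unfolding k v(1) using k v e by (simp add: ennreal_less_iff flip: ennreal_plus)
      then show ?thesis using K by blast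
    qed
    then obtain K where K: "compact K" "K \<subseteq> E" "cm_var \<nu> E < cm_var \<nu> K + ennreal (e/2)" by blast
    have Kb: "K \<in> sets borel" using K(1) by (simp add: borel_closed compact_imp_closed)
    have EK: "cm_var \<nu> (E - K) < ennreal (e/2)"
      using K(3) fin[OF Kb] unfolding cm_var_split[OF cb Kb E K(2)] by (simp add: ennreal_add_left_cancel_less)
    have KU: "K \<subseteq> U" using K(2) U(2) by blast
    have eq: "U - K = (E - K) \<union> (U - E)" using K U by blast
    have "ennreal (measure (N i) (U - K)) \<le> cm_var \<nu> (U - K)" using Ub Kb by (intro dom i) auto
    also have "\<dots> \<le> cm_var \<nu> (E - K) + cm_var \<nu> (U - E)"
      unfolding eq using E Ub Kb by (intro cm_var_subadditive[OF cb]) auto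
    also have "\<dots> < ennreal (e/2) + ennreal (e/2)" by (rule add_strict_mono[OF EK UE])
    also have "\<dots> = ennreal e" using e by (simp flip: ennreal_plus)
    finally have "measure (N i) (U - K) < e" by (simp add: ennreal_less_iff)
    then show "\<exists>K U. compact K \<and> open U \<and> K \<subseteq> E \<and> E \<subseteq> U \<and> measure (N i) (U - K) < e"
      using K U by blast
  qed
  then show ?thesis unfolding radon_decomposes_def using N(1) by blast
qed

text \<open>The variation of a gap \<open>U - K\<close> is at most the sum of its four masses, so a
  pair common to the four measures gives both regularity conditions.\<close>

lemma radon_decomposes_imp_regular:
  fixes \<nu> :: "'x::t2_space set \<Rightarrow> complex"
  assumes N: "radon_decomposes \<nu> N" and 0: "\<And>A. A \<notin> sets borel \<Longrightarrow> \<nu> A = 0"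
  shows "regular_complex_borel_measure \<nu>"
proof -
  have dec: "decomposes \<nu> N" and rad: "\<And>i. i < 4 \<Longrightarrow> radon (N i)"
    using N by (auto simp: radon_decomposes_def)
  have cb: "complex_borel_measure \<nu>" using dec 0 by (rule decomposes_imp_complex_borel_measure)
  have approx: "\<exists>K U. compact K \<and> open U \<and> K \<subseteq> E \<and> E \<subseteq> U \<and> cm_var \<nu> (U - K) \<le> ennreal e"
    if E: "E \<in> sets borel" and e: "e > 0" for E :: "'x set" and e :: real
  proof -
    have "\<exists>K U. compact K \<and> open U \<and> K \<subseteq> E \<and> E \<subseteq> U \<and> (\<forall>i\<in>{..<4}. measure (N i) (U - K) < e/4)"
      by (rule radon_common) (use rad E e in auto)
    then obtain K U where KU: "compact K" "open U" "K \<subseteq> E" "E \<subseteq> U" "\<forall>i\<in>{..<4}. measure (N i) (U - K) < e/4"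
      by (elim exE conjE)
    have "U - K \<in> sets borel" using KU by (intro sets.Diff borel_open borel_closed compact_imp_closed)
    then have "cm_var \<nu> (U - K) \<le> ennreal (\<Sum>i<4. measure (N i) (U - K))" by (rule cm_var_le_decomposition[OF dec])
    also have "(\<Sum>i<4. measure (N i) (U - K)) \<le> (\<Sum>i<4::nat. e/4)"
      using KU(5) by (intro sum_mono less_imp_le) blast
    then have "ennreal (\<Sum>i<4. measure (N i) (U - K)) \<le> ennreal e" by (intro ennreal_leI) simp
    finally show ?thesis using KU by blast
  qed
  have "cm_var \<nu> E = (INF U \<in> {U. open U \<and> E \<subseteq> U}. cm_var \<nu> U)" if E: "E \<in> sets borel" for E
  proof (rule antisym)
    show "cm_var \<nu> E \<le> (INF U \<in> {U. open U \<and> E \<subseteq> U}. cm_var \<nu> U)"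
      using E by (intro INF_greatest cm_var_mono) auto
    show "(INF U \<in> {U. open U \<and> E \<subseteq> U}. cm_var \<nu> U) \<le> cm_var \<nu> E"
    proof (rule ennreal_le_epsilon)
      fix e :: real assume e: "e > 0"
      obtain K U where KU: "compact K" "open U" "K \<subseteq> E" "E \<subseteq> U" "cm_var \<nu> (U - K) \<le> ennreal e"
        using approx[OF E e] by blast
      have b: "U \<in> sets borel" "K \<in> sets borel" using KU by (auto intro: borel_closed compact_imp_closed)
      have "(INF U \<in> {U. open U \<and> E \<subseteq> U}. cm_var \<nu> U) \<le> cm_var \<nu> U" using KU by (intro INF_lower) auto
      also have "\<dots> = cm_var \<nu> E + cm_var \<nu> (U - E)" by (rule cm_var_split[OF cb E b(1) KU(4)])
      also have "\<dots> \<le> cm_var \<nu> E + cm_var \<nu> (U - K)"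
        using b E KU by (intro add_left_mono cm_var_mono) auto
      also have "\<dots> \<le> cm_var \<nu> E + ennreal e" using KU by (intro add_left_mono)
      finally show "(INF U \<in> {U. open U \<and> E \<subseteq> U}. cm_var \<nu> U) \<le> cm_var \<nu> E + ennreal e" .
    qed
  qed
  moreover have "cm_var \<nu> E = (SUP K \<in> {K. compact K \<and> K \<subseteq> E}. cm_var \<nu> K)" if E: "E \<in> sets borel" for E
  proof (rule antisym)
    show "(SUP K \<in> {K. compact K \<and> K \<subseteq> E}. cm_var \<nu> K) \<le> cm_var \<nu> E"
      using E by (intro SUP_least cm_var_mono) (auto intro: borel_closed compact_imp_closed)
    show "cm_var \<nu> E \<le> (SUP K \<in> {K. compact K \<and> K \<subseteq> E}. cm_var \<nu> K)"
    proof (rule ennreal_le_epsilon)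
      fix e :: real assume e: "e > 0"
      obtain K U where KU: "compact K" "open U" "K \<subseteq> E" "E \<subseteq> U" "cm_var \<nu> (U - K) \<le> ennreal e"
        using approx[OF E e] by blast
      have b: "U \<in> sets borel" "K \<in> sets borel" using KU by (auto intro: borel_closed compact_imp_closed)
      have "cm_var \<nu> E = cm_var \<nu> K + cm_var \<nu> (E - K)" by (rule cm_var_split[OF cb b(2) E KU(3)])
      also have "\<dots> \<le> cm_var \<nu> K + cm_var \<nu> (U - K)"
        using b E KU by (intro add_left_mono cm_var_mono) auto
      also have "\<dots> \<le> (SUP K \<in> {K. compact K \<and> K \<subseteq> E}. cm_var \<nu> K) + ennreal e"
        using KU by (intro add_mono SUP_upper) auto
      finally show "cm_var \<nu> E \<le> (SUP K \<in> {K. compact K \<and> K \<subseteq> E}. cm_var \<nu> K) + ennreal e" .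
    qed
  qed
  ultimately show ?thesis using cb unfolding regular_complex_borel_measure_def by blast
qed

section \<open>Functions vanishing at infinity\<close>

definition C0 :: "('x::topological_space \<Rightarrow> 'b::real_normed_vector) set" where
  "C0 = {f. continuous_on UNIV f \<and> vanishes_at_infinity f}"

lemma C0_continuous: "f \<in> C0 \<Longrightarrow> continuous_on S f"
  unfolding C0_def by (auto intro: continuous_on_subset)

lemma C0_dominated:
  assumes f: "f \<in> C0" and g: "continuous_on UNIV g" and le: "\<And>x. norm (g x) \<le> c * norm (f x)"
  shows "g \<in> C0"
proof -
  have "\<exists>K. compact K \<and> (\<forall>x. x \<notin> K \<longrightarrow> norm (g x) < e)" if e: "e > 0" for e
  proof -
    \<comment> \<open>\<open>\<bar>c\<bar> + 1\<close> in place of \<open>c\<close> keeps the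
      divisor positive for every real \<open>c\<close>.\<close>
    have "e / (\<bar>c\<bar> + 1) > 0" using e by simp
    then obtain K where K: "compact K" "\<And>x. x \<notin> K \<Longrightarrow> norm (f x) < e / (\<bar>c\<bar> + 1)"
      using f unfolding C0_def vanishes_at_infinity_def by blast
    have "norm (g x) < e" if "x \<notin> K" for x
    proof -
      have "norm (g x) \<le> (\<bar>c\<bar> + 1) * norm (f x)"
        by (rule order_trans[OF le mult_right_mono]) auto
      also have "\<dots> < e" using K(2)[OF that] by (simp add: pos_less_divide_eq mult.commute)
      finally show ?thesis .
    qed
    then show ?thesis using K(1) by blast
  qed
  then show ?thesis using g unfolding C0_def vanishes_at_infinity_def by blast
qed

lemma C0_zero [simp]: "(\<lambda>_. 0) \<in> C0"
  unfolding C0_def vanishes_at_infinity_def by (auto intro!: exI[of _ "{}"])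

lemma C0_add:
  assumes f: "f \<in> C0" and g: "g \<in> C0" shows "(\<lambda>x. f x + g x) \<in> C0"
proof -
  have "\<exists>K. compact K \<and> (\<forall>x. x \<notin> K \<longrightarrow> norm (f x + g x) < e)" if e: "e > 0" for e
  proof -
    obtain K where K: "compact K" "\<And>x. x \<notin> K \<Longrightarrow> norm (f x) < e / 2"
      using f half_gt_zero[OF e] unfolding C0_def vanishes_at_infinity_def by blast
    obtain K' where K': "compact K'" "\<And>x. x \<notin> K' \<Longrightarrow> norm (g x) < e / 2"
      using g half_gt_zero[OF e] unfolding C0_def vanishes_at_infinity_def by blast
    have "norm (f x + g x) < e" if "x \<notin> K \<union> K'" for x
      using norm_triangle_ineq[of "f x" "g x"] K(2)[of x] K'(2)[of x] that by simp
    then show ?thesis using K(1) K'(1) by (intro exI[of _ "K \<union> K'"]) auto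
  qed
  then show ?thesis
    using assms unfolding C0_def vanishes_at_infinity_def by (auto intro: continuous_on_add)
qed

lemma C0_bounded_linear:
  assumes "f \<in> C0" "bounded_linear h" shows "(\<lambda>x. h (f x)) \<in> C0"
proof -
  obtain K where "\<And>x. norm (h x) \<le> norm x * K" using bounded_linear.bounded[OF assms(2)] by blast
  then show ?thesis
    using bounded_linear.continuous_on[OF assms(2) C0_continuous[OF assms(1)]]
    by (intro C0_dominated[OF assms(1), of _ K]) (simp_all add: mult.commute)
qed

lemma C0_diff: "f \<in> C0 \<Longrightarrow> g \<in> C0 \<Longrightarrow> (\<lambda>x. f x - g x) \<in> C0"
  using C0_add[of f "\<lambda>x. - g x"] C0_bounded_linear[of g uminus] by (simp add: bounded_linear_minus bounded_linear_ident)

lemma C0_sum: "(\<And>i. i \<in> I \<Longrightarrow> f i \<in> C0) \<Longrightarrow> (\<lambda>x. \<Sum>i\<in>I. f i x) \<in> C0"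
  by (induction I rule: infinite_finite_induct) (auto intro: C0_add)

lemma C0_bounded:
  assumes "f \<in> C0" obtains B where "B > 0" "\<And>x. norm (f x) \<le> B"
proof -
  obtain K where K: "compact K" "\<And>x. x \<notin> K \<Longrightarrow> norm (f x) < 1"
    using assms unfolding C0_def vanishes_at_infinity_def by (auto dest: spec[of _ 1])
  obtain B where "\<And>x. x \<in> K \<Longrightarrow> norm (f x) \<le> B"
    using compact_imp_bounded[OF compact_continuous_image[OF C0_continuous[OF assms] K(1)]]
    unfolding bounded_iff by auto
  then have "norm (f x) \<le> \<bar>B\<bar> + 1" for x
    using K(2)[of x] by (cases "x \<in> K") (force+)
  then show thesis using that[of "\<bar>B\<bar> + 1"] by simp
qed

lemma C0_compact_level:
  assumes "f \<in> C0" "e > 0" shows "compact {x. e \<le> norm (f x)}"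
proof -
  obtain K where K: "compact K" "\<And>x. x \<notin> K \<Longrightarrow> norm (f x) < e"
    using assms unfolding C0_def vanishes_at_infinity_def by blast
  have "closed {x. e \<le> norm (f x)}"
    by (intro closed_Collect_le continuous_on_const continuous_on_norm C0_continuous assms)
  then have "compact (K \<inter> {x. e \<le> norm (f x)})" using K(1) by (rule compact_Int_closed[rotated])
  moreover have "K \<inter> {x. e \<le> norm (f x)} = {x. e \<le> norm (f x)}" using K(2) by (auto simp: not_less[symmetric])
  ultimately show ?thesis by simp
qed

definition pos_C0 :: "('x::topological_space \<Rightarrow> real) set" where
  "pos_C0 = {f\<in>C0. \<forall>x. 0 \<le> f x}"

lemma pos_C0I: "f \<in> C0 \<Longrightarrow> (\<And>x. 0 \<le> f x) \<Longrightarrow> f \<in> pos_C0" by (simp add: pos_C0_def)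

lemma pos_C0D: "f \<in> pos_C0 \<Longrightarrow> f \<in> C0" "f \<in> pos_C0 \<Longrightarrow> 0 \<le> f x" by (simp_all add: pos_C0_def)

lemma pos_C0_le:
  assumes "f \<in> pos_C0" "continuous_on UNIV g" "\<And>x. 0 \<le> g x" "\<And>x. g x \<le> f x" shows "g \<in> pos_C0"
  using assms by (intro pos_C0I C0_dominated[of f g 1]) (auto simp: pos_C0_def)

lemma pos_C0_add: "f \<in> pos_C0 \<Longrightarrow> g \<in> pos_C0 \<Longrightarrow> (\<lambda>x. f x + g x) \<in> pos_C0"
  by (auto simp: pos_C0_def C0_add)

lemma pos_C0_cmult: "f \<in> pos_C0 \<Longrightarrow> 0 \<le> c \<Longrightarrow> (\<lambda>x. c * f x) \<in> pos_C0"
  by (auto simp: pos_C0_def intro: C0_bounded_linear[OF _ bounded_linear_mult_right])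

lemma pos_C0_continuous: "f \<in> pos_C0 \<Longrightarrow> continuous_on S f"
  by (intro C0_continuous pos_C0D(1))

lemma pos_C0_trunc:
  assumes "f \<in> pos_C0" "0 \<le> d" shows "(\<lambda>x. max (f x - d) 0) \<in> pos_C0"
proof (rule pos_C0_le[OF assms(1)])
  show "continuous_on UNIV (\<lambda>x. max (f x - d) 0)"
    by (rule continuous_on_max continuous_on_diff continuous_on_const pos_C0_continuous assms)+
  show "max (f x - d) 0 \<le> f x" for x using pos_C0D(2)[OF assms(1), of x] assms(2) by simp
qed simp

lemma pos_C0_min:
  assumes "f \<in> pos_C0" "0 \<le> d" shows "(\<lambda>x. min (f x) d) \<in> pos_C0"
proof (rule pos_C0_le[OF assms(1)])
  show "continuous_on UNIV (\<lambda>x. min (f x) d)"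
    by (rule continuous_on_min continuous_on_const pos_C0_continuous assms)+
  show "0 \<le> min (f x) d" for x using pos_C0D(2)[OF assms(1), of x] assms(2) by simp
qed simp

text \<open>A locally compact Hausdorff space is completely regular. Separating \<open>x\<close>
  from the complement of \<open>U \<inter> V\<close>, where \<open>U\<close> lies in a compact set,
  makes \<open>1 - f\<close> vanish at infinity as well as outside \<open>V\<close>.\<close>

lemma C0_Urysohn_point:
  fixes x :: "'x::t2_space"
  assumes lc: "locally_compact_space (euclidean :: 'x topology)" and V: "open V" "x \<in> V"
  obtains h where "h \<in> pos_C0" "\<And>y. h y \<le> 1" "h x = 1" "\<And>y. y \<notin> V \<Longrightarrow> h y = 0"
proof -
  have "x \<in> topspace euclidean" by simp
  then obtain U K where "openin euclidean U" "compactin euclidean K" and xU: "x \<in> U" "U \<subseteq> K"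
    using lc unfolding locally_compact_space_def by meson
  then have UK: "open U" "compact K" "x \<in> U" "U \<subseteq> K" by (simp_all add: compactin_euclidean_iff)
  have "completely_regular_space (euclidean :: 'x topology)"
  proof (intro locally_compact_regular_imp_completely_regular_space lc disjI1)
    show "Hausdorff_space (euclidean :: 'x topology)"
      unfolding Hausdorff_space_def using hausdorff[where 'a = 'x]
      by (auto simp: disjnt_def)
  qed
  moreover have "closedin euclidean (- (U \<inter> V))" "x \<in> topspace euclidean - (- (U \<inter> V))"
    using UK V by auto
  ultimately obtain f :: "'x \<Rightarrow> real" where
    f: "continuous_map euclidean (top_of_set {0..1}) f" "f x = 0" "f ` (- (U \<inter> V)) \<subseteq> {1}"
    unfolding completely_regular_space_def by blast
  have fc: "continuous_on UNIV f" and f01: "\<And>y. f y \<in> {0..1}"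
    using f(1) by (auto simp: continuous_map_in_subtopology image_subset_iff)
  have out: "f y = 1" if "y \<notin> U \<or> y \<notin> V" for y using f(3) that by blast
  have "(\<lambda>y. 1 - f y) \<in> C0"
    unfolding C0_def vanishes_at_infinity_def
  proof (intro CollectI conjI allI impI)
    show "continuous_on UNIV (\<lambda>y. 1 - f y)" using fc by (intro continuous_intros)
    fix e :: real assume "e > 0"
    moreover have "f y = 1" if "y \<notin> K" for y using out UK(4) that by blast
    ultimately have "\<forall>y. y \<notin> K \<longrightarrow> norm (1 - f y) < e" by simp
    then show "\<exists>K. compact K \<and> (\<forall>y. y \<notin> K \<longrightarrow> norm (1 - f y) < e)" using UK(2) by blast
  qed
  then have "(\<lambda>y. 1 - f y) \<in> pos_C0" using f01 by (intro pos_C0I) auto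
  then show thesis using f01 f(2) out by (intro that[of "\<lambda>y. 1 - f y"]) auto
qed

text \<open>A partition of unity before normalisation: a lower bound 1/2 for the sum on
  \<open>K\<close> is what a finite subcover gives directly. It is normalised by truncation in
  \<open>C0_Urysohn_compact\<close> and by division in
  \<open>content_countably_subadditive\<close>.\<close>

lemma C0_Urysohn_cover:
  fixes K :: "'x::t2_space set"
  assumes lc: "locally_compact_space (euclidean :: 'x topology)" and K: "compact K"
    and V: "\<And>x. x \<in> K \<Longrightarrow> open (V x)" "\<And>x. x \<in> K \<Longrightarrow> x \<in> V x"
  shows "\<exists>D h. finite D \<and> D \<subseteq> K \<and> (\<forall>x\<in>D. h x \<in> pos_C0 \<and> (\<forall>y. h x y \<le> 1) \<and> (\<forall>y. y \<notin> V x \<longrightarrow> h x y = 0)) \<and>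
    (\<forall>y\<in>K. 1/2 < (\<Sum>x\<in>D. h x y))"
proof -
  have "\<exists>h. h \<in> pos_C0 \<and> (\<forall>y. h y \<le> 1) \<and> h x = 1 \<and> (\<forall>y. y \<notin> V x \<longrightarrow> h y = 0)" if "x \<in> K" for x
    by (rule C0_Urysohn_point[OF lc V[OF that]]) blast
  then obtain h where h: "\<forall>x\<in>K. h x \<in> pos_C0 \<and> (\<forall>y. h x y \<le> 1) \<and> h x x = 1 \<and> (\<forall>y. y \<notin> V x \<longrightarrow> h x y = 0)"
    by metis
  have "open {y. 1/2 < h x y}" if "x \<in> K" for x
    by (intro open_Collect_less continuous_on_const pos_C0_continuous) (use h that in blast)
  moreover have "K \<subseteq> (\<Union>x\<in>K. {y. 1/2 < h x y})" using h by force
  ultimately obtain D where D: "D \<subseteq> K" "finite D" "K \<subseteq> (\<Union>x\<in>D. {y. 1/2 < h x y})"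
    by (rule compactE_image[OF K])
  have "1/2 < (\<Sum>x\<in>D. h x y)" if y: "y \<in> K" for y
  proof -
    obtain x where x: "x \<in> D" "1/2 < h x y" using D(3) y by blast
    have "h x y \<le> (\<Sum>x\<in>D. h x y)"
      by (rule member_le_sum[OF x(1)]) (use D h in \<open>auto intro: pos_C0D(2)\<close>)
    then show ?thesis using x by simp
  qed
  moreover have "\<forall>x\<in>D. h x \<in> pos_C0 \<and> (\<forall>y. h x y \<le> 1) \<and> (\<forall>y. y \<notin> V x \<longrightarrow> h x y = 0)"
    using h D(1) by (meson subsetD)
  ultimately show ?thesis using D(1,2) by blast
qed

lemma C0_Urysohn_compact:
  fixes K :: "'x::t2_space set"
  assumes lc: "locally_compact_space (euclidean :: 'x topology)" and K: "compact K" and V: "open V" "K \<subseteq> V"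
  shows "\<exists>h\<in>pos_C0. (\<forall>y. h y \<le> 1) \<and> (\<forall>y\<in>K. h y = 1) \<and> (\<forall>y. y \<notin> V \<longrightarrow> h y = 0)"
proof -
  obtain D h where D: "finite D" "D \<subseteq> K"
    and h: "\<forall>x\<in>D. h x \<in> pos_C0 \<and> (\<forall>y. h x y \<le> 1) \<and> (\<forall>y. y \<notin> V \<longrightarrow> h x y = 0)"
    and cover: "\<forall>y\<in>K. 1/2 < (\<Sum>x\<in>D. h x y)"
    using C0_Urysohn_cover[OF lc K, of "\<lambda>_. V"] V by blast
  have s: "(\<lambda>y. \<Sum>x\<in>D. h x y) \<in> pos_C0"
    using h by (auto intro!: pos_C0I C0_sum sum_nonneg dest: pos_C0D)
  have "(\<lambda>y. min (2 * (\<Sum>x\<in>D. h x y)) 1) \<in> pos_C0"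
    by (intro pos_C0_min pos_C0_cmult s) auto
  moreover have "min (2 * (\<Sum>x\<in>D. h x y)) 1 = 1" if "y \<in> K" for y
    using cover that by fastforce
  moreover have "min (2 * (\<Sum>x\<in>D. h x y)) 1 = 0" if "y \<notin> V" for y
    using h that by simp
  ultimately show ?thesis by (intro bexI[of _ "\<lambda>y. min (2 * (\<Sum>x\<in>D. h x y)) 1"]) auto
qed

section \<open>The Riesz representation theorem for positive functionals\<close>

text \<open>The functional is prescribed only on the cone of nonnegative functions, because the
  positive part of a real functional is defined, and additive, there.\<close>

locale cone_functional =
  fixes L :: "('x::t2_space \<Rightarrow> real) \<Rightarrow> real" and C :: real
  assumes lc: "locally_compact_space (euclidean :: 'x topology)"
    and add: "f \<in> pos_C0 \<Longrightarrow> g \<in> pos_C0 \<Longrightarrow> L (\<lambda>x. f x + g x) = L f + L g"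
    and cmult: "f \<in> pos_C0 \<Longrightarrow> 0 \<le> c \<Longrightarrow> L (\<lambda>x. c * f x) = c * L f"
    and nonneg: "f \<in> pos_C0 \<Longrightarrow> 0 \<le> L f"
    and bound: "f \<in> pos_C0 \<Longrightarrow> (\<And>x. f x \<le> 1) \<Longrightarrow> L f \<le> C"
begin

lemma zero_pos_C0: "(\<lambda>_. 0) \<in> pos_C0" by (intro pos_C0I) auto

lemma zero: "L (\<lambda>_. 0) = 0"
  using cmult[OF zero_pos_C0, of 0] by simp

lemma C_nonneg: "0 \<le> C" using bound[OF zero_pos_C0] by (simp add: zero)

lemma mono:
  assumes "f \<in> pos_C0" "g \<in> pos_C0" "\<And>x. f x \<le> g x" shows "L f \<le> L g"
proof -
  have d: "(\<lambda>x. g x - f x) \<in> pos_C0" using assms by (intro pos_C0I C0_diff) (auto dest: pos_C0D)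
  show ?thesis using add[OF assms(1) d] nonneg[OF d] by simp
qed

lemma sum:
  assumes "finite I" "\<And>i. i \<in> I \<Longrightarrow> f i \<in> pos_C0"
  shows "(\<lambda>x. \<Sum>i\<in>I. f i x) \<in> pos_C0 \<and> L (\<lambda>x. \<Sum>i\<in>I. f i x) = (\<Sum>i\<in>I. L (f i))"
  using assms by (induction I rule: finite_induct) (auto simp: zero zero_pos_C0 add pos_C0_add)

lemma bound_scaled:
  assumes "f \<in> pos_C0" "\<And>x. f x \<le> d" "0 < d" shows "L f \<le> d * C"
proof -
  have p: "(\<lambda>x. (1/d) * f x) \<in> pos_C0" using assms by (intro pos_C0_cmult) auto
  have "L f = d * L (\<lambda>x. (1/d) * f x)" using cmult[OF p, of d] assms(3) by simp
  also have "\<dots> \<le> d * C" using assms by (intro mult_left_mono bound p) (auto simp: divide_le_eq)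
  finally show ?thesis .
qed

text \<open>Cutting off at height \<open>d\<close> costs at most \<open>d * C\<close>, and the
  remaining \<open>max (f x - d) 0\<close> lives on the compact set where
  \<open>d \<le> f x\<close>. This takes over the role of functions with compact support.\<close>

lemma trunc_le:
  assumes "f \<in> pos_C0" "0 < d" shows "L f \<le> L (\<lambda>x. max (f x - d) 0) + d * C"
proof -
  have t: "(\<lambda>x. max (f x - d) 0) \<in> pos_C0" "(\<lambda>x. min (f x) d) \<in> pos_C0"
    using assms by (intro pos_C0_trunc pos_C0_min; simp)+
  have "f = (\<lambda>x. max (f x - d) 0 + min (f x) d)" by (auto simp: max_def min_def)
  then have "L f = L (\<lambda>x. max (f x - d) 0) + L (\<lambda>x. min (f x) d)" using add[OF t] by simp
  also have "L (\<lambda>x. min (f x) d) \<le> d * C" by (rule bound_scaled[OF t(2) _ assms(2)]) simp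
  finally show ?thesis by simp
qed

text \<open>The support of these functions need not lie in \<open>V\<close>; for a bounded functional on functions vanishing at infinity this gives the same supremum.\<close>

definition below :: "'x set \<Rightarrow> ('x \<Rightarrow> real) set" where
  "below V = {f\<in>pos_C0. (\<forall>x. f x \<le> 1) \<and> (\<forall>x. x \<notin> V \<longrightarrow> f x = 0)}"

definition content :: "'x set \<Rightarrow> ennreal" where
  "content V = (SUP f\<in>below V. ennreal (L f))"

definition outer :: "'x set \<Rightarrow> ennreal" where
  "outer A = (INF V\<in>{V. open V \<and> A \<subseteq> V}. content V)"

lemma belowD: "f \<in> below V \<Longrightarrow> f \<in> pos_C0" "f \<in> below V \<Longrightarrow> f x \<le> 1" "f \<in> below V \<Longrightarrow> x \<notin> V \<Longrightarrow> f x = 0"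
    "f \<in> below V \<Longrightarrow> 0 \<le> f x"
  by (auto simp: below_def pos_C0_def)

lemma zero_below: "(\<lambda>_. 0) \<in> below V" by (simp add: below_def zero_pos_C0)

lemma below_mono: "V \<subseteq> W \<Longrightarrow> below V \<subseteq> below W" by (auto simp: below_def)

lemma content_upper: "f \<in> below V \<Longrightarrow> ennreal (L f) \<le> content V"
  unfolding content_def by (rule SUP_upper)

lemma content_mono: "V \<subseteq> W \<Longrightarrow> content V \<le> content W"
  unfolding content_def by (intro SUP_subset_mono below_mono) auto

lemma content_le_C: "content V \<le> ennreal C"
  unfolding content_def by (intro SUP_least ennreal_leI bound) (auto dest: belowD)

lemma outer_open: "open V \<Longrightarrow> outer V = content V"
  unfolding outer_def by (intro antisym INF_lower INF_greatest content_mono) auto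

lemma outer_mono: "A \<subseteq> B \<Longrightarrow> outer A \<le> outer B"
  unfolding outer_def by (intro INF_superset_mono) auto

lemma outer_le: "open V \<Longrightarrow> A \<subseteq> V \<Longrightarrow> outer A \<le> content V"
  unfolding outer_def by (intro INF_lower) auto

lemma outer_le_C: "outer A \<le> ennreal C"
  using outer_le[of UNIV A] content_le_C[of UNIV] by simp

lemma outer_empty: "outer {} = 0"
proof -
  have "content {} = 0"
  proof -
    have "L f = 0" if "f \<in> below {}" for f
    proof -
      have "f = (\<lambda>_. 0)" using belowD(3)[OF that] by auto
      then show ?thesis using zero by simp
    qed
    then show ?thesis unfolding content_def using zero_below by (auto intro!: antisym SUP_least)
  qed
  then show ?thesis by (simp add: outer_open)
qed

text \<open>After truncation only a compact set matters, which finitely many of the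
  \<open>V n\<close> cover. A partition of unity subordinate to them splits the truncated function
  into pieces, each counted by one \<open>content (V m)\<close>.\<close>

lemma content_countably_subadditive:
  assumes V: "\<And>n::nat. open (V n)"
  shows "content (\<Union>n. V n) \<le> (\<Sum>n. content (V n))"
  unfolding content_def[of "\<Union>n. V n"]
proof (rule SUP_least)
  fix g assume g: "g \<in> below (\<Union>n. V n)"
  note gp = belowD(1)[OF g]
  show "ennreal (L g) \<le> (\<Sum>n. content (V n))"
  proof (rule ennreal_le_epsilon)
    fix e :: real assume e: "e > 0"
    \<comment> \<open>\<open>C\<close> may be 0, so the divisor is \<open>C + 1\<close>.\<close>
    define d where "d = e / (C + 1)"
    have d: "d > 0" "d * C \<le> e" using e C_nonneg by (auto simp: d_def field_simps)
    define k where "k = (\<lambda>x. max (g x - d) 0)"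
    have kp: "k \<in> pos_C0" unfolding k_def using gp d by (intro pos_C0_trunc) auto
    have k1: "k x \<le> 1" for x unfolding k_def using belowD(2)[OF g, of x] d by simp
    define K where "K = {x. d \<le> g x}"
    have "K = {x. d \<le> norm (g x)}" using pos_C0D(2)[OF gp] by (simp add: K_def)
    then have K: "compact K" using C0_compact_level[OF pos_C0D(1)[OF gp] d(1)] by simp
    have "\<exists>n. x \<in> V n" if "x \<in> K" for x
      using belowD(3)[OF g, of x] d(1) that by (auto simp: K_def)
    then obtain n where n: "\<And>x. x \<in> K \<Longrightarrow> x \<in> V (n x)" by metis
    then obtain D h where D: "finite D" "D \<subseteq> K"
      and h: "\<forall>x\<in>D. h x \<in> pos_C0 \<and> (\<forall>y. h x y \<le> 1) \<and> (\<forall>y. y \<notin> V (n x) \<longrightarrow> h x y = 0)"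
      and cover: "\<forall>y\<in>K. 1/2 < (\<Sum>x\<in>D. h x y)"
      using C0_Urysohn_cover[OF lc K, of "\<lambda>x. V (n x)"] V by blast
    \<comment> \<open>On \<open>K\<close> this is the sum itself. Elsewhere the lower bound 1/2
      keeps the quotients below continuous, and their factor \<open>k\<close> is 0 there.\<close>
    define H where "H y = max (\<Sum>x\<in>D. h x y) (1/2)" for y
    \<comment> \<open>All bump functions assigned to the same index \<open>m\<close> are collected,
      so that \<open>q m\<close> vanishes outside \<open>V m\<close>.\<close>
    define q where "q m y = k y * (\<Sum>x | x \<in> D \<and> n x = m. h x y) / H y" for m y
    have hc: "continuous_on UNIV (h x)" if "x \<in> D" for x using h that by (blast intro: pos_C0_continuous)
    have h0: "0 \<le> h x y" if "x \<in> D" for x y using h that by (blast intro: pos_C0D)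
    have Hpos: "H y > 0" for y by (simp add: H_def)
    have part: "(\<Sum>x | x \<in> D \<and> n x = m. h x y) \<le> H y" for m y
    proof -
      have "(\<Sum>x | x \<in> D \<and> n x = m. h x y) \<le> (\<Sum>x\<in>D. h x y)" using D(1) h0 by (intro sum_mono2) auto
      then show ?thesis by (simp add: H_def)
    qed
    have qb: "q m \<in> below (V m)" for m
    proof -
      have qk: "q m y \<le> k y" for y
      proof -
        have "k y * (\<Sum>x | x \<in> D \<and> n x = m. h x y) \<le> k y * H y"
          by (intro mult_left_mono part pos_C0D(2)[OF kp])
        then show ?thesis using Hpos[of y] by (simp add: q_def divide_le_eq)
      qed
      have "continuous_on UNIV (q m)"
        unfolding q_def H_def
        by (intro continuous_on_divide continuous_on_mult continuous_on_max continuous_on_sum continuous_on_const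
            pos_C0_continuous[OF kp]) (auto intro: hc)
      moreover have "0 \<le> q m y" for y
        unfolding q_def using h0 Hpos[of y] pos_C0D(2)[OF kp, of y]
        by (intro divide_nonneg_pos mult_nonneg_nonneg sum_nonneg) auto
      ultimately have "q m \<in> pos_C0" using qk by (intro pos_C0_le[OF kp])
      moreover have "q m y = 0" if "y \<notin> V m" for y
      proof -
        have "(\<Sum>x | x \<in> D \<and> n x = m. h x y) = 0" using h that by (intro sum.neutral) auto
        then show ?thesis by (simp add: q_def)
      qed
      ultimately show ?thesis using qk k1 by (auto simp: below_def intro: order_trans)
    qed
    define N where "N = Suc (Max (n ` D))"
    have nN: "n x < N" if "x \<in> D" for x using D(1) that by (simp add: N_def less_Suc_eq_le)
    have "k y = (\<Sum>m<N. q m y)" for y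
    proof -
      have "(\<Sum>m<N. \<Sum>x | x \<in> D \<and> n x = m. h x y) = (\<Sum>x\<in>D. h x y)"
        using nN D(1) by (intro sum.group) auto
      then have "(\<Sum>m<N. q m y) = k y * (\<Sum>x\<in>D. h x y) / H y"
        by (simp add: q_def flip: sum_distrib_left sum_divide_distrib)
      also have "\<dots> = k y"
      proof (cases "y \<in> K")
        case True
        then have "H y = (\<Sum>x\<in>D. h x y)" using cover True by (force simp: H_def)
        then show ?thesis using Hpos[of y] by simp
      next
        case False
        then have "k y = 0" by (simp add: K_def k_def)
        then show ?thesis by simp
      qed
      finally show ?thesis by simp
    qed
    then have "k = (\<lambda>y. \<Sum>m<N. q m y)" by (rule ext)
    then have "L k = L (\<lambda>y. \<Sum>m<N. q m y)" by (rule arg_cong)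
    also have "\<dots> = (\<Sum>m<N. L (q m))" using sum[of "{..<N}" q] belowD(1)[OF qb] by simp
    finally have "ennreal (L k) = (\<Sum>m<N. ennreal (L (q m)))"
      using nonneg[OF belowD(1)[OF qb]] by (simp add: sum_ennreal)
    also have "\<dots> \<le> (\<Sum>m<N. content (V m))" by (intro sum_mono content_upper qb)
    also have "\<dots> \<le> (\<Sum>m. content (V m))" by (rule sum_le_suminf) auto
    finally have Lk: "ennreal (L k) \<le> (\<Sum>m. content (V m))" .
    have "L g \<le> L k + e" using trunc_le[OF gp d(1)] d(2) by (simp add: k_def)
    then have "ennreal (L g) \<le> ennreal (L k + e)" by (rule ennreal_leI)
    also have "\<dots> = ennreal (L k) + ennreal e" using nonneg[OF kp] e by simp
    also have "\<dots> \<le> (\<Sum>m. content (V m)) + ennreal e" by (rule add_right_mono[OF Lk])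
    finally show "ennreal (L g) \<le> (\<Sum>m. content (V m)) + ennreal e" .
  qed
qed

lemma outer_approx:
  assumes "e > 0" shows "\<exists>V. open V \<and> A \<subseteq> V \<and> content V \<le> outer A + ennreal e"
proof -
  have "outer A < outer A + ennreal e"
    using outer_le_C[of A] assms
    by (cases "outer A") (auto simp: ennreal_less_iff top_unique simp flip: ennreal_plus)
  then obtain V where "open V" "A \<subseteq> V" "content V < outer A + ennreal e"
    unfolding outer_def INF_less_iff by blast
  then show ?thesis using less_imp_le by blast
qed

lemma outer_measure_space_outer: "outer_measure_space (Pow UNIV) outer"
  unfolding outer_measure_space_def
proof (intro conjI)
  show "positive (Pow UNIV) outer" by (simp add: positive_def outer_empty)
  show "increasing (Pow UNIV) outer" by (simp add: increasing_def outer_mono)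
  show "countably_subadditive (Pow UNIV) outer"
    unfolding countably_subadditive_def
  proof (intro allI impI)
    fix A :: "nat \<Rightarrow> 'x set"
    show "outer (\<Union>i. A i) \<le> (\<Sum>i. outer (A i))"
    proof (rule ennreal_le_epsilon)
      fix e :: real assume e: "e > 0"
      have "\<exists>V. open V \<and> A i \<subseteq> V \<and> content V \<le> outer (A i) + ennreal (e * (1/2) ^ Suc i)" for i
      proof -
        have "e * (1/2) ^ Suc i > 0" using e by simp
        then show ?thesis by (rule outer_approx)
      qed
      then obtain V where V: "\<And>i. open (V i)" "\<And>i. A i \<subseteq> V i"
        "\<And>i. content (V i) \<le> outer (A i) + ennreal (e * (1/2) ^ Suc i)" by metis
      have "outer (\<Union>i. A i) \<le> content (\<Union>i. V i)" using V by (intro outer_le) auto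
      also have "\<dots> \<le> (\<Sum>i. content (V i))" by (rule content_countably_subadditive[OF V(1)])
      also have "\<dots> \<le> (\<Sum>i. outer (A i) + ennreal (e * (1/2) ^ Suc i))" by (intro suminf_le V(3) summableI)
      also have "\<dots> = (\<Sum>i. outer (A i)) + (\<Sum>i. ennreal (e * (1/2) ^ Suc i))"
        by (rule suminf_add[symmetric]) auto
      also have "(\<Sum>i. ennreal (e * (1/2) ^ Suc i)) = ennreal e"
      proof (rule suminf_ennreal_eq)
        show "(\<lambda>i. e * (1/2) ^ Suc i) sums e" using sums_mult[OF power_half_series, of e] by simp
      qed (use e in simp)
      finally show "outer (\<Union>i. A i) \<le> (\<Sum>i. outer (A i)) + ennreal e" .
    qed
  qed
qed

text \<open>If \<open>h\<close> vanishes on the level set where \<open>d \<le> g x\<close>, then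
  \<open>max (g x - d) 0\<close> and \<open>h\<close> are never nonzero together, so their sum is
  again below \<open>V\<close>. Both the measurability of open sets and tightness rest on
  this.\<close>

lemma content_split:
  assumes V: "open V" and g: "g \<in> below V" and d: "d > 0"
  shows "ennreal (L g) + content (V - {x. d \<le> g x}) \<le> content V + ennreal (d * C)"
proof -
  note gp = belowD(1)[OF g]
  let ?k = "\<lambda>x. max (g x - d) 0" and ?W = "V - {x. d \<le> g x}"
  have kp: "?k \<in> pos_C0" using gp d by (intro pos_C0_trunc) auto
  have "ennreal (L ?k) + ennreal (L h) \<le> content V" if h: "h \<in> below ?W" for h
  proof -
    have "?k x + h x \<le> 1 \<and> (x \<notin> V \<longrightarrow> ?k x + h x = 0)" for x
      using belowD(2,3)[OF g, of x] belowD(2,3)[OF h, of x] d by (cases "d \<le> g x") auto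
    then have "(\<lambda>x. ?k x + h x) \<in> below V"
      unfolding below_def using pos_C0_add[OF kp belowD(1)[OF h]] by simp
    from content_upper[OF this] show ?thesis
      using nonneg[OF kp] nonneg[OF belowD(1)[OF h]] by (simp add: add[OF kp belowD(1)[OF h]])
  qed
  then have *: "ennreal (L ?k) + content ?W \<le> content V"
    unfolding content_def[of ?W] using zero_below
    by (subst ennreal_SUP_add_right) (auto intro!: SUP_least)
  have "ennreal (L g) \<le> ennreal (L ?k + d * C)" by (intro ennreal_leI trunc_le gp d)
  also have "\<dots> = ennreal (L ?k) + ennreal (d * C)" using nonneg[OF kp] d C_nonneg by simp
  finally have "ennreal (L g) + content ?W \<le> (ennreal (L ?k) + ennreal (d * C)) + content ?W" by (rule add_right_mono)
  also have "\<dots> = (ennreal (L ?k) + content ?W) + ennreal (d * C)" by (simp add: ac_simps)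
  also have "\<dots> \<le> content V + ennreal (d * C)" by (rule add_right_mono[OF *])
  finally show ?thesis .
qed

lemma open_level: "g \<in> below V \<Longrightarrow> open W \<Longrightarrow> open (W - {x. d \<le> g x})"
  by (intro open_Diff closed_Collect_le continuous_on_const pos_C0_continuous belowD(1))

text \<open>For \<open>g\<close> below \<open>V \<inter> W\<close> the level set where
  \<open>d \<le> g x\<close> lies in \<open>V\<close>, so \<open>W - V\<close> lies in the open set
  left by \<open>content_split\<close>. The supremum over \<open>g\<close> and the infimum over
  \<open>W\<close> then give the splitting inequality of Caratheodory's criterion.\<close>

lemma open_in_lambda_system:
  assumes V: "open V" shows "V \<in> lambda_system UNIV (Pow UNIV) outer"
  unfolding lambda_system_def
proof (intro CollectI conjI ballI antisym)
  show "V \<in> Pow UNIV" by simp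
  fix A :: "'x set"
  interpret sigma_algebra UNIV "Pow (UNIV :: 'x set)" by (rule sigma_algebra_Pow)
  have "subadditive (Pow UNIV) outer"
    using outer_measure_space_outer unfolding outer_measure_space_def
    by (intro countably_subadditive_subadditive) auto
  then have "outer ((V \<inter> A) \<union> ((UNIV - V) \<inter> A)) \<le> outer (V \<inter> A) + outer ((UNIV - V) \<inter> A)"
    by (rule subadditiveD) auto
  moreover have "(V \<inter> A) \<union> ((UNIV - V) \<inter> A) = A" by blast
  ultimately show "outer A \<le> outer (V \<inter> A) + outer ((UNIV - V) \<inter> A)" by simp
  have "outer (V \<inter> A) + outer ((UNIV - V) \<inter> A) \<le> content W" if W: "open W" "A \<subseteq> W" for W
  proof -
    have "ennreal (L g) + outer (W - V) \<le> content W" if g: "g \<in> below (V \<inter> W)" for g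
    proof (rule ennreal_le_epsilon)
      fix e :: real assume e: "e > 0"
      define d where "d = e / (C + 1)"
      have d: "d > 0" "d * C \<le> e" using e C_nonneg by (auto simp: d_def field_simps)
      have gW: "g \<in> below W" using g below_mono[of "V \<inter> W" W] by auto
      have "W - V \<subseteq> W - {x. d \<le> g x}" using belowD(3)[OF g] d(1) by auto
      then have "outer (W - V) \<le> content (W - {x. d \<le> g x})" by (intro outer_le open_level[OF g W(1)])
      then have "ennreal (L g) + outer (W - V) \<le> ennreal (L g) + content (W - {x. d \<le> g x})" by (rule add_left_mono)
      also have "\<dots> \<le> content W + ennreal (d * C)" by (rule content_split[OF W(1) gW d(1)])
      also have "\<dots> \<le> content W + ennreal e" by (intro add_left_mono ennreal_leI d)
      finally show "ennreal (L g) + outer (W - V) \<le> content W + ennreal e" .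
    qed
    then have "content (V \<inter> W) + outer (W - V) \<le> content W"
      unfolding content_def[of "V \<inter> W"] using zero_below
      by (subst ennreal_SUP_add_left[symmetric]) (auto intro!: SUP_least)
    moreover have "outer (V \<inter> A) \<le> content (V \<inter> W)" using V W by (intro outer_le) auto
    moreover have "outer ((UNIV - V) \<inter> A) \<le> outer (W - V)" using W by (intro outer_mono) auto
    ultimately show ?thesis by (meson add_mono order_trans)
  qed
  then show "outer (V \<inter> A) + outer ((UNIV - V) \<inter> A) \<le> outer A"
    unfolding outer_def[of A] by (intro INF_greatest) auto
qed

definition riesz :: "'x measure" where
  "riesz = measure_of UNIV (sets borel) outer"

lemma sets_riesz [simp]: "sets riesz = sets borel"
  unfolding riesz_def using sets.sigma_sets_eq[of "borel :: 'x measure"] by (simp add: sets_measure_of_conv)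

text \<open>Caratheodory's sets form a sigma-algebra on which the outer measure is countably
  additive; containing the open sets, it contains the Borel sets.\<close>

lemma emeasure_riesz:
  assumes "A \<in> sets borel" shows "emeasure riesz A = outer A"
proof -
  interpret P: sigma_algebra UNIV "Pow (UNIV :: 'x set)" by (rule sigma_algebra_Pow)
  have ms: "measure_space UNIV (lambda_system UNIV (Pow UNIV) outer) outer"
    by (rule P.caratheodory_lemma[OF outer_measure_space_outer])
  then interpret l: sigma_algebra UNIV "lambda_system UNIV (Pow UNIV) outer"
    by (simp add: measure_space_def)
  have sub: "sets borel \<subseteq> lambda_system UNIV (Pow UNIV) outer"
  proof -
    have "sigma_sets UNIV {S :: 'x set. open S} \<subseteq> lambda_system UNIV (Pow UNIV) outer"
      by (rule l.sigma_sets_subset) (use open_in_lambda_system in blast)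
    moreover have "sets borel = sigma_sets UNIV {S :: 'x set. open S}" by (simp add: borel_def)
    ultimately show ?thesis by (simp only:)
  qed
  have ca: "countably_additive (lambda_system UNIV (Pow UNIV) outer) outer"
    using ms by (simp add: measure_space_def)
  show ?thesis
    unfolding riesz_def
  proof (rule emeasure_measure_of_sigma)
    show "sigma_algebra UNIV (sets (borel :: 'x measure))"
      using sets.sigma_algebra_axioms[of "borel :: 'x measure"] by simp
    show "positive (sets borel) outer" by (simp add: positive_def outer_empty)
    show "countably_additive (sets borel) outer"
      using ca sub unfolding countably_additive_def by (meson order_trans subsetD)
  qed fact
qed

lemma finite_measure_riesz: "finite_measure riesz"
proof
  have "space riesz = UNIV" using sets_eq_imp_space_eq[OF sets_riesz] by simp
  then show "emeasure riesz (space riesz) \<noteq> \<infinity>"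
    using outer_le_C[of UNIV] by (auto simp: emeasure_riesz top_unique)
qed

lemma space_riesz [simp]: "space riesz = UNIV"
  using sets_eq_imp_space_eq[OF sets_riesz] by simp

lemma content_eq_measure: "open V \<Longrightarrow> content V = ennreal (measure riesz V)"
  using finite_measure.emeasure_eq_measure[OF finite_measure_riesz, of V] by (simp add: emeasure_riesz outer_open)

lemma le_measure: "open V \<Longrightarrow> f \<in> below V \<Longrightarrow> L f \<le> measure riesz V"
  using content_upper[of f V] by (simp add: content_eq_measure)

lemma measure_le:
  assumes "open V" "0 \<le> c" "\<And>f. f \<in> below V \<Longrightarrow> L f \<le> c" shows "measure riesz V \<le> c"
proof -
  have "content V \<le> ennreal c" unfolding content_def by (intro SUP_least ennreal_leI assms)
  then show ?thesis using assms by (simp add: content_eq_measure)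
qed

lemma measure_split:
  assumes "open V" "g \<in> below V" "d > 0"
  shows "L g + measure riesz (V - {x. d \<le> g x}) \<le> measure riesz V + d * C"
proof -
  have "ennreal (L g + measure riesz (V - {x. d \<le> g x})) \<le> ennreal (measure riesz V + d * C)"
    using content_split[OF assms] nonneg[OF belowD(1)[OF assms(2)]] mult_nonneg_nonneg[OF less_imp_le[OF assms(3)] C_nonneg]
    by (simp add: content_eq_measure assms(1) open_level[OF assms(2,1)])
  then show ?thesis using assms(3) C_nonneg by (subst (asm) ennreal_le_iff) auto
qed

lemma outer_regular:
  assumes E: "E \<in> sets borel" and e: "e > 0"
  shows "\<exists>U. open U \<and> E \<subseteq> U \<and> measure riesz (U - E) < e"
proof -
  interpret finite_measure riesz by (rule finite_measure_riesz)
  have "e/2 > 0" using e by simp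
  then obtain U where U: "open U" "E \<subseteq> U" "content U \<le> outer E + ennreal (e/2)"
    using outer_approx by blast
  have "ennreal (measure riesz U) \<le> ennreal (measure riesz E + e/2)"
    using U e E by (simp add: content_eq_measure emeasure_eq_measure flip: emeasure_riesz)
  then have "measure riesz U \<le> measure riesz E + e/2" using e by (subst (asm) ennreal_le_iff) auto
  moreover have "measure riesz (U - E) = measure riesz U - measure riesz E"
    using U E by (intro finite_measure_Diff) auto
  ultimately have "measure riesz (U - E) < e" using e by linarith
  then show ?thesis using U by blast
qed

text \<open>If \<open>L g\<close> is close to the total mass, little mass lies off the compact level
  set of \<open>g\<close>; \<open>measure_split\<close> makes this precise.\<close>

lemma tight:
  assumes e: "e > 0" shows "\<exists>K. compact K \<and> measure riesz (- K) < e"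
proof -
  \<comment> \<open>With this \<open>d\<close> the truncation costs at most \<open>e/4\<close>,
    which together with the \<open>e/2\<close> from the choice of \<open>g\<close> stays below
    \<open>e\<close>.\<close>
  define d where "d = e / (4 * (C + 1))"
  have d: "d > 0" "d * C \<le> e/4" using e C_nonneg by (auto simp: d_def field_simps)
  have "\<exists>g\<in>below UNIV. measure riesz UNIV - e/2 \<le> L g"
  proof (rule ccontr)
    assume "\<not> ?thesis"
    then have *: "\<And>g. g \<in> below UNIV \<Longrightarrow> L g \<le> measure riesz UNIV - e/2" by (meson linear)
    \<comment> \<open>\<open>measure_le\<close> asks for a nonnegative bound; the zero function
      shows that this one is.\<close>
    have "0 \<le> measure riesz UNIV - e/2" using *[OF zero_below] zero by simp
    from measure_le[OF open_UNIV this *] show False using e by simp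
  qed
  then obtain g where g: "g \<in> below UNIV" "measure riesz UNIV - e/2 \<le> L g" by blast
  have "- {x. d \<le> g x} = UNIV - {x. d \<le> g x}" by blast
  then have "measure riesz (- {x. d \<le> g x}) \<le> e/2 + e/4"
    using measure_split[OF open_UNIV g(1) d(1)] g(2) d(2) by simp
  moreover have "compact {x. d \<le> g x}"
    using C0_compact_level[OF pos_C0D(1)[OF belowD(1)[OF g(1)]] d(1)] belowD(4)[OF g(1)] by simp
  ultimately show ?thesis using e by (intro exI[of _ "{x. d \<le> g x}"]) auto
qed

text \<open>An open set around the complement of \<open>E\<close> has a closed complement inside
  \<open>E\<close>, and intersecting the latter with a compact set of nearly full measure makes it
  compact.\<close>

theorem radon_riesz: "radon riesz"
  unfolding radon_def
proof (intro conjI ballI allI impI sets_riesz finite_measure_riesz)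
  interpret finite_measure riesz by (rule finite_measure_riesz)
  fix E :: "'x set" and e :: real assume E: "E \<in> sets borel" and e: "e > 0"
  have e3: "e/3 > 0" using e by simp
  obtain U where U: "open U" "E \<subseteq> U" "measure riesz (U - E) < e/3" using outer_regular[OF E e3] by blast
  have "- E \<in> sets borel" using E by (simp add: Compl_eq_Diff_UNIV)
  then obtain W where W: "open W" "- E \<subseteq> W" "measure riesz (W - - E) < e/3" using outer_regular e3 by blast
  obtain K where K: "compact K" "measure riesz (- K) < e/3" using tight[OF e3] by blast
  have Kb: "K \<in> sets borel" by (simp add: K borel_closed compact_imp_closed)
  have b: "U - E \<in> sets borel" "W - - E \<in> sets borel" "- K \<in> sets borel"
    using U W E Kb by (auto simp: Compl_eq_Diff_UNIV)
  have "compact (K - W)" using K W by (simp add: compact_diff)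
  moreover have "K - W \<subseteq> E" using W by blast
  moreover have "measure riesz (U - (K - W)) < e"
  proof -
    have "U - (K - W) \<subseteq> ((U - E) \<union> (W - - E)) \<union> - K" by blast
    then have "measure riesz (U - (K - W)) \<le> measure riesz (((U - E) \<union> (W - - E)) \<union> - K)"
      using b by (intro finite_measure_mono) auto
    also have "\<dots> \<le> measure riesz ((U - E) \<union> (W - - E)) + measure riesz (- K)"
      using b by (intro measure_subadditive) auto
    also have "\<dots> \<le> measure riesz (U - E) + measure riesz (W - - E) + measure riesz (- K)"
      using b by (intro add_right_mono measure_subadditive) auto
    finally show ?thesis using U W K by linarith
  qed
  ultimately show "\<exists>K U. compact K \<and> open U \<and> K \<subseteq> E \<and> E \<subseteq> U \<and> measure riesz (U - K) < e"
    using U by blast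
qed

lemma integrable_C0: "f \<in> C0 \<Longrightarrow> integrable riesz (f :: 'x \<Rightarrow> real)"
proof -
  interpret finite_measure riesz by (rule finite_measure_riesz)
  assume f: "f \<in> C0"
  obtain B where "\<And>x. norm (f x) \<le> B" using C0_bounded[OF f] by blast
  moreover have "f \<in> borel_measurable riesz"
    using borel_measurable_continuous_onI[OF C0_continuous[OF f]] measurable_cong_sets[OF sets_riesz refl] by blast
  ultimately show ?thesis by (intro integrable_const_bound[of _ B]) auto
qed

text \<open>Cutting \<open>f\<close> into horizontal slices of height \<open>1/N\<close>, the functional and the integral of
  each slice lie between the measures of two consecutive superlevel sets, so the
  total discrepancy telescopes.\<close>

lemma integral_riesz_le_1:
  assumes f: "f \<in> pos_C0" and f1: "\<And>x. f x \<le> 1"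
  shows "integral\<^sup>L riesz f = L f"
proof -
  interpret finite_measure riesz by (rule finite_measure_riesz)
  have bound: "\<bar>integral\<^sup>L riesz f - L f\<bar> \<le> measure riesz UNIV / real N" if N: "N > 0" for N :: nat
  proof -
    \<comment> \<open>The slice of \<open>f\<close> between heights \<open>i/N\<close> and
      \<open>(i+1)/N\<close>, stretched to height 1: it is 1 on \<open>A (Suc i)\<close> and 0
      outside \<open>A i\<close>.\<close>
    define s where "s i x = real N * min (max (f x - real i / real N) 0) (1 / real N)" for i x
    define A where "A i = {x. real i / real N < f x}" for i
    have Ao: "open (A i)" for i
      unfolding A_def by (intro open_Collect_less continuous_on_const pos_C0_continuous f)
    have sp: "s i \<in> pos_C0" for i
      unfolding s_def[abs_def] by (intro pos_C0_cmult pos_C0_min pos_C0_trunc f) auto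
    have s1: "s i x \<le> 1" for i x
    proof -
      have "s i x \<le> real N * (1 / real N)" unfolding s_def by (intro mult_left_mono) auto
      then show ?thesis using N by simp
    qed
    have s0: "s i x = 0" if "x \<notin> A i" for i x using that by (simp add: s_def A_def)
    have sone: "s i x = 1" if "x \<in> A (Suc i)" for i x
    proof -
      have "1 / real N \<le> f x - real i / real N" using that N by (simp add: A_def add_divide_distrib)
      then have "min (max (f x - real i / real N) 0) (1 / real N) = 1 / real N"
        by (simp add: min_absorb2 le_max_iff_disj)
      then show ?thesis using N by (simp add: s_def)
    qed
    have sb: "s i \<in> below (A i)" for i using sp s1 s0 by (simp add: below_def)
    have L1: "L (s i) \<le> measure riesz (A i)" for i by (rule le_measure[OF Ao sb])
    have L2: "measure riesz (A (Suc i)) \<le> L (s i)" for i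
    proof (rule measure_le[OF Ao nonneg[OF sp]])
      fix g assume g: "g \<in> below (A (Suc i))"
      have "g x \<le> s i x" for x
        using belowD(2,3)[OF g, of x] sone[of x i] pos_C0D(2)[OF sp, of i x] by (cases "x \<in> A (Suc i)") auto
      then show "L g \<le> L (s i)" by (intro mono belowD(1)[OF g] sp)
    qed
    have si: "integrable riesz (s i)" for i by (intro integrable_C0 pos_C0D(1) sp)
    have I1: "integral\<^sup>L riesz (s i) \<le> measure riesz (A i)" for i
    proof -
      have "integral\<^sup>L riesz (s i) \<le> integral\<^sup>L riesz (indicator (A i) :: _ \<Rightarrow> real)"
        using Ao si s0 s1 by (intro integral_mono) (auto simp: indicator_def emeasure_eq_measure)
      then show ?thesis by simp
    qed
    have I2: "measure riesz (A (Suc i)) \<le> integral\<^sup>L riesz (s i)" for i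
    proof -
      have "integral\<^sup>L riesz (indicator (A (Suc i)) :: _ \<Rightarrow> real) \<le> integral\<^sup>L riesz (s i)"
        using Ao si sone pos_C0D(2)[OF sp] by (intro integral_mono) (auto simp: indicator_def emeasure_eq_measure)
      then show ?thesis by simp
    qed
    \<comment> \<open>Adding the slices below height \<open>n/N\<close> gives the value cut off at
      that height; for \<open>n = N\<close> nothing of \<open>f\<close> is cut, as it is at most
      1.\<close>
    have tel: "(\<Sum>i<n. min (max (t - real i / real N) 0) (1 / real N)) = min t (real n / real N)" if "0 \<le> t" for t n
    proof (induction n)
      case 0 then show ?case using that by simp
    next
      case (Suc n)
      have "min t a + min (max (t - a) 0) b = min t (a + b)" if "0 \<le> b" for a b :: real
        using that by (auto simp: min_def max_def)
      from this[of "1 / real N" "real n / real N"] show ?case by (simp add: Suc add_divide_distrib add.commute)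
    qed
    have Nf: "real N * f x = (\<Sum>i<N. s i x)" for x
      using tel[OF pos_C0D(2)[OF f], of x N] f1[of x] N by (simp add: s_def flip: sum_distrib_left)
    have "real N * L f = L (\<lambda>x. real N * f x)" by (simp add: cmult f)
    also have "\<dots> = (\<Sum>i<N. L (s i))" using sum[of "{..<N}" s] sp by (simp add: Nf)
    finally have a: "real N * L f = (\<Sum>i<N. L (s i))" .
    have "real N * integral\<^sup>L riesz f = integral\<^sup>L riesz (\<lambda>x. \<Sum>i<N. s i x)" by (simp flip: Nf)
    also have "\<dots> = (\<Sum>i<N. integral\<^sup>L riesz (s i))" by (rule Bochner_Integration.integral_sum) (rule si)
    finally have b: "real N * integral\<^sup>L riesz f = (\<Sum>i<N. integral\<^sup>L riesz (s i))" .
    have "\<bar>real N * integral\<^sup>L riesz f - real N * L f\<bar> \<le> (\<Sum>i<N. \<bar>integral\<^sup>L riesz (s i) - L (s i)\<bar>)"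
      unfolding a b sum_subtractf[symmetric] by (rule sum_abs)
    also have "\<dots> \<le> (\<Sum>i<N. measure riesz (A i) - measure riesz (A (Suc i)))"
    proof (rule sum_mono)
      fix i show "\<bar>integral\<^sup>L riesz (s i) - L (s i)\<bar> \<le> measure riesz (A i) - measure riesz (A (Suc i))"
        using L1[of i] L2[of i] I1[of i] I2[of i] by linarith
    qed
    also have "\<dots> = measure riesz (A 0) - measure riesz (A N)" by (rule sum_lessThan_telescope')
    also have "\<dots> \<le> measure riesz UNIV"
      using finite_measure_mono[of "A 0" UNIV] by (simp add: diff_le_eq add_increasing2)
    finally have "real N * \<bar>integral\<^sup>L riesz f - L f\<bar> \<le> measure riesz UNIV"
      by (simp add: abs_mult flip: right_diff_distrib)
    then show ?thesis using N by (simp add: pos_le_divide_eq mult.commute)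
  qed
  have "(\<lambda>N. measure riesz UNIV / real N) \<longlonglongrightarrow> 0" by (rule lim_const_over_n)
  then have "\<bar>integral\<^sup>L riesz f - L f\<bar> \<le> 0"
    by (rule LIMSEQ_le_const) (use bound in \<open>auto intro!: exI[of _ 1]\<close>)
  then show ?thesis by simp
qed

theorem integral_riesz:
  assumes f: "f \<in> pos_C0" shows "integral\<^sup>L riesz f = L f"
proof -
  obtain B where B: "B > 0" "\<And>x. norm (f x) \<le> B" using C0_bounded[OF pos_C0D(1)[OF f]] by blast
  have p: "(\<lambda>x. (1/B) * f x) \<in> pos_C0" using B f by (intro pos_C0_cmult) auto
  have "(1/B) * integral\<^sup>L riesz f = integral\<^sup>L riesz (\<lambda>x. (1/B) * f x)" by simp
  also have "\<dots> = L (\<lambda>x. (1/B) * f x)"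
    using B(1) order_trans[OF abs_ge_self B(2)[unfolded real_norm_def]]
    by (intro integral_riesz_le_1 p) (simp add: divide_le_eq)
  also have "\<dots> = (1/B) * L f" using B by (intro cmult f) simp
  finally show ?thesis using B(1) by simp
qed

end

section \<open>The Riesz representation theorem for real and complex functionals\<close>

locale bounded_real_functional =
  fixes T :: "('x::t2_space \<Rightarrow> real) \<Rightarrow> real" and C :: real
  assumes lc: "locally_compact_space (euclidean :: 'x topology)"
    and add: "f \<in> C0 \<Longrightarrow> g \<in> C0 \<Longrightarrow> T (\<lambda>x. f x + g x) = T f + T g"
    and cmult: "f \<in> C0 \<Longrightarrow> T (\<lambda>x. c * f x) = c * T f"
    and bound: "f \<in> C0 \<Longrightarrow> (\<And>x. \<bar>f x\<bar> \<le> B) \<Longrightarrow> \<bar>T f\<bar> \<le> C * B"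
begin

text \<open>This is the Riesz-Kantorovich formula. For \<open>f\<close> in \<open>pos_C0\<close> the
  competitors include 0, and \<open>T\<close> is bounded above on them.\<close>

definition positive_part :: "('x \<Rightarrow> real) \<Rightarrow> real" where
  "positive_part f = (SUP g\<in>{g\<in>pos_C0. \<forall>x. g x \<le> f x}. T g)"

lemma positive_part_upper:
  assumes f: "f \<in> pos_C0" and g: "g \<in> pos_C0" "\<And>x. g x \<le> f x" shows "T g \<le> positive_part f"
proof -
  obtain B where B: "\<And>x. norm (f x) \<le> B" using C0_bounded[OF pos_C0D(1)[OF f]] by blast
  have "T h \<le> C * B" if h: "h \<in> pos_C0" "\<forall>x. h x \<le> f x" for h
  proof -
    have "\<bar>h x\<bar> \<le> B" for x using B[of x] h(2) pos_C0D(2)[OF h(1), of x] by (auto intro: order_trans)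
    then show ?thesis using bound[OF pos_C0D(1)[OF h(1)]] by fastforce
  qed
  then have "bdd_above (T ` {g\<in>pos_C0. \<forall>x. g x \<le> f x})" by (intro bdd_aboveI[of _ "C * B"]) auto
  then show ?thesis unfolding positive_part_def using g by (intro cSUP_upper) auto
qed

lemma positive_part_least:
  assumes f: "f \<in> pos_C0" and b: "\<And>g. g \<in> pos_C0 \<Longrightarrow> (\<And>x. g x \<le> f x) \<Longrightarrow> T g \<le> b"
  shows "positive_part f \<le> b"
  unfolding positive_part_def using f b by (intro cSUP_least) auto

lemma zero: "T (\<lambda>_. 0) = 0" using cmult[OF C0_zero, of 0] by simp

lemma diff:
  assumes "f \<in> C0" "g \<in> C0" shows "T (\<lambda>x. f x - g x) = T f - T g"
proof -
  have "(\<lambda>x. -1 * g x) \<in> C0" using assms(2) by (rule C0_bounded_linear) (rule bounded_linear_mult_right)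
  from add[OF assms(1) this] show ?thesis using cmult[OF assms(2), of "-1"] by simp
qed

lemma zero_pos_C0: "(\<lambda>_. 0) \<in> pos_C0" by (intro pos_C0I) auto

lemma positive_part_nonneg: "f \<in> pos_C0 \<Longrightarrow> 0 \<le> positive_part f"
  using positive_part_upper[OF _ zero_pos_C0, of f] pos_C0D(2)[of f] by (simp add: zero)

text \<open>The inequality \<open>\<le>\<close> is the Riesz decomposition property: a competitor
  for the sum splits into its minimum with \<open>f\<close>, which is below \<open>f\<close>, and
  the rest, which is below \<open>f'\<close>. The other inequality adds competitors.\<close>

lemma positive_part_add:
  assumes f: "f \<in> pos_C0" "f' \<in> pos_C0"
  shows "positive_part (\<lambda>x. f x + f' x) = positive_part f + positive_part f'"
proof (rule antisym)
  note ff = pos_C0_add[OF f]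
  show "positive_part (\<lambda>x. f x + f' x) \<le> positive_part f + positive_part f'"
  proof (rule positive_part_least[OF ff])
    fix g assume g: "g \<in> pos_C0" "\<And>x. g x \<le> f x + f' x"
    have m: "(\<lambda>x. min (g x) (f x)) \<in> pos_C0"
    proof (rule pos_C0_le[OF g(1)])
      show "continuous_on UNIV (\<lambda>x. min (g x) (f x))"
        by (intro continuous_on_min pos_C0_continuous g f)
    qed (use pos_C0D(2)[OF g(1)] pos_C0D(2)[OF f(1)] in auto)
    have r: "(\<lambda>x. g x - min (g x) (f x)) \<in> pos_C0"
      using C0_diff[OF pos_C0D(1)[OF g(1)] pos_C0D(1)[OF m]] by (intro pos_C0I) auto
    have "T g = T (\<lambda>x. min (g x) (f x)) + T (\<lambda>x. g x - min (g x) (f x))"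
      using add[OF pos_C0D(1)[OF m] pos_C0D(1)[OF r]] by simp
    also have "\<dots> \<le> positive_part f + positive_part f'"
    proof (intro add_mono positive_part_upper f m r)
      show "g x - min (g x) (f x) \<le> f' x" for x using g(2)[of x] pos_C0D(2)[OF f(2), of x] by (simp add: min_def)
    qed simp
    finally show "T g \<le> positive_part f + positive_part f'" .
  qed
  have "T g \<le> positive_part (\<lambda>x. f x + f' x) - positive_part f'" if g: "g \<in> pos_C0" "\<And>x. g x \<le> f x" for g
  proof -
    have "positive_part f' \<le> positive_part (\<lambda>x. f x + f' x) - T g"
    proof (rule positive_part_least[OF f(2)])
      fix h assume h: "h \<in> pos_C0" "\<And>x. h x \<le> f' x"
      have "T g + T h = T (\<lambda>x. g x + h x)" by (rule add[symmetric]) (intro pos_C0D(1) g h)+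
      also have "\<dots> \<le> positive_part (\<lambda>x. f x + f' x)"
        by (intro positive_part_upper ff pos_C0_add g h add_mono)
      finally show "T h \<le> positive_part (\<lambda>x. f x + f' x) - T g" by simp
    qed
    then show ?thesis by simp
  qed
  then have "positive_part f \<le> positive_part (\<lambda>x. f x + f' x) - positive_part f'"
    by (rule positive_part_least[OF f(1)])
  then show "positive_part f + positive_part f' \<le> positive_part (\<lambda>x. f x + f' x)" by simp
qed

text \<open>One inequality holds for every positive factor, so applying it to \<open>1/c\<close>
  gives the reverse one. For \<open>c = 0\<close> additivity already forces the value 0.\<close>

lemma positive_part_cmult:
  assumes f: "f \<in> pos_C0" and c: "0 \<le> c" shows "positive_part (\<lambda>x. c * f x) = c * positive_part f"
proof (cases "c = 0")
  case True
  have "positive_part (\<lambda>_. 0) = positive_part (\<lambda>_. 0) + positive_part (\<lambda>_. 0)"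
    using positive_part_add[OF zero_pos_C0 zero_pos_C0] by simp
  then show ?thesis using True by simp
next
  case False
  have le: "positive_part (\<lambda>x. a * g x) \<le> a * positive_part g" if a: "a > 0" and g: "g \<in> pos_C0" for a g
  proof (rule positive_part_least[OF pos_C0_cmult[OF g less_imp_le[OF a]]])
    fix h assume h: "h \<in> pos_C0" "\<And>x. h x \<le> a * g x"
    have p: "(\<lambda>x. (1/a) * h x) \<in> pos_C0" using a h by (intro pos_C0_cmult) auto
    have "T h = a * T (\<lambda>x. (1/a) * h x)" using cmult[OF pos_C0D(1)[OF p], of a] a by simp
    also have "\<dots> \<le> a * positive_part g"
      using a h(2) by (intro mult_left_mono positive_part_upper g p) (auto simp: divide_le_eq mult.commute)
    finally show "T h \<le> a * positive_part g" .
  qed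
  have c0: "c > 0" using c False by simp
  have "positive_part f \<le> (1/c) * positive_part (\<lambda>x. c * f x)"
    using le[of "1/c" "\<lambda>x. c * f x"] pos_C0_cmult[OF f c] c0 by simp
  then have "c * positive_part f \<le> positive_part (\<lambda>x. c * f x)" using c0 by (simp add: pos_le_divide_eq mult.commute)
  with le[OF c0 f] show ?thesis by simp
qed

lemma cone_functional_positive_part: "cone_functional positive_part C"
proof
  show "locally_compact_space (euclidean :: 'x topology)" by (rule lc)
  fix f :: "'x \<Rightarrow> real" assume f: "f \<in> pos_C0"
  show "positive_part f \<le> C" if f1: "\<And>x. f x \<le> 1"
  proof (rule positive_part_least[OF f])
    fix g assume g: "g \<in> pos_C0" "\<And>x. g x \<le> f x"
    have "\<bar>g x\<bar> \<le> 1" for x using g(2)[of x] f1[of x] pos_C0D(2)[OF g(1), of x] by simp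
    then show "T g \<le> C" using bound[OF pos_C0D(1)[OF g(1)], of 1] by simp
  qed
qed (auto simp: positive_part_add positive_part_cmult positive_part_nonneg)

text \<open>Nonnegativity holds because \<open>f\<close> itself competes in the supremum; the bound
  adds \<open>C\<close> for the positive part and \<open>C\<close> for \<open>T\<close>.\<close>

lemma cone_functional_negative_part: "cone_functional (\<lambda>f. positive_part f - T f) (2 * C)"
proof -
  interpret p: cone_functional positive_part C by (rule cone_functional_positive_part)
  show ?thesis
  proof
    show "locally_compact_space (euclidean :: 'x topology)" by (rule lc)
    fix f :: "'x \<Rightarrow> real" assume f: "f \<in> pos_C0"
    show "0 \<le> positive_part f - T f" using positive_part_upper[OF f f] by simp
    show "positive_part f - T f \<le> 2 * C" if f1: "\<And>x. f x \<le> 1"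
    proof -
      have "\<bar>f x\<bar> \<le> 1" for x using f1[of x] pos_C0D(2)[OF f, of x] by simp
      then show ?thesis using bound[OF pos_C0D(1)[OF f], of 1] p.bound[OF f f1] by simp
    qed
  qed (auto simp: positive_part_add positive_part_cmult add cmult pos_C0D algebra_simps)
qed

theorem riesz_representation:
  "\<exists>M1 M2. radon M1 \<and> radon M2 \<and> (\<forall>f\<in>C0. T f = integral\<^sup>L M1 f - integral\<^sup>L M2 f)"
proof -
  interpret p: cone_functional positive_part C by (rule cone_functional_positive_part)
  interpret n: cone_functional "\<lambda>f. positive_part f - T f" "2 * C" by (rule cone_functional_negative_part)
  have "T f = integral\<^sup>L p.riesz f - integral\<^sup>L n.riesz f" if f: "f \<in> C0" for f
  proof -
    define u where "u x = max (f x) 0" for x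
    define v where "v x = max (- f x) 0" for x
    have up: "u \<in> pos_C0"
      unfolding u_def[abs_def]
      by (intro pos_C0I C0_dominated[OF f, of _ 1] continuous_on_max continuous_on_const C0_continuous[OF f]) auto
    have vp: "v \<in> pos_C0"
      unfolding v_def[abs_def]
      by (intro pos_C0I C0_dominated[OF f, of _ 1] continuous_on_max continuous_on_minus continuous_on_const C0_continuous[OF f]) auto
    have fuv: "f = (\<lambda>x. u x - v x)" by (auto simp: u_def v_def)
    have "T f = T u - T v" unfolding fuv by (intro diff pos_C0D(1) up vp)
    moreover have "integral\<^sup>L p.riesz f = positive_part u - positive_part v"
      unfolding fuv using up vp by (subst Bochner_Integration.integral_diff) (simp_all add: p.integrable_C0 pos_C0D(1) p.integral_riesz)
    moreover have "integral\<^sup>L n.riesz f = (positive_part u - T u) - (positive_part v - T v)"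
      unfolding fuv using up vp by (subst Bochner_Integration.integral_diff) (simp_all add: n.integrable_C0 pos_C0D(1) n.integral_riesz)
    ultimately show ?thesis by simp
  qed
  then show ?thesis using p.radon_riesz n.radon_riesz by blast
qed

end

section \<open>Complex functionals and complex measures\<close>

lemma C0_bounded_borel:
  assumes "f \<in> C0" shows "bounded_borel f"
proof -
  obtain B where "\<And>x. cmod (f x) \<le> B" using C0_bounded[OF assms] by blast
  moreover have "f \<in> borel_measurable borel" by (intro borel_measurable_continuous_onI C0_continuous assms)
  ultimately show ?thesis unfolding bounded_borel_def by blast
qed

lemma bounded_borel_functional_cm_integral:
  assumes "complex_borel_measure \<nu>" shows "bounded_borel_functional (cm_integral \<nu>)"
proof -
  obtain N where N: "decomposes \<nu> N" by (rule complex_Jordan_decomposition[OF assms])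
  interpret J: bounded_borel_functional "\<lambda>f. \<Sum>i<4. \<i> ^ i * integral\<^sup>L (N i) f"
    by (rule bounded_borel_functional_decomposition[OF N])
  note eq = cm_integral_eq[OF N]
  show ?thesis
  proof
    show "cm_integral \<nu> (\<lambda>x. f x + g x) = cm_integral \<nu> f + cm_integral \<nu> g"
      if "bounded_borel f" "bounded_borel g" for f g
      using J.add[OF that] by (simp only: eq that bounded_borel_add)
    show "cm_integral \<nu> (\<lambda>x. c * f x) = c * cm_integral \<nu> f" if "bounded_borel f" for f c
      using J.cmult[OF that] by (simp only: eq that bounded_borel_cmult)
    show "\<exists>C. \<forall>f B. bounded_borel f \<longrightarrow> (\<forall>x. cmod (f x) \<le> B) \<longrightarrow> cmod (cm_integral \<nu> f) \<le> C * B"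
      using J.bounded by (simp only: eq cong: imp_cong)
  qed
qed

lemma cm_integral_indicator:
  assumes "complex_borel_measure \<nu>" "A \<in> sets borel" shows "cm_integral \<nu> (indicator A) = \<nu> A"
proof -
  obtain N where N: "decomposes \<nu> N" by (rule complex_Jordan_decomposition[OF assms(1)])
  show ?thesis
    using cm_integral_eq[OF N bounded_borel_indicator[OF assms(2)]] decomposition_indicator[OF N assms(2)] by simp
qed

lemma regular_imp_complex_borel_measure: "regular_complex_borel_measure \<nu> \<Longrightarrow> complex_borel_measure \<nu>"
  by (simp add: regular_complex_borel_measure_def)

text \<open>The real and imaginary parts of \<open>T\<close> on real functions are bounded real
  functionals, each represented by a difference of two Radon measures. Complex linearity extends the
  identity from real functions to complex ones.\<close>

theorem complex_riesz_representation:
  fixes T :: "('x::t2_space \<Rightarrow> complex) \<Rightarrow> complex"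
  assumes lc: "locally_compact_space (euclidean :: 'x topology)"
    and add: "\<And>f g. f \<in> C0 \<Longrightarrow> g \<in> C0 \<Longrightarrow> T (\<lambda>x. f x + g x) = T f + T g"
    and cmult: "\<And>f c. f \<in> C0 \<Longrightarrow> T (\<lambda>x. c * f x) = c * T f"
    and bound: "\<And>f B. f \<in> C0 \<Longrightarrow> (\<And>x. cmod (f x) \<le> B) \<Longrightarrow> cmod (T f) \<le> C * B"
  shows "\<exists>\<nu>. regular_complex_borel_measure \<nu> \<and> (\<forall>f\<in>C0. T f = cm_integral \<nu> f)"
proof -
  let ?c = "\<lambda>f x. complex_of_real (f x)"
  have cC0: "?c f \<in> C0" if "f \<in> C0" for f :: "'x \<Rightarrow> real"
    using that bounded_linear_of_real by (rule C0_bounded_linear)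
  interpret re: bounded_real_functional "\<lambda>f. Re (T (?c f))" C
  proof
    show "\<bar>Re (T (?c f))\<bar> \<le> C * B" if "f \<in> C0" "\<And>x. \<bar>f x\<bar> \<le> B" for f B
      using order_trans[OF abs_Re_le_cmod bound[OF cC0[OF that(1)], of B]] that(2) by simp
  qed (simp_all add: lc add cmult cC0)
  interpret im: bounded_real_functional "\<lambda>f. Im (T (?c f))" C
  proof
    show "\<bar>Im (T (?c f))\<bar> \<le> C * B" if "f \<in> C0" "\<And>x. \<bar>f x\<bar> \<le> B" for f B
      using order_trans[OF abs_Im_le_cmod bound[OF cC0[OF that(1)], of B]] that(2) by simp
  qed (simp_all add: lc add cmult cC0)
  obtain N0 N2 where re: "radon N0" "radon N2" "\<forall>f\<in>C0. Re (T (?c f)) = integral\<^sup>L N0 f - integral\<^sup>L N2 f"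
    using re.riesz_representation by (elim exE conjE)
  obtain N1 N3 where im: "radon N1" "radon N3" "\<forall>f\<in>C0. Im (T (?c f)) = integral\<^sup>L N1 f - integral\<^sup>L N3 f"
    using im.riesz_representation by (elim exE conjE)
  define N where "N i = [N0, N1, N2, N3] ! i" for i
  have N: "N 0 = N0" "N 1 = N1" "N 2 = N2" "N 3 = N3" by (auto simp: N_def)
  have rad: "radon (N i)" if "i < 4" for i
  proof -
    have "i = 0 \<or> i = 1 \<or> i = 2 \<or> i = 3" using that by auto
    then show ?thesis using N re im by auto
  qed
  \<comment> \<open>The value 0 off the Borel sets is the normalisation built into
    \<open>complex_borel_measure\<close>, without which uniqueness would fail.\<close>
  define \<nu> where "\<nu> A = (if A \<in> sets borel then \<Sum>i<4. \<i> ^ i * of_real (measure (N i) A) else 0)" for A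
  have dec: "decomposes \<nu> N" using rad by (auto simp: decomposes_def \<nu>_def radon_def)
  then have rdec: "radon_decomposes \<nu> N" using rad by (simp add: radon_decomposes_def)
  have reg: "regular_complex_borel_measure \<nu>"
    by (rule radon_decomposes_imp_regular[OF rdec]) (simp add: \<nu>_def)
  interpret J: bounded_borel_functional "cm_integral \<nu>"
    by (rule bounded_borel_functional_cm_integral[OF regular_imp_complex_borel_measure[OF reg]])
  have real: "T (?c f) = cm_integral \<nu> (?c f)" if f: "f \<in> C0" for f
    unfolding cm_integral_eq[OF dec C0_bounded_borel[OF cC0[OF f]]] sum_powers_ii N integral_complex_of_real
    using re(3) im(3) f by (simp add: complex_eq_iff)
  have "T f = cm_integral \<nu> f" if f: "f \<in> C0" for f
  proof -
    have u: "(\<lambda>x. Re (f x)) \<in> C0" "(\<lambda>x. Im (f x)) \<in> C0"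
      by (rule C0_bounded_linear[OF f bounded_linear_Re], rule C0_bounded_linear[OF f bounded_linear_Im])
    have i: "(\<lambda>x. \<i> * ?c (\<lambda>x. Im (f x)) x) \<in> C0"
      by (rule C0_bounded_linear[OF cC0[OF u(2)] bounded_linear_mult_right])
    have f_eq: "f = (\<lambda>x. ?c (\<lambda>x. Re (f x)) x + \<i> * ?c (\<lambda>x. Im (f x)) x)" by (auto simp: complex_eq_iff)
    have "T f = T (?c (\<lambda>x. Re (f x))) + \<i> * T (?c (\<lambda>x. Im (f x)))"
      by (subst f_eq) (simp only: add[OF cC0[OF u(1)] i] cmult[OF cC0[OF u(2)]])
    also have "\<dots> = cm_integral \<nu> (?c (\<lambda>x. Re (f x))) + \<i> * cm_integral \<nu> (?c (\<lambda>x. Im (f x)))"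
      by (simp only: real u)
    also have "\<dots> = cm_integral \<nu> f"
      by (subst (3) f_eq) (simp only: J.add[OF C0_bounded_borel C0_bounded_borel] J.cmult[OF C0_bounded_borel] cC0 u i)
    finally show ?thesis .
  qed
  then show ?thesis using reg by blast
qed

text \<open>A Urysohn function equal to 1 on \<open>K\<close> and 0 outside \<open>U\<close> differs
  from the indicator of \<open>A\<close> only on \<open>U - K\<close>, by at most 1, and this set is
  small for all the measures at once.\<close>

lemma radon_approx_C0:
  fixes N :: "'i \<Rightarrow> 'x::t2_space measure"
  assumes lc: "locally_compact_space (euclidean :: 'x topology)"
    and I: "finite I" "\<And>i. i \<in> I \<Longrightarrow> radon (N i)" and A: "A \<in> sets borel" and e: "e > 0"
  shows "\<exists>h\<in>pos_C0. (\<forall>x. h x \<le> 1) \<and> (\<forall>i\<in>I. \<bar>measure (N i) A - integral\<^sup>L (N i) h\<bar> < e)"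
proof -
  have "\<exists>K U. compact K \<and> open U \<and> K \<subseteq> A \<and> A \<subseteq> U \<and> (\<forall>i\<in>I. measure (N i) (U - K) < e)"
    by (rule radon_common) (use I A e in auto)
  then obtain K U where KU: "compact K" "open U" "K \<subseteq> A" "A \<subseteq> U" "\<forall>i\<in>I. measure (N i) (U - K) < e"
    by (elim exE conjE)
  obtain h where h: "h \<in> pos_C0" "\<And>y. h y \<le> 1" "\<And>y. y \<in> K \<Longrightarrow> h y = 1" "\<And>y. y \<notin> U \<Longrightarrow> h y = 0"
    using C0_Urysohn_compact[OF lc KU(1,2) order_trans[OF KU(3,4)]] by metis
  have "\<bar>measure (N i) A - integral\<^sup>L (N i) h\<bar> < e" if i: "i \<in> I" for i
  proof -
    have s: "sets (N i) = sets borel" and f: "finite_measure (N i)" using I(2)[OF i] by (auto simp: radon_def)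
    interpret finite_measure "N i" by (rule f)
    have sp: "space (N i) = UNIV" using sets_eq_imp_space_eq[OF s] by simp
    have hm: "h \<in> borel_measurable (N i)"
      using borel_measurable_continuous_onI[OF pos_C0_continuous[OF h(1)]] measurable_cong_sets[OF s refl] by blast
    have hi: "integrable (N i) h"
      using h(2) pos_C0D(2)[OF h(1)] hm by (intro integrable_const_bound[of _ 1]) auto
    have UK: "U - K \<in> sets (N i)" unfolding s using KU by (intro sets.Diff borel_open borel_closed compact_imp_closed)
    have Ai: "integrable (N i) (indicator A :: _ \<Rightarrow> real)" using A s by (simp add: emeasure_eq_measure)
    have Ui: "integrable (N i) (indicator (U - K) :: _ \<Rightarrow> real)" using UK by (simp add: emeasure_eq_measure)
    have "measure (N i) A - integral\<^sup>L (N i) h = (\<integral>x. indicator A x - h x \<partial>N i)"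
      using Ai hi sp by simp
    also have "\<bar>\<dots>\<bar> \<le> (\<integral>x. \<bar>indicator A x - h x\<bar> \<partial>N i)" by (rule integral_abs_bound)
    also have "\<dots> \<le> (\<integral>x. indicator (U - K) x \<partial>N i)"
    proof (rule integral_mono)
      show "integrable (N i) (\<lambda>x. \<bar>indicator A x - h x\<bar>)" using Ai hi by simp
      show "\<bar>indicator A x - h x\<bar> \<le> indicator (U - K) x" for x
        using h(2)[of x] h(3)[of x] h(4)[of x] pos_C0D(2)[OF h(1), of x] KU(3,4)
        by (auto simp: indicator_def)
    qed (rule Ui)
    also have "\<dots> = measure (N i) (U - K)" using sp by simp
    also have "\<dots> < e" by (rule KU(5)[rule_format, OF i])
    finally show ?thesis .
  qed
  then show ?thesis using h by blast
qed

text \<open>Stated for linear relations, so that it yields both uniqueness and invariance.\<close>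

lemma regular_lincomb_eq_0:
  fixes \<nu> :: "'i \<Rightarrow> 'x::t2_space set \<Rightarrow> complex"
  assumes lc: "locally_compact_space (euclidean :: 'x topology)"
    and I: "finite I" "\<And>i. i \<in> I \<Longrightarrow> regular_complex_borel_measure (\<nu> i)"
    and zero: "\<And>h. h \<in> pos_C0 \<Longrightarrow> (\<Sum>i\<in>I. c i * cm_integral (\<nu> i) (\<lambda>x. of_real (h x))) = 0"
    and A: "A \<in> sets borel"
  shows "(\<Sum>i\<in>I. c i * \<nu> i A) = 0"
proof -
  have "\<forall>i\<in>I. \<exists>N. radon_decomposes (\<nu> i) N" using I(2) regular_imp_radon_decomposes by blast
  then obtain N where N: "\<And>i. i \<in> I \<Longrightarrow> radon_decomposes (\<nu> i) (N i)" by metis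
  have "cmod (\<Sum>i\<in>I. c i * \<nu> i A) \<le> 0 + e" if e: "e > 0" for e
  proof -
    \<comment> \<open>The total weight of the coefficients times the four parts of each measure; the
      added 1 keeps it positive when all coefficients vanish.\<close>
    define s where "s = (\<Sum>i\<in>I. cmod (c i)) * 4 + 1"
    have s: "s > 0" by (simp add: s_def add_nonneg_pos sum_nonneg)
    have "\<exists>h\<in>pos_C0. (\<forall>x. h x \<le> 1) \<and> (\<forall>p\<in>I \<times> {..<4}. \<bar>measure (N (fst p) (snd p)) A - integral\<^sup>L (N (fst p) (snd p)) h\<bar> < e / s)"
      using N I(1) e s by (intro radon_approx_C0[OF lc _ _ A]) (auto simp: radon_decomposes_def)
    then obtain h where h: "h \<in> pos_C0"
      "\<And>i k. i \<in> I \<Longrightarrow> k < 4 \<Longrightarrow> \<bar>measure (N i k) A - integral\<^sup>L (N i k) h\<bar> < e / s" by fastforce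
    have hb: "bounded_borel (\<lambda>x. of_real (h x))"
      by (intro C0_bounded_borel C0_bounded_linear[OF _ bounded_linear_of_real] pos_C0D(1) h)
    have "cmod (\<nu> i A - cm_integral (\<nu> i) (\<lambda>x. of_real (h x))) \<le> 4 * (e / s)" if i: "i \<in> I" for i
    proof -
      have dec: "decomposes (\<nu> i) (N i)" using N[OF i] by (simp add: radon_decomposes_def)
      have "\<nu> i A - cm_integral (\<nu> i) (\<lambda>x. of_real (h x))
          = (\<Sum>k<4. \<i> ^ k * of_real (measure (N i k) A - integral\<^sup>L (N i k) h))"
        using dec A unfolding cm_integral_eq[OF dec hb]
        by (simp add: decomposes_def sum_subtractf right_diff_distrib)
      also have "cmod \<dots> \<le> (\<Sum>k<4::nat. e / s)"
        by (rule sum_norm_le) (use h(2)[OF i] in \<open>auto simp: norm_mult norm_power simp flip: of_real_diff intro: less_imp_le\<close>)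
      finally show ?thesis by simp
    qed note close = this
    have "(\<Sum>i\<in>I. c i * \<nu> i A) = (\<Sum>i\<in>I. c i * (\<nu> i A - cm_integral (\<nu> i) (\<lambda>x. of_real (h x))))"
      using zero[OF h(1)] by (simp add: right_diff_distrib sum_subtractf)
    also have "cmod \<dots> \<le> (\<Sum>i\<in>I. cmod (c i) * (4 * (e / s)))"
      by (intro sum_norm_le) (simp only: norm_mult, intro mult_left_mono close norm_ge_zero)
    also have "\<dots> = (\<Sum>i\<in>I. cmod (c i)) * (4 * (e / s))" by (rule sum_distrib_right[symmetric])
    also have "\<dots> = (s - 1) * (e / s)" by (simp add: s_def)
    also have "\<dots> \<le> s * (e / s)" using e s by (intro mult_right_mono) auto
    also have "\<dots> = e" using s by simp
    finally show ?thesis by simp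
  qed
  then have "cmod (\<Sum>i\<in>I. c i * \<nu> i A) \<le> 0" by (rule field_le_epsilon)
  then show ?thesis by simp
qed

section \<open>Transport of regular measures by homeomorphisms\<close>

lemma image_eq_vimage_inverse:
  assumes "\<And>x. s (t x) = x" "\<And>x. t (s x) = x" shows "t ` A = s -` A"
  using assms by (auto simp: image_iff) metis

lemma radon_distr:
  fixes s t :: "'x::t2_space \<Rightarrow> 'x"
  assumes st: "\<And>x. s (t x) = x" "\<And>x. t (s x) = x" and cont: "continuous_on UNIV s" "continuous_on UNIV t"
    and M: "radon M"
  shows "radon (distr M borel s)" "\<And>A. A \<in> sets borel \<Longrightarrow> measure (distr M borel s) A = measure M (t ` A)"
proof -
  have sM: "sets M = sets borel" and fin: "finite_measure M" using M by (auto simp: radon_def)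
  have sm: "s \<in> measurable M borel"
    using borel_measurable_continuous_onI[OF cont(1)] measurable_cong_sets[OF sM refl] by blast
  have spM: "space M = UNIV" using sets_eq_imp_space_eq[OF sM] by simp
  show meas: "measure (distr M borel s) A = measure M (t ` A)" if "A \<in> sets borel" for A
    using measure_distr[OF sm that] by (simp add: spM image_eq_vimage_inverse[OF st])
  show "radon (distr M borel s)"
    unfolding radon_def
  proof (intro conjI ballI allI impI)
    show "sets (distr M borel s) = sets borel" by simp
    show "finite_measure (distr M borel s)" by (rule finite_measure.finite_measure_distr[OF fin sm])
    fix E :: "'x set" and e :: real assume E: "E \<in> sets borel" "e > 0"
    have "t ` E \<in> sets borel"
      using measurable_sets[OF sm E(1)] by (simp add: spM sM image_eq_vimage_inverse[OF st])
    then obtain K U where KU: "compact K" "open U" "K \<subseteq> t ` E" "t ` E \<subseteq> U" "measure M (U - K) < e"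
      using M E(2) unfolding radon_def by metis
    have sU: "s ` U = t -` U" by (rule image_eq_vimage_inverse[OF st(2,1)])
    have "inj t" by (metis injI st(1))
    then have "t ` (s ` U - s ` K) = U - K" by (simp add: image_set_diff image_image st)
    moreover have "compact (s ` K)" using KU cont by (intro compact_continuous_image continuous_on_subset[OF cont(1)]) auto
    moreover have "open (s ` U)" unfolding sU using KU(2) cont(2) by (simp add: open_vimage)
    moreover have "s ` K \<subseteq> E" "E \<subseteq> s ` U"
      using image_mono[OF KU(3), of s] image_mono[OF KU(4), of s] by (simp_all add: image_image st)
    ultimately show "\<exists>K U. compact K \<and> open U \<and> K \<subseteq> E \<and> E \<subseteq> U \<and> measure (distr M borel s) (U - K) < e"
      using KU(5) by (intro exI[of _ "s ` K"] exI[of _ "s ` U"]) (simp add: meas borel_closed compact_imp_closed)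
  qed
qed

text \<open>Taking images under \<open>t\<close> is taking preimages under its inverse
  \<open>s\<close>, so the new set function is the pushforward along \<open>s\<close>, obtained by
  pushing forward four Radon measures that decompose \<nu>.\<close>

lemma regular_pushforward:
  fixes s t :: "'x::t2_space \<Rightarrow> 'x"
  assumes st: "\<And>x. s (t x) = x" "\<And>x. t (s x) = x" and cont: "continuous_on UNIV s" "continuous_on UNIV t"
    and \<nu>: "regular_complex_borel_measure \<nu>"
  shows "regular_complex_borel_measure (\<lambda>A. \<nu> (t ` A))"
    and "bounded_borel f \<Longrightarrow> cm_integral (\<lambda>A. \<nu> (t ` A)) f = cm_integral \<nu> (\<lambda>x. f (s x))"
proof -
  have cb: "complex_borel_measure \<nu>" by (rule regular_imp_complex_borel_measure[OF \<nu>])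
  obtain N where N: "radon_decomposes \<nu> N" using regular_imp_radon_decomposes[OF \<nu>] by blast
  \<comment> \<open>The converse direction carries over the value 0 on sets that are not
    Borel.\<close>
  have tb: "t ` A \<in> sets borel \<longleftrightarrow> A \<in> sets borel" for A
  proof
    assume "A \<in> sets borel"
    then show "t ` A \<in> sets borel"
      using measurable_sets[OF borel_measurable_continuous_onI[OF cont(1)], of A] by (simp add: image_eq_vimage_inverse[OF st])
  next
    assume "t ` A \<in> sets borel"
    then have "t -` (t ` A) \<in> sets borel"
      using measurable_sets[OF borel_measurable_continuous_onI[OF cont(2)], of "t ` A"] by simp
    moreover have "t -` (t ` A) = A" using st by (metis inj_vimage_image_eq injI)
    ultimately show "A \<in> sets borel" by simp
  qed
  have rad: "radon (N i)" if "i < 4" for i using N that by (simp add: radon_decomposes_def)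
  have r: "radon (distr (N i) borel s)" if "i < 4" for i by (rule radon_distr(1)[OF st cont rad[OF that]])
  have r': "sets (distr (N i) borel s) = sets borel \<and> finite_measure (distr (N i) borel s)" if "i < 4" for i
    using r[OF that] unfolding radon_def by (elim conjE) (intro conjI)
  have q: "\<nu> (t ` A) = (\<Sum>i<4. \<i> ^ i * of_real (measure (distr (N i) borel s) A))" if A: "A \<in> sets borel" for A
  proof -
    have "\<nu> (t ` A) = (\<Sum>i<4. \<i> ^ i * of_real (measure (N i) (t ` A)))"
      using N A tb unfolding radon_decomposes_def decomposes_def by blast
    also have "\<dots> = (\<Sum>i<4. \<i> ^ i * of_real (measure (distr (N i) borel s) A))"
      using radon_distr(2)[OF st cont rad A] by (intro sum.cong) auto
    finally show ?thesis .
  qed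
  have "radon_decomposes (\<lambda>A. \<nu> (t ` A)) (\<lambda>i. distr (N i) borel s)"
    unfolding radon_decomposes_def decomposes_def using r r' q by (intro conjI allI impI ballI) simp_all
  then show reg: "regular_complex_borel_measure (\<lambda>A. \<nu> (t ` A))"
  proof (rule radon_decomposes_imp_regular)
    show "\<nu> (t ` A) = 0" if "A \<notin> sets borel" for A
      using cb that tb unfolding complex_borel_measure_def by blast
  qed
  have cb': "complex_borel_measure (\<lambda>A. \<nu> (t ` A))" by (rule regular_imp_complex_borel_measure[OF reg])
  show "cm_integral (\<lambda>A. \<nu> (t ` A)) f = cm_integral \<nu> (\<lambda>x. f (s x))" if f: "bounded_borel f"
  proof (rule bounded_borel_functional_eqI[OF bounded_borel_functional_cm_integral[OF cb']
        bounded_borel_functional_compose[OF bounded_borel_functional_cm_integral[OF cb] cont(1)] _ f])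
    fix A :: "'x set" assume A: "A \<in> sets borel"
    have "(\<lambda>x. indicator A (s x)) = (indicator (t ` A) :: 'x \<Rightarrow> complex)"
      by (auto simp: image_eq_vimage_inverse[OF st] indicator_def)
    then show "cm_integral (\<lambda>A. \<nu> (t ` A)) (indicator A) = cm_integral \<nu> (\<lambda>x. indicator A (s x))"
      using A tb by (simp add: cm_integral_indicator cb cb')
  qed
qed

section \<open>Averaging over the action\<close>

text \<open>The library has these instances only for metric domains.\<close>

instance bcontfun :: (topological_space, complete_space) complete_space
proof
  fix f :: "nat \<Rightarrow> ('a, 'b) bcontfun"
  assume "Cauchy f"
  then obtain g where "uniform_limit UNIV (\<lambda>n. apply_bcontfun (f n)) g sequentially"
    using uniformly_convergent_eq_cauchy[of "\<lambda>_. True" "\<lambda>n. apply_bcontfun (f n)"]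
    unfolding Cauchy_def uniform_limit_sequentially_iff
    by (metis dist_fun_lt_imp_dist_val_lt)
  from uniform_limit_bcontfunE[OF this sequentially_bot] show "convergent f"
    by (metis convergentI)
qed

instance bcontfun :: (topological_space, banach) banach ..

lemma matrix_mult_cscale_left: "cscale c A ** B = cscale c (A ** B)"
  by (simp add: cscale_def matrix_matrix_mult_def vec_eq_iff sum_distrib_left mult.assoc)

lemma matrix_mult_cscale_right: "A ** cscale c B = cscale c (A ** B)"
  by (simp add: cscale_def matrix_matrix_mult_def vec_eq_iff sum_distrib_left mult_ac)

lemma norm_cscale: "norm (cscale c A) = cmod c * norm A"
proof -
  have "(norm (cscale c A))\<^sup>2 = (cmod c * norm A)\<^sup>2"
    by (simp add: norm_vec_def L2_set_def sum_nonneg cscale_def norm_mult power_mult_distrib sum_distrib_left)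
  then show ?thesis by (simp add: power2_eq_iff_nonneg)
qed

lemma bounded_linear_cscale: "bounded_linear (cscale c)"
  by (rule bounded_linear_intro[where K = "cmod c"])
    (simp_all add: norm_cscale, simp_all add: cscale_def vec_eq_iff algebra_simps)

lemma matrix_add_rdistrib: "(B + C) ** A = B ** A + C ** A"
  for B C :: "complex^'n^'m" and A :: "complex^'p^'n"
  by (simp add: matrix_matrix_mult_def vec_eq_iff sum.distrib distrib_right)

lemma matrix_mult_scaleR: "A ** (r *\<^sub>R B) = r *\<^sub>R (A ** B)" "(r *\<^sub>R A) ** B = r *\<^sub>R (A ** B)"
  for A :: "complex^'n^'m" and B :: "complex^'p^'n"
  by (simp_all add: matrix_matrix_mult_def vec_eq_iff scaleR_sum_right)

lemma bounded_linear_conj_unitary: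
  assumes "unitary V" shows "bounded_linear (\<lambda>A :: complex^'n^'n. V ** A ** cadj V)"
proof (rule bounded_linear_intro[where K = 1])
  show "norm (V ** A ** cadj V) \<le> norm A * 1" for A :: "complex^'n^'n"
    using assms by (simp add: norm_mult_unitary_left norm_mult_unitary_right)
qed (simp_all add: matrix_add_ldistrib matrix_add_rdistrib matrix_mult_scaleR)

text \<open>Cauchy-Schwarz row by row: the Frobenius norm dominates the operator norm that enters
  \<open>cstar_norm\<close>, so uniform smallness in the former gives it in the latter.\<close>

lemma norm_matrix_vector_mult_le: "norm (A *v v) \<le> norm A * norm v" for A :: "complex^'n^'m"
proof -
  have "norm ((A *v v) $ i) \<le> norm (A $ i) * norm v" for i
  proof -
    have "norm ((A *v v) $ i) \<le> (\<Sum>j\<in>UNIV. cmod (A $ i $ j * v $ j))"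
      unfolding matrix_vector_mult_def by (simp add: norm_sum)
    also have "\<dots> = (\<Sum>j\<in>UNIV. \<bar>cmod (A $ i $ j)\<bar> * \<bar>cmod (v $ j)\<bar>)" by (simp add: norm_mult)
    also have "\<dots> \<le> norm (A $ i) * norm v"
      unfolding norm_vec_def by (rule L2_set_mult_ineq)
    finally show ?thesis .
  qed
  then have "norm (A *v v) \<le> L2_set (\<lambda>i. norm (A $ i) * norm v) UNIV"
    unfolding norm_vec_def[of "A *v v"] by (intro L2_set_mono) auto
  also have "\<dots> = norm A * norm v"
    unfolding norm_vec_def[of A] by (simp add: L2_set_left_distrib)
  finally show ?thesis .
qed

lemma cstar_norm_le:
  fixes f :: "'x \<Rightarrow> complex^'n^'n"
  assumes "\<And>x. norm (f x) \<le> B" shows "cstar_norm f \<le> B"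
  unfolding cstar_norm_def
proof (rule cSUP_least)
  fix x
  have "0 \<le> B" using assms[of x] norm_ge_zero order_trans by blast
  show "onorm (\<lambda>v. f x *v v) \<le> B"
  proof (rule onorm_bound[OF \<open>0 \<le> B\<close>])
    show "norm (f x *v v) \<le> B * norm v" for v
      by (rule order_trans[OF norm_matrix_vector_mult_le mult_right_mono[OF assms]]) simp
  qed
qed simp

text \<open>Multiples of matrix units turn a scalar function into a matrix-valued one, through which
  the entries of functionals and measures are reached one at a time.\<close>

definition mat_unit :: "'n \<Rightarrow> 'n \<Rightarrow> complex \<Rightarrow> complex^'n^'n" where
  "mat_unit j k z = (\<chi> a b. if a = j \<and> b = k then z else 0)"

lemma norm_mat_unit: "norm (mat_unit j k z) = cmod z"
proof -
  have "(norm (mat_unit j k z))\<^sup>2 = (\<Sum>a\<in>UNIV. \<Sum>b\<in>UNIV. if a = j \<and> b = k then (cmod z)\<^sup>2 else 0)"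
    by (simp add: norm_vec_def L2_set_def sum_nonneg mat_unit_def) (intro sum.cong refl, simp)
  also have "\<dots> = (\<Sum>a\<in>UNIV. if a = j then (cmod z)\<^sup>2 else 0)"
    by (rule sum.cong) auto
  also have "\<dots> = (cmod z)\<^sup>2" by simp
  finally show ?thesis by (simp add: power2_eq_iff_nonneg)
qed

lemma mat_unit_linear:
  "mat_unit j k (z + w) = mat_unit j k z + mat_unit j k w" "mat_unit j k (c * z) = cscale c (mat_unit j k z)"
  by (simp_all add: mat_unit_def cscale_def vec_eq_iff)

lemma bounded_linear_mat_unit: "bounded_linear (mat_unit j k)"
proof (rule bounded_linear_intro[where K = 1])
  show "mat_unit j k (r *\<^sub>R z) = r *\<^sub>R mat_unit j k z" for r z
    by (simp add: mat_unit_def vec_eq_iff)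
qed (simp_all add: norm_mat_unit mat_unit_linear)

lemma matrix_eq_sum_mat_unit: "A = (\<Sum>j\<in>UNIV. \<Sum>k\<in>UNIV. mat_unit j k (A $ j $ k))"
proof -
  have "(\<Sum>j\<in>UNIV. \<Sum>k\<in>UNIV. mat_unit j k (A $ j $ k)) $ a $ b = A $ a $ b" for a b
  proof -
    have "(\<Sum>j\<in>UNIV. \<Sum>k\<in>UNIV. mat_unit j k (A $ j $ k)) $ a $ b
        = (\<Sum>j\<in>UNIV. \<Sum>k\<in>UNIV. if a = j \<and> b = k then A $ j $ k else 0)"
      by (simp add: mat_unit_def)
    also have "\<dots> = (\<Sum>j\<in>UNIV. if a = j then A $ j $ b else 0)"
      by (rule sum.cong) auto
    finally show ?thesis by simp
  qed
  then show ?thesis by (simp add: vec_eq_iff)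
qed

lemma conj_unitary_component:
  "(U ** A ** cadj U) $ a $ b = (\<Sum>k\<in>UNIV. \<Sum>j\<in>UNIV. U $ a $ k * cnj (U $ b $ j) * A $ k $ j)"
proof -
  have "(U ** A ** cadj U) $ a $ b = (\<Sum>j\<in>UNIV. \<Sum>k\<in>UNIV. U $ a $ k * cnj (U $ b $ j) * A $ k $ j)"
    by (simp add: matrix_matrix_mult_def cadj_def sum_distrib_left mult_ac)
  also have "\<dots> = (\<Sum>k\<in>UNIV. \<Sum>j\<in>UNIV. U $ a $ k * cnj (U $ b $ j) * A $ k $ j)" by (rule sum.swap)
  finally show ?thesis .
qed

lemma C0_component: "f \<in> C0 \<Longrightarrow> (\<lambda>x. f x $ j $ k) \<in> C0" for f :: "'x::topological_space \<Rightarrow> complex^'n^'n"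
  by (erule C0_bounded_linear) (rule bounded_linear_compose[OF bounded_linear_vec_nth[of k] bounded_linear_vec_nth[of j]])

section \<open>The averaging projection onto the equivariant functions\<close>

locale n_space_action =
  fixes act :: "complex^'n^'n \<Rightarrow> 'x::t2_space \<Rightarrow> 'x"
  assumes n_space: "n_space act"
begin

lemma lc: "locally_compact_space (euclidean :: 'x topology)"
  and cont: "continuous_on ({U. unitary U} \<times> UNIV) (\<lambda>(U, x). act U x)"
  and act_1 [simp]: "act (mat 1) x = x"
  and act_mult: "unitary U \<Longrightarrow> unitary V \<Longrightarrow> act (U ** V) x = act U (act V x)"
  using n_space unfolding n_space_def by blast+

lemma act_cadj [simp]: "unitary U \<Longrightarrow> act (cadj U) (act U x) = x" "unitary U \<Longrightarrow> act U (act (cadj U) x) = x"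
  by (simp_all add: act_mult[symmetric] unitaryD)

lemma continuous_on_act:
  assumes "continuous_on S f" "continuous_on S g" "\<And>p. p \<in> S \<Longrightarrow> unitary (f p)"
  shows "continuous_on S (\<lambda>p. act (f p) (g p))"
  using continuous_on_compose2[OF cont continuous_on_Pair[OF assms(1,2)]] assms(3) by auto

lemma continuous_act: "unitary U \<Longrightarrow> continuous_on S (act U)"
  by (rule continuous_on_act[where f = "\<lambda>_. U" and g = "\<lambda>x. x"]) auto

definition translate :: "complex^'n^'n \<Rightarrow> ('x \<Rightarrow> complex^'n^'n) \<Rightarrow> 'x \<Rightarrow> complex^'n^'n" where
  "translate U F = (\<lambda>x. cadj U ** F (act U x) ** U)"

definition average :: "('x \<Rightarrow> complex^'n^'n) \<Rightarrow> 'x \<Rightarrow> complex^'n^'n" where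
  "average F x = umean (\<lambda>U. translate U F x)"

lemma norm_translate: "unitary U \<Longrightarrow> norm (translate U F x) = norm (F (act U x))"
  by (simp add: translate_def norm_mult_unitary_left norm_mult_unitary_right)

text \<open>The order of the product is that of a right action. Hence translating \<open>F\<close>
  multiplies the averaging variable on the left, while moving the point \<open>x\<close> multiplies
  it on the right.\<close>

lemma translate_translate: "unitary U \<Longrightarrow> unitary V \<Longrightarrow> translate V (translate U F) = translate (U ** V) F"
  by (simp add: translate_def act_mult cadj_mult matrix_mul_assoc)

lemma continuous_translate:
  assumes "F \<in> C0" "continuous_on S f" "continuous_on S g" "\<And>p. p \<in> S \<Longrightarrow> unitary (f p)"
  shows "continuous_on S (\<lambda>p. translate (f p) F (g p))"
  unfolding translate_def
  by (intro continuous_on_matrix_mult continuous_on_cadj assms continuous_on_compose2[OF C0_continuous[OF assms(1), of UNIV]]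
      continuous_on_act) auto

lemma continuous_translate_orbit: "F \<in> C0 \<Longrightarrow> continuous_on {U. unitary U} (\<lambda>U. translate U F x)"
  by (rule continuous_translate[where f = "\<lambda>U. U" and g = "\<lambda>_. x"]) auto

text \<open>If \<open>F\<close> is small off \<open>K\<close>, all translates are small off the
  union of the orbits through \<open>K\<close>, which is compact as an image of the unitary group
  times \<open>K\<close>.\<close>

lemma translate_uniformly_small:
  assumes F: "F \<in> C0" and e: "e > 0"
  shows "\<exists>K. compact K \<and> (\<forall>x U. x \<notin> K \<and> unitary U \<longrightarrow> norm (translate U F x) < e)"
proof -
  obtain K where K: "compact K" "\<And>x. x \<notin> K \<Longrightarrow> norm (F x) < e"
    using F e unfolding C0_def vanishes_at_infinity_def by blast
  let ?K = "(\<lambda>p. act (cadj (fst p)) (snd p)) ` ({U. unitary U} \<times> K)"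
  have "compact ?K"
    by (intro compact_continuous_image compact_Times compact_unitary K(1) continuous_on_act continuous_on_cadj continuous_intros)
      auto
  moreover have "norm (translate U F x) < e" if "x \<notin> ?K" "unitary U" for x U
  proof -
    have "act U x \<notin> K"
    proof
      assume "act U x \<in> K"
      then have "(\<lambda>p. act (cadj (fst p)) (snd p)) (U, act U x) \<in> ?K" using that(2) by blast
      then show False using that by simp
    qed
    then show ?thesis using K(2) that(2) by (simp add: norm_translate)
  qed
  ultimately show ?thesis by blast
qed

lemma translate_C0: assumes F: "F \<in> C0" and U: "unitary U" shows "translate U F \<in> C0"
proof -
  have "continuous_on UNIV (translate U F)"
    using continuous_translate[OF F, of UNIV "\<lambda>_. U" "\<lambda>x. x"] U by simp
  moreover have "vanishes_at_infinity (translate U F)"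
    unfolding vanishes_at_infinity_def using translate_uniformly_small[OF F] U by meson
  ultimately show ?thesis by (simp add: C0_def)
qed

text \<open>Values in \<open>bcontfun\<close> make the averages converge uniformly in the point, so
  that continuity and decay survive averaging.\<close>

definition orbit :: "('x \<Rightarrow> complex^'n^'n) \<Rightarrow> complex^'n^'n \<Rightarrow> ('x, complex^'n^'n) bcontfun" where
  "orbit F U = Bcontfun (translate U F)"

lemma apply_Bcontfun_C0:
  assumes "F \<in> C0" shows "apply_bcontfun (Bcontfun F) = (F :: 'x \<Rightarrow> complex^'n^'n)"
proof -
  obtain B where "\<And>x. norm (F x) \<le> B" using C0_bounded[OF assms] by blast
  then have "F \<in> bcontfun" by (intro bcontfun_normI[of _ B] C0_continuous assms)
  then show ?thesis by (rule Bcontfun_inverse)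
qed

lemma apply_orbit: "F \<in> C0 \<Longrightarrow> unitary U \<Longrightarrow> apply_bcontfun (orbit F U) = translate U F"
  by (simp add: orbit_def apply_Bcontfun_C0 translate_C0)

text \<open>Off a compact set all translates are uniformly below \<open>e / 4\<close>; on it, joint
  continuity and compactness give a neighbourhood of \<open>U0\<close> that works for all points at
  once.\<close>

lemma continuous_orbit:
  assumes F: "F \<in> C0" shows "continuous_on {U. unitary U} (orbit F)"
  unfolding continuous_on_iff
proof (intro ballI allI impI)
  fix U0 :: "complex^'n^'n" and e :: real assume U0: "U0 \<in> {U. unitary U}" and e: "e > 0"
  have e4: "e / 4 > 0" and e2: "e / 2 > 0" using e by auto
  obtain K where K: "compact K" "\<And>x U. x \<notin> K \<Longrightarrow> unitary U \<Longrightarrow> norm (translate U F x) < e / 4"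
    using translate_uniformly_small[OF F e4] by blast
  have "continuous_on ({U. unitary U} \<times> K) (\<lambda>p. translate (fst p) F (snd p))"
    by (rule continuous_translate[OF F]) (auto intro!: continuous_intros)
  from continuous_on_prod_compactE[OF this K(1) U0 e2] obtain X0 where X0: "U0 \<in> X0" "open X0"
    "\<forall>U\<in>X0 \<inter> {U. unitary U}. \<forall>x\<in>K. dist (translate U F x) (translate U0 F x) \<le> e / 2" by auto
  obtain d where d: "d > 0" "\<And>U. dist U U0 < d \<Longrightarrow> U \<in> X0"
    using X0 unfolding open_dist by metis
  have "dist (orbit F U) (orbit F U0) < e" if U: "unitary U" "dist U U0 < d" for U
  proof -
    have "dist (translate U F x) (translate U0 F x) \<le> e / 2" for x
    proof (cases "x \<in> K")
      case True then show ?thesis using X0(3) d(2)[OF U(2)] U(1) by blast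
    next
      case False
      then show ?thesis
        using K(2)[OF False U(1)] K(2)[OF False, of U0] U0 norm_triangle_ineq4[of "translate U F x" "translate U0 F x"]
        by (simp add: dist_norm)
    qed
    then have "dist (orbit F U) (orbit F U0) \<le> e / 2"
      using U(1) U0 by (intro dist_bound) (simp add: apply_orbit F)
    then show ?thesis using e by simp
  qed
  then show "\<exists>d>0. \<forall>U\<in>{U. unitary U}. dist U U0 < d \<longrightarrow> dist (orbit F U) (orbit F U0) < e"
    using d(1) by blast
qed

lemma closed_subspace_C0:
  "closed {g :: ('x, complex^'n^'n) bcontfun. apply_bcontfun g \<in> C0}" "subspace {g :: ('x, complex^'n^'n) bcontfun. apply_bcontfun g \<in> C0}"
proof -
  show "closed {g :: ('x, complex^'n^'n) bcontfun. apply_bcontfun g \<in> C0}"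
    unfolding closure_subset_eq[symmetric]
  proof (intro subsetI CollectI)
    fix g :: "('x, complex^'n^'n) bcontfun" assume g: "g \<in> closure {g. apply_bcontfun g \<in> C0}"
    have "\<exists>K. compact K \<and> (\<forall>x. x \<notin> K \<longrightarrow> norm (apply_bcontfun g x) < e)" if e: "e > 0" for e
    proof -
      obtain h :: "('x, complex^'n^'n) bcontfun" where h: "apply_bcontfun h \<in> C0" "dist h g < e / 2"
        using g half_gt_zero[OF e] unfolding closure_approachable by blast
      obtain K where K: "compact K" "\<And>x. x \<notin> K \<Longrightarrow> norm (apply_bcontfun h x) < e / 2"
        using h(1) half_gt_zero[OF e] unfolding C0_def vanishes_at_infinity_def by blast
      have "norm (apply_bcontfun g x) < e" if "x \<notin> K" for x
      proof -
        have "norm (apply_bcontfun h x - apply_bcontfun g x) < e / 2"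
          using dist_fun_lt_imp_dist_val_lt[OF h(2)] by (simp add: dist_norm)
        then show ?thesis
          using K(2)[OF that] norm_triangle_ineq4[of "apply_bcontfun h x" "apply_bcontfun h x - apply_bcontfun g x"] by simp
      qed
      then show ?thesis using K(1) by blast
    qed
    then show "apply_bcontfun g \<in> C0" by (simp add: C0_def vanishes_at_infinity_def)
  qed
  show "subspace {g :: ('x, complex^'n^'n) bcontfun. apply_bcontfun g \<in> C0}"
    by (auto simp: subspace_def C0_add plus_bcontfun.rep_eq scaleR_bcontfun.rep_eq zero_bcontfun.rep_eq
        intro: C0_bounded_linear[OF _ bounded_linear_scaleR_right])
qed

lemma bounded_linear_apply_bcontfun: "bounded_linear (\<lambda>g :: ('x, complex^'n^'n) bcontfun. apply_bcontfun g x)"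
  by (rule bounded_linear_intro[where K = 1])
    (simp_all add: plus_bcontfun.rep_eq scaleR_bcontfun.rep_eq norm_bounded)

text \<open>Evaluation at a point is bounded linear on \<open>bcontfun\<close> and hence commutes
  with the mean of the orbit.\<close>

lemma average_eq:
  assumes F: "F \<in> C0" shows "average F = apply_bcontfun (umean (orbit F))"
proof
  fix x
  have "average F x = umean (\<lambda>U. apply_bcontfun (orbit F U) x)"
    unfolding average_def by (rule umean_cong) (simp add: apply_orbit F)
  also have "\<dots> = apply_bcontfun (umean (orbit F)) x"
    by (rule umean_bounded_linear[OF continuous_orbit[OF F] bounded_linear_apply_bcontfun])
  finally show "average F x = apply_bcontfun (umean (orbit F)) x" .
qed

lemma average_C0: assumes F: "F \<in> C0" shows "average F \<in> C0"
  unfolding average_eq[OF F]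
  using umean_closed_subspace[OF continuous_orbit[OF F] closed_subspace_C0]
  by (simp add: apply_orbit F translate_C0)

text \<open>Moving the point by \<open>V\<close> replaces \<open>U\<close> by \<open>U ** V\<close>
  and conjugates by \<open>V\<close>. Conjugation is bounded linear and passes out of the mean,
  which is invariant under right multiplication.\<close>

lemma average_equivariant:
  assumes F: "F \<in> C0" and V: "unitary V" shows "average F (act V x) = V ** average F x ** cadj V"
proof -
  let ?k = "\<lambda>U. translate U F x"
  note ck = continuous_translate_orbit[OF F, of x]
  have "average F (act V x) = umean (\<lambda>U. V ** ?k (U ** V) ** cadj V)"
    unfolding average_def
  proof (rule umean_cong)
    fix U :: "complex^'n^'n" assume U: "unitary U"
    have "V ** ?k (U ** V) ** cadj V = (V ** cadj V) ** (cadj U ** F (act U (act V x)) ** U) ** (V ** cadj V)"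
      by (simp add: translate_def act_mult U V cadj_mult matrix_mul_assoc)
    then show "translate U F (act V x) = V ** ?k (U ** V) ** cadj V"
      by (simp add: unitaryD V translate_def)
  qed
  also have "\<dots> = V ** umean (\<lambda>U. ?k (U ** V)) ** cadj V"
  proof (rule umean_bounded_linear[OF _ bounded_linear_conj_unitary[OF V]])
    show "continuous_on {U. unitary U} (\<lambda>U. ?k (U ** V))"
      by (rule continuous_translate[OF F]) (auto intro!: continuous_intros unitary_mult V)
  qed
  also have "umean (\<lambda>U. ?k (U ** V)) = average F x"
    unfolding average_def by (rule umean_translate_right[OF ck V])
  finally show ?thesis .
qed

lemma cstar_subset_C0: "cstar act \<subseteq> C0" by (auto simp: cstar_def C0_def)

lemma cstarI: "F \<in> C0 \<Longrightarrow> (\<And>U x. unitary U \<Longrightarrow> F (act U x) = U ** F x ** cadj U) \<Longrightarrow> F \<in> cstar act"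
  by (auto simp: cstar_def C0_def)

lemma cstarD: "F \<in> cstar act \<Longrightarrow> unitary U \<Longrightarrow> F (act U x) = U ** F x ** cadj U"
  by (auto simp: cstar_def)

lemma average_cstar: "F \<in> C0 \<Longrightarrow> average F \<in> cstar act"
  by (intro cstarI average_C0 average_equivariant)

lemma average_of_cstar:
  assumes "F \<in> cstar act" shows "average F = F"
proof
  fix x
  have "translate U F x = F x" if U: "unitary U" for U
  proof -
    have "translate U F x = (cadj U ** U) ** F x ** (cadj U ** U)"
      by (simp add: translate_def cstarD[OF assms U] matrix_mul_assoc)
    then show ?thesis by (simp add: unitaryD U)
  qed
  then have "umean (\<lambda>U. translate U F x) = umean (\<lambda>_::complex^'n^'n. F x)" by (rule umean_cong)
  then have "average F x = umean (\<lambda>_::complex^'n^'n. F x)" by (simp add: average_def)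
  then show "average F x = F x" by (simp add: umean_const)
qed

text \<open>Invariance of the mean under left multiplication gives this; every functional of
  \<open>average F\<close> is therefore invariant under translating \<open>F\<close>.\<close>

lemma average_translate:
  assumes F: "F \<in> C0" and V: "unitary V" shows "average (translate V F) = average F"
proof
  fix x
  have "average (translate V F) x = umean (\<lambda>U. translate (V ** U) F x)"
    unfolding average_def by (rule umean_cong) (simp add: translate_translate V)
  also have "\<dots> = average F x"
    unfolding average_def by (rule umean_translate_left[OF continuous_translate_orbit[OF F] V])
  finally show "average (translate V F) x = average F x" .
qed

lemma average_add:
  assumes "F \<in> C0" "G \<in> C0" shows "average (\<lambda>x. F x + G x) = (\<lambda>x. average F x + average G x)"
proof
  fix x
  have "translate U (\<lambda>x. F x + G x) x = translate U F x + translate U G x" for U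
    by (simp add: translate_def matrix_add_ldistrib matrix_add_rdistrib)
  then show "average (\<lambda>x. F x + G x) x = average F x + average G x"
    unfolding average_def by (simp add: umean_add[OF assms[THEN continuous_translate_orbit]])
qed

lemma average_cscale:
  assumes "F \<in> C0" shows "average (\<lambda>x. cscale c (F x)) = (\<lambda>x. cscale c (average F x))"
proof
  fix x
  have "translate U (\<lambda>x. cscale c (F x)) x = cscale c (translate U F x)" for U
    by (simp add: translate_def matrix_mult_cscale_left matrix_mult_cscale_right)
  then show "average (\<lambda>x. cscale c (F x)) x = cscale c (average F x)"
    unfolding average_def
    by (simp add: umean_bounded_linear[OF continuous_translate_orbit[OF assms] bounded_linear_cscale])
qed

lemma norm_average_le:
  assumes "F \<in> C0" "\<And>x. norm (F x) \<le> B" shows "norm (average F x) \<le> B"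
  unfolding average_def
  by (rule norm_umean_le[OF continuous_translate_orbit[OF assms(1)]]) (simp add: norm_translate assms(2))

end

section \<open>Integration against n-measures\<close>

lemma n_integral_eq: "n_integral F \<mu> = (\<Sum>j\<in>UNIV. \<Sum>k\<in>UNIV. cm_integral (\<mu> k j) (\<lambda>x. F x $ j $ k))"
  by (simp add: n_integral_def)

lemma bounded_borel_functional_regular:
  "regular_complex_borel_measure \<nu> \<Longrightarrow> bounded_borel_functional (cm_integral \<nu>)"
  by (intro bounded_borel_functional_cm_integral regular_imp_complex_borel_measure)

text \<open>The indices are exchanged because the integral pairs entry \<open>j k\<close> of the
  function with entry \<open>k j\<close> of the measure, like the trace of a product.\<close>

lemma n_integral_mat_unit:
  fixes \<mu> :: "'n::finite \<Rightarrow> 'n \<Rightarrow> 'x::topological_space set \<Rightarrow> complex"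
  assumes \<mu>: "\<And>j k. regular_complex_borel_measure (\<mu> j k)"
  shows "n_integral (\<lambda>x. mat_unit j k (h x)) \<mu> = cm_integral (\<mu> k j) h"
proof -
  have "cm_integral (\<mu> b a) (\<lambda>x. mat_unit j k (h x) $ a $ b) = (if b = k then if a = j then cm_integral (\<mu> k j) h else 0 else 0)" for a b
    using bounded_borel_functional.zero[OF bounded_borel_functional_regular[OF \<mu>]] by (auto simp: mat_unit_def)
  then show ?thesis by (simp add: n_integral_eq)
qed

lemma sum_swap4:
  "(\<Sum>a\<in>A. \<Sum>b\<in>B. \<Sum>c\<in>C. \<Sum>d\<in>D. g a b c d) = (\<Sum>d\<in>D. \<Sum>c\<in>C. \<Sum>a\<in>A. \<Sum>b\<in>B. g a b c d)"
proof -
  have "(\<Sum>a\<in>A. \<Sum>b\<in>B. \<Sum>c\<in>C. \<Sum>d\<in>D. g a b c d) = (\<Sum>a\<in>A. \<Sum>b\<in>B. \<Sum>d\<in>D. \<Sum>c\<in>C. g a b c d)"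
    by (rule sum.cong[OF refl sum.cong[OF refl sum.swap]])
  also have "\<dots> = (\<Sum>a\<in>A. \<Sum>d\<in>D. \<Sum>b\<in>B. \<Sum>c\<in>C. g a b c d)"
    by (rule sum.cong[OF refl sum.swap])
  also have "\<dots> = (\<Sum>d\<in>D. \<Sum>a\<in>A. \<Sum>b\<in>B. \<Sum>c\<in>C. g a b c d)" by (rule sum.swap)
  also have "\<dots> = (\<Sum>d\<in>D. \<Sum>a\<in>A. \<Sum>c\<in>C. \<Sum>b\<in>B. g a b c d)"
    by (rule sum.cong[OF refl sum.cong[OF refl sum.swap]])
  also have "\<dots> = (\<Sum>d\<in>D. \<Sum>c\<in>C. \<Sum>a\<in>A. \<Sum>b\<in>B. g a b c d)"
    by (rule sum.cong[OF refl sum.swap])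
  finally show ?thesis .
qed

context n_space_action
begin

lemma translate_component:
  "translate U F x $ j $ k = (\<Sum>a\<in>UNIV. \<Sum>b\<in>UNIV. cnj (U $ a $ j) * U $ b $ k * F (act U x) $ a $ b)"
  using conj_unitary_component[of "cadj U" "F (act U x)" j k]
  by (simp add: translate_def) (simp add: cadj_def)

lemma homeomorphism_act:
  assumes "unitary U"
  shows "\<And>x. act (cadj U) (act U x) = x" "\<And>x. act U (act (cadj U) x) = x"
    "continuous_on UNIV (act U)" "continuous_on UNIV (act (cadj U))"
  using assms by (simp_all add: continuous_act)

lemma C0_compose_act:
  assumes "F \<in> C0" "unitary U" shows "(\<lambda>x. F (act U x) :: complex^'n^'n) \<in> C0"
proof (rule C0_dominated[OF translate_C0[OF assms], where c = 1])
  show "continuous_on UNIV (\<lambda>x. F (act U x))"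
    by (rule continuous_on_compose2[OF C0_continuous[OF assms(1), of UNIV] continuous_act[OF assms(2)]]) simp
qed (simp add: norm_translate assms)

lemma act_image_borel: "unitary U \<Longrightarrow> A \<in> sets borel \<Longrightarrow> act U ` A \<in> sets borel"
  using measurable_sets[OF borel_measurable_continuous_onI[OF continuous_act[of "cadj U" UNIV]], of A]
  by (simp add: image_eq_vimage_inverse[of "act (cadj U)" "act U"])

text \<open>Equivariance writes each entry of \<mu> as a combination, with coefficients from
  \<open>U\<close>, of the entries transported by the action. Integrating \<open>F\<close> against
  it moves the action onto \<open>F\<close>, and the same coefficients appear when
  \<open>translate U F\<close> is written out, so both sides are one fourfold sum.\<close>

lemma n_integral_translate:
  assumes \<mu>: "n_measure act \<mu>" and U: "unitary U" and F: "F \<in> C0"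
  shows "n_integral (translate U F) \<mu> = n_integral F \<mu>"
proof -
  have reg: "regular_complex_borel_measure (\<mu> j k)" for j k using \<mu> by (simp add: n_measure_def)
  note J = bounded_borel_functional_regular[OF reg]
  let ?t = "act (cadj U)"
  have Fb: "bounded_borel (\<lambda>x. F x $ a $ b)" for a b by (intro C0_bounded_borel C0_component F)
  have FU: "bounded_borel (\<lambda>x. F (act U x) $ a $ b)" for a b
    using bounded_borel_compose[OF Fb continuous_act[OF U]] .
  note pf = regular_pushforward[OF homeomorphism_act(2,1)[OF U] homeomorphism_act(3,4)[OF U]]
  have "cm_integral (\<mu> b a) (\<lambda>x. F x $ a $ b)
      = (\<Sum>k\<in>UNIV. \<Sum>j\<in>UNIV. U $ b $ k * cnj (U $ a $ j) * cm_integral (\<mu> k j) (\<lambda>x. F (act U x) $ a $ b))" for a b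
  proof -
    let ?J = "\<lambda>f. \<Sum>k\<in>UNIV. \<Sum>j\<in>UNIV. U $ b $ k * cnj (U $ a $ j) * cm_integral (\<lambda>A. \<mu> k j (?t ` A)) f"
    have "?J = (\<lambda>f. \<Sum>p\<in>UNIV \<times> UNIV. U $ b $ fst p * cnj (U $ a $ snd p) * cm_integral (\<lambda>A. \<mu> (fst p) (snd p) (?t ` A)) f)"
      by (simp add: sum.cartesian_product case_prod_unfold)
    then have J': "bounded_borel_functional ?J"
      using bounded_borel_functional_lincomb[of "UNIV \<times> UNIV" "\<lambda>p. cm_integral (\<lambda>A. \<mu> (fst p) (snd p) (?t ` A))"
          "\<lambda>p. U $ b $ fst p * cnj (U $ a $ snd p)"] bounded_borel_functional_regular[OF pf(1)[OF reg]] by simp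
    \<comment> \<open>Equivariance is a statement about sets; comparing the two functionals on
      indicators carries it over to bounded Borel functions.\<close>
    have "cm_integral (\<mu> b a) (\<lambda>x. F x $ a $ b) = ?J (\<lambda>x. F x $ a $ b)"
    proof (rule bounded_borel_functional_eqI[OF J J' _ Fb])
      fix A :: "'x set" assume A: "A \<in> sets borel"
      have tA: "?t ` A \<in> sets borel" using act_image_borel[of "cadj U"] U A by simp
      have "act U ` ?t ` A = A" using U by (simp add: image_image)
      then have "cm_mat \<mu> A = U ** cm_mat \<mu> (?t ` A) ** cadj U"
        using \<mu> U tA unfolding n_measure_def by metis
      then have "\<mu> b a A = (U ** cm_mat \<mu> (?t ` A) ** cadj U) $ b $ a" by (simp add: cm_mat_def vec_eq_iff)
      then show "cm_integral (\<mu> b a) (indicator A) = ?J (indicator A)"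
        unfolding conj_unitary_component
        by (simp add: cm_integral_indicator regular_imp_complex_borel_measure reg pf(1) A cm_mat_def)
    qed
    also have "\<dots> = (\<Sum>k\<in>UNIV. \<Sum>j\<in>UNIV. U $ b $ k * cnj (U $ a $ j) * cm_integral (\<mu> k j) (\<lambda>x. F (act U x) $ a $ b))"
      by (simp add: pf(2)[OF reg Fb])
    finally show ?thesis .
  qed note 1 = this
  have 2: "cm_integral (\<mu> k j) (\<lambda>x. translate U F x $ j $ k)
      = (\<Sum>a\<in>UNIV. \<Sum>b\<in>UNIV. cnj (U $ a $ j) * U $ b $ k * cm_integral (\<mu> k j) (\<lambda>x. F (act U x) $ a $ b))" for j k
  proof -
    interpret J: bounded_borel_functional "cm_integral (\<mu> k j)" by (rule J)
    show ?thesis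
      unfolding translate_component
      by (simp add: J.sum J.cmult bounded_borel_sum bounded_borel_cmult FU)
  qed
  have "n_integral F \<mu> = (\<Sum>a\<in>UNIV. \<Sum>b\<in>UNIV. \<Sum>k\<in>UNIV. \<Sum>j\<in>UNIV. U $ b $ k * cnj (U $ a $ j) * cm_integral (\<mu> k j) (\<lambda>x. F (act U x) $ a $ b))"
    unfolding n_integral_eq by (simp only: 1)
  also have "\<dots> = (\<Sum>j\<in>UNIV. \<Sum>k\<in>UNIV. \<Sum>a\<in>UNIV. \<Sum>b\<in>UNIV. U $ b $ k * cnj (U $ a $ j) * cm_integral (\<mu> k j) (\<lambda>x. F (act U x) $ a $ b))"
    by (rule sum_swap4)
  also have "\<dots> = n_integral (translate U F) \<mu>"
    unfolding n_integral_eq by (simp add: 2 mult_ac)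
  finally show ?thesis by simp
qed

text \<open>Bounded linearity on \<open>bcontfun\<close> is what lets integration be exchanged with
  the mean of an orbit.\<close>

lemma bounded_linear_n_integral:
  assumes reg: "\<And>j k. regular_complex_borel_measure (\<mu> j k)"
  shows "bounded_linear (\<lambda>g :: ('x, complex^'n^'n) bcontfun. n_integral (apply_bcontfun g) \<mu>)"
  unfolding n_integral_eq
proof (intro bounded_linear_sum)
  fix j k
  interpret J: bounded_borel_functional "cm_integral (\<mu> k j)"
    by (rule bounded_borel_functional_regular[OF reg])
  have le: "cmod (apply_bcontfun g x $ j $ k) \<le> norm g" for g :: "('x, complex^'n^'n) bcontfun" and x
    using Finite_Cartesian_Product.norm_nth_le[of "apply_bcontfun g x $ j" k] Finite_Cartesian_Product.norm_nth_le[of "apply_bcontfun g x" j] norm_bounded[of g x] by linarith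
  have b: "bounded_borel (\<lambda>x. apply_bcontfun g x $ j $ k)" for g :: "('x, complex^'n^'n) bcontfun"
    unfolding bounded_borel_def using le
    by (auto intro!: borel_measurable_continuous_onI continuous_intros)
  obtain C where C: "\<And>f B. bounded_borel f \<Longrightarrow> (\<And>x. cmod (f x) \<le> B) \<Longrightarrow> cmod (cm_integral (\<mu> k j) f) \<le> C * B"
    using J.bounded by metis
  show "bounded_linear (\<lambda>g :: ('x, complex^'n^'n) bcontfun. cm_integral (\<mu> k j) (\<lambda>x. apply_bcontfun g x $ j $ k))"
  proof (rule bounded_linear_intro[where K = C])
    show "norm (cm_integral (\<mu> k j) (\<lambda>x. apply_bcontfun g x $ j $ k)) \<le> norm g * C" for g :: "('x, complex^'n^'n) bcontfun"
      using C[OF b le] by (simp add: mult.commute)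
  qed (simp_all add: plus_bcontfun.rep_eq scaleR_bcontfun.rep_eq scaleR_conv_of_real J.add J.cmult b flip: scaleR_conv_of_real, simp add: scaleR_conv_of_real J.cmult b)
qed

text \<open>Exchanging integral and mean leaves the mean of a constant, since every translate has
  the same integral.\<close>

lemma n_integral_average:
  assumes \<mu>: "n_measure act \<mu>" and F: "F \<in> C0"
  shows "n_integral (average F) \<mu> = n_integral F \<mu>"
proof -
  have reg: "regular_complex_borel_measure (\<mu> j k)" for j k using \<mu> by (simp add: n_measure_def)
  have "n_integral (average F) \<mu> = umean (\<lambda>U. n_integral (apply_bcontfun (orbit F U)) \<mu>)"
    unfolding average_eq[OF F]
    by (rule umean_bounded_linear[OF continuous_orbit[OF F] bounded_linear_n_integral[OF reg], symmetric])
  also have "\<dots> = umean (\<lambda>_::complex^'n^'n. n_integral F \<mu>)"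
    by (rule umean_cong) (simp add: apply_orbit F n_integral_translate \<mu>)
  finally show ?thesis by (simp add: umean_const)
qed

text \<open>A single entry of \<mu> is seen by test functions with one nonzero entry, which need not
  be equivariant; averaging brings them into \<open>cstar act\<close> without changing either
  integral.\<close>

lemma n_measure_unique:
  assumes \<mu>: "n_measure act \<mu>" "n_measure act \<mu>'"
    and eq: "\<And>F. F \<in> cstar act \<Longrightarrow> n_integral F \<mu> = n_integral F \<mu>'"
  shows "\<mu> = \<mu>'"
proof (intro ext)
  fix j k and A :: "'x set"
  have reg: "regular_complex_borel_measure (\<mu> j k)" "regular_complex_borel_measure (\<mu>' j k)" for j k
    using \<mu> by (simp_all add: n_measure_def)
  show "\<mu> j k A = \<mu>' j k A"
  proof (cases "A \<in> sets borel")
    case True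
    have same: "cm_integral (\<mu> j k) (\<lambda>x. of_real (h x)) = cm_integral (\<mu>' j k) (\<lambda>x. of_real (h x))" if h: "h \<in> pos_C0" for h
    proof -
      let ?F = "\<lambda>x. mat_unit k j (of_real (h x))"
      have F: "?F \<in> C0"
        by (intro C0_bounded_linear[OF _ bounded_linear_mat_unit] C0_bounded_linear[OF _ bounded_linear_of_real] pos_C0D(1) h)
      have "n_integral ?F \<mu> = n_integral (average ?F) \<mu>" by (rule n_integral_average[OF \<mu>(1) F, symmetric])
      also have "\<dots> = n_integral (average ?F) \<mu>'" by (rule eq[OF average_cstar[OF F]])
      also have "\<dots> = n_integral ?F \<mu>'" by (rule n_integral_average[OF \<mu>(2) F])
      finally show ?thesis by (simp add: n_integral_mat_unit reg)
    qed
    have "(\<Sum>i\<in>{True, False}. (if i then 1 else -1) * (if i then \<mu> j k else \<mu>' j k) A) = 0"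
      by (rule regular_lincomb_eq_0[OF lc _ _ _ True]) (auto simp: reg same)
    then show ?thesis by simp
  next
    case False
    then show ?thesis
      using reg[THEN regular_imp_complex_borel_measure, of j k] by (simp add: complex_borel_measure_def)
  qed
qed

text \<open>Testing invariance on functions with one nonzero entry gives, for each pair of indices,
  a linear relation between one transported measure and the entries of \<mu>. Such relations pass
  from functions in \<open>pos_C0\<close> to Borel sets by
  \<open>regular_lincomb_eq_0\<close>.\<close>

lemma n_measureI:
  assumes reg: "\<And>j k. regular_complex_borel_measure (\<mu> j k)"
    and inv: "\<And>U F. unitary U \<Longrightarrow> F \<in> C0 \<Longrightarrow> n_integral (translate U F) \<mu> = n_integral F \<mu>"
  shows "n_measure act \<mu>"
  unfolding n_measure_def
proof (intro conjI allI impI reg, elim conjE)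
  fix U :: "complex^'n^'n" and A :: "'x set" assume U: "unitary U" and A: "A \<in> sets borel"
  note pf = regular_pushforward[OF homeomorphism_act(1,2)[OF U] homeomorphism_act(4,3)[OF U]]
  have "\<mu> a b (act U ` A) = (\<Sum>c\<in>UNIV. \<Sum>d\<in>UNIV. U $ a $ c * cnj (U $ b $ d) * \<mu> c d A)" for a b
  proof -
    \<comment> \<open>\<open>None\<close> stands for the transported measure, with coefficient 1;
      the pairs index the entries on the other side of the relation, with coefficients
      negated.\<close>
    let ?I = "insert None (Some ` (UNIV \<times> UNIV)) :: ('n \<times> 'n) option set"
    let ?\<nu> = "\<lambda>i. case i of None \<Rightarrow> (\<lambda>A. \<mu> a b (act U ` A)) | Some p \<Rightarrow> \<mu> (fst p) (snd p)"
    let ?c = "\<lambda>i. case i of None \<Rightarrow> 1 | Some p \<Rightarrow> - (U $ a $ fst p * cnj (U $ b $ snd p))"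
    have expand: "(\<Sum>i\<in>?I. ?c i * g (?\<nu> i)) = g (\<lambda>A. \<mu> a b (act U ` A))
        - (\<Sum>c\<in>UNIV. \<Sum>d\<in>UNIV. U $ a $ c * cnj (U $ b $ d) * g (\<mu> c d))" for g :: "('x set \<Rightarrow> complex) \<Rightarrow> complex"
      by (subst sum.insert) (auto simp: sum.reindex sum.cartesian_product case_prod_unfold sum_negf)
    have "(\<Sum>i\<in>?I. ?c i * ?\<nu> i A) = 0"
    proof (rule regular_lincomb_eq_0[OF lc _ _ _ A])
      fix h :: "'x \<Rightarrow> real" assume h: "h \<in> pos_C0"
      \<comment> \<open>Composing with \<open>act (cadj U)\<close> cancels the action inside
        \<open>translate U\<close>, and the unit at \<open>b a\<close> selects the entry
        \<open>\<mu> a b\<close> under the pairing.\<close>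
      let ?h = "\<lambda>x. complex_of_real (h x)" and ?F = "\<lambda>x. mat_unit b a (complex_of_real (h (act (cadj U) x)))"
      have hC: "?h \<in> C0" by (intro C0_bounded_linear[OF _ bounded_linear_of_real] pos_C0D(1) h)
      have hb: "bounded_borel ?h" by (rule C0_bounded_borel[OF hC])
      have G: "(\<lambda>x. mat_unit b a (?h x)) \<in> C0" by (rule C0_bounded_linear[OF hC bounded_linear_mat_unit])
      have F: "?F \<in> C0" using C0_compose_act[OF G, of "cadj U"] U by simp
      have "cm_integral (\<lambda>A. \<mu> a b (act U ` A)) ?h = cm_integral (\<mu> a b) (\<lambda>x. ?h (act (cadj U) x))"
        by (rule pf(2)[OF reg hb])
      also have "\<dots> = n_integral ?F \<mu>" by (simp add: n_integral_mat_unit reg)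
      also have "\<dots> = n_integral (translate U ?F) \<mu>" by (rule inv[OF U F, symmetric])
      also have "\<dots> = (\<Sum>j\<in>UNIV. \<Sum>k\<in>UNIV. U $ a $ k * cnj (U $ b $ j) * cm_integral (\<mu> k j) ?h)"
      proof -
        have "translate U ?F x $ j $ k = U $ a $ k * cnj (U $ b $ j) * ?h x" for x j k
        proof -
          have "translate U ?F x $ j $ k
              = (\<Sum>a'\<in>UNIV. \<Sum>b'\<in>UNIV. if a' = b then if b' = a then cnj (U $ b $ j) * U $ a $ k * ?h x else 0 else 0)"
            unfolding translate_component using U by (intro sum.cong refl) (auto simp: mat_unit_def)
          also have "\<dots> = (\<Sum>a'\<in>UNIV. if a' = b then cnj (U $ b $ j) * U $ a $ k * ?h x else 0)"
            by (intro sum.cong refl) auto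
          finally show ?thesis by (simp add: mult.commute)
        qed
        then show ?thesis
          unfolding n_integral_eq
          by (simp add: bounded_borel_functional.cmult[OF bounded_borel_functional_regular[OF reg] hb])
      qed
      also have "\<dots> = (\<Sum>c\<in>UNIV. \<Sum>d\<in>UNIV. U $ a $ c * cnj (U $ b $ d) * cm_integral (\<mu> c d) ?h)"
        by (rule sum.swap)
      finally show "(\<Sum>i\<in>?I. ?c i * cm_integral (?\<nu> i) ?h) = 0"
        unfolding expand[of "\<lambda>\<nu>. cm_integral \<nu> ?h"] by simp
    qed (auto simp: reg pf(1))
    then show ?thesis unfolding expand[of "\<lambda>\<nu>. \<nu> A"] by simp
  qed
  then show "cm_mat \<mu> (act U ` A) = U ** cm_mat \<mu> A ** cadj U"
    by (simp add: vec_eq_iff conj_unitary_component) (simp add: cm_mat_def)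
qed

section \<open>Existence of the representing n-measure\<close>

lemma cstar_cscale: "f \<in> cstar act \<Longrightarrow> (\<lambda>x. cscale c (f x)) \<in> cstar act"
  using cstar_subset_C0
  by (intro cstarI C0_bounded_linear[OF _ bounded_linear_cscale])
    (auto simp: cstarD matrix_mult_cscale_left matrix_mult_cscale_right)

text \<open>The usual scaling argument from continuity at 0, phrased with an arbitrary uniform bound
  \<open>B\<close> in the Frobenius norm, the form in which averages are estimated.\<close>

lemma cont_lin_functional_bounded:
  assumes \<phi>: "cont_lin_functional act \<phi>"
  shows "\<exists>C. \<forall>f\<in>cstar act. \<forall>B. (\<forall>x. norm (f x) \<le> B) \<longrightarrow> cmod (\<phi> f) \<le> C * B"
proof -
  have scale: "\<phi> (\<lambda>x. cscale c (f x)) = c * \<phi> f" if "f \<in> cstar act" for c f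
    using \<phi> that unfolding cont_lin_functional_def by blast
  have z: "(\<lambda>_. 0) \<in> cstar act" by (intro cstarI C0_zero) simp
  have \<phi>0: "\<phi> (\<lambda>_. 0) = 0" using scale[OF z, of 0] by (simp add: cscale_def zero_vec_def)
  obtain d where d: "d > 0" "\<forall>g\<in>cstar act. cstar_norm (\<lambda>x. g x - 0) < d \<longrightarrow> cmod (\<phi> g - \<phi> (\<lambda>_. 0)) < 1"
  proof -
    have "\<forall>f\<in>cstar act. \<forall>e>0. \<exists>d>0. \<forall>g\<in>cstar act. cstar_norm (\<lambda>x. g x - f x) < d \<longrightarrow> cmod (\<phi> g - \<phi> f) < e"
      using \<phi> unfolding cont_lin_functional_def by (elim conjE)
    from bspec[OF this z] have "\<exists>d>0. \<forall>g\<in>cstar act. cstar_norm (\<lambda>x. g x - 0) < d \<longrightarrow> cmod (\<phi> g - \<phi> (\<lambda>_. 0)) < 1"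
      using zero_less_one by meson
    then show thesis using that by (elim exE conjE)
  qed
  have "cmod (\<phi> f) \<le> (2 / d) * B" if f: "f \<in> cstar act" "\<forall>x. norm (f x) \<le> B" for f B
  proof (cases "B > 0")
    case True
    \<comment> \<open>This factor brings the bound \<open>B\<close> down to \<open>d / 2\<close>,
      inside the ball of radius \<open>d\<close>; undoing it gives the constant
      \<open>2 / d\<close>.\<close>
    define r where "r = d / (2 * B)"
    have r: "r > 0" "r * B = d / 2" using d(1) True by (auto simp: r_def)
    let ?g = "\<lambda>x. cscale (complex_of_real r) (f x)"
    have "norm (?g x - 0) \<le> d / 2" for x
    proof -
      have "norm (?g x - 0) = r * norm (f x)" using r(1) by (simp add: norm_cscale)
      also have "\<dots> \<le> r * B" using f(2) r(1) by (intro mult_left_mono) auto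
      finally show ?thesis using r(2) by simp
    qed
    then have "cstar_norm (\<lambda>x. ?g x - 0) \<le> d / 2" by (rule cstar_norm_le)
    then have "cstar_norm (\<lambda>x. ?g x - 0) < d" using d(1) by linarith
    then have "cmod (\<phi> ?g - \<phi> (\<lambda>_. 0)) < 1" by (rule d(2)[rule_format, OF cstar_cscale[OF f(1)]])
    then have "r * cmod (\<phi> f) < 1"
      using r(1) by (simp add: scale[OF f(1)] norm_mult \<phi>0)
    then show ?thesis using d(1) True by (simp add: r_def field_simps)
  next
    case False
    have "norm (f x) \<le> 0" for x using f(2)[rule_format, of x] False by linarith
    then have "f x = 0" for x by simp
    then have "f = (\<lambda>_. 0)" by (rule ext)
    moreover have "0 \<le> B" by (rule order_trans[OF norm_ge_zero f(2)[rule_format]])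
    ultimately show ?thesis using \<phi>0 d(1) by simp
  qed
  then show ?thesis by blast
qed

lemma n_measure_exists:
  assumes \<phi>: "cont_lin_functional act \<phi>"
  shows "\<exists>\<mu>. n_measure act \<mu> \<and> (\<forall>f\<in>cstar act. \<phi> f = n_integral f \<mu>)"
proof -
  have \<phi>_scale: "\<phi> (\<lambda>x. cscale c (f x)) = c * \<phi> f" if "f \<in> cstar act" for c f
    using \<phi> that unfolding cont_lin_functional_def by blast
  have \<phi>_add: "\<phi> (\<lambda>x. f x + g x) = \<phi> f + \<phi> g" if "f \<in> cstar act" "g \<in> cstar act" for f g
    using \<phi> that unfolding cont_lin_functional_def by blast
  obtain C where C: "\<And>f B. f \<in> cstar act \<Longrightarrow> (\<And>x. norm (f x) \<le> B) \<Longrightarrow> cmod (\<phi> f) \<le> C * B"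
    using cont_lin_functional_bounded[OF \<phi>] by metis
  define \<Phi> where "\<Phi> F = \<phi> (average F)" for F
  have \<Phi>_add: "\<Phi> (\<lambda>x. F x + G x) = \<Phi> F + \<Phi> G" if "F \<in> C0" "G \<in> C0" for F G
    using that by (simp add: \<Phi>_def average_add \<phi>_add average_cstar)
  have \<Phi>_scale: "\<Phi> (\<lambda>x. cscale c (F x)) = c * \<Phi> F" if "F \<in> C0" for c F
    using that by (simp add: \<Phi>_def average_cscale \<phi>_scale average_cstar)
  have \<Phi>_0: "\<Phi> (\<lambda>_. 0) = 0"
    using \<Phi>_scale[OF C0_zero, of 0] by (simp add: cscale_def zero_vec_def)
  have \<Phi>_sum: "\<Phi> (\<lambda>x. \<Sum>i\<in>I. F i x) = (\<Sum>i\<in>I. \<Phi> (F i))" if "\<And>i. i \<in> I \<Longrightarrow> F i \<in> C0"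
    for I :: "'i set" and F
    using that by (induction I rule: infinite_finite_induct) (simp_all add: \<Phi>_0 \<Phi>_add C0_sum)
  have unit: "(\<lambda>x. mat_unit j k (h x)) \<in> C0" if "h \<in> C0" for j k and h :: "'x \<Rightarrow> complex"
    using that bounded_linear_mat_unit by (rule C0_bounded_linear)
  have "\<exists>\<nu>. regular_complex_borel_measure \<nu> \<and> (\<forall>h\<in>C0. \<Phi> (\<lambda>x. mat_unit j k (h x)) = cm_integral \<nu> h)" for j k
  proof (rule complex_riesz_representation[OF lc])
    fix f g :: "'x \<Rightarrow> complex" assume f: "f \<in> C0"
    show "\<Phi> (\<lambda>x. mat_unit j k (f x + g x)) = \<Phi> (\<lambda>x. mat_unit j k (f x)) + \<Phi> (\<lambda>x. mat_unit j k (g x))" if "g \<in> C0"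
      using \<Phi>_add[OF unit[OF f] unit[OF that]] by (simp add: mat_unit_linear)
    show "\<Phi> (\<lambda>x. mat_unit j k (c * f x)) = c * \<Phi> (\<lambda>x. mat_unit j k (f x))" for c
      using \<Phi>_scale[OF unit[OF f]] by (simp add: mat_unit_linear)
    show "cmod (\<Phi> (\<lambda>x. mat_unit j k (f x))) \<le> C * B" if "\<And>x. cmod (f x) \<le> B" for B
      unfolding \<Phi>_def
      by (intro C average_cstar norm_average_le unit f) (simp add: norm_mat_unit that)
  qed
  then obtain \<nu> where \<nu>: "\<And>j k. regular_complex_borel_measure (\<nu> j k)"
    "\<And>j k h. h \<in> C0 \<Longrightarrow> \<Phi> (\<lambda>x. mat_unit j k (h x)) = cm_integral (\<nu> j k) h" by metis
  \<comment> \<open>Transposed, to match the pairing of entry \<open>j k\<close> of a function with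
    entry \<open>k j\<close> of the measure.\<close>
  define \<mu> where "\<mu> j k = \<nu> k j" for j k
  have int: "n_integral F \<mu> = \<Phi> F" if F: "F \<in> C0" for F
  proof -
    have "\<Phi> F = \<Phi> (\<lambda>x. \<Sum>j\<in>UNIV. \<Sum>k\<in>UNIV. mat_unit j k (F x $ j $ k))"
      by (simp flip: matrix_eq_sum_mat_unit)
    also have "\<dots> = (\<Sum>j\<in>UNIV. \<Sum>k\<in>UNIV. \<Phi> (\<lambda>x. mat_unit j k (F x $ j $ k)))"
      by (simp add: \<Phi>_sum C0_sum unit C0_component F)
    also have "\<dots> = n_integral F \<mu>" by (simp add: n_integral_eq \<mu>_def \<nu>(2) C0_component F)
    finally show ?thesis by simp
  qed
  have "n_measure act \<mu>"
  proof (rule n_measureI)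
    show "n_integral (translate U F) \<mu> = n_integral F \<mu>" if "unitary U" "F \<in> C0" for U F
      using that by (simp add: int translate_C0 \<Phi>_def average_translate)
  qed (simp add: \<mu>_def \<nu>(1))
  moreover have "\<phi> f = n_integral f \<mu>" if "f \<in> cstar act" for f
    using that cstar_subset_C0 by (subst int) (auto simp: \<Phi>_def average_of_cstar)
  ultimately show ?thesis by blast
qed

end

theorem theorem4p2:
  fixes act :: "complex^'n^'n \<Rightarrow> 'x::t2_space \<Rightarrow> 'x"
    and \<phi> :: "('x \<Rightarrow> complex^'n^'n) \<Rightarrow> complex"
  assumes "n_space act"
    and "cont_lin_functional act \<phi>"
  shows "\<exists>!\<mu>. n_measure act \<mu> \<and> (\<forall>f\<in>cstar act. \<phi> f = n_integral f \<mu>)"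
proof -
  interpret n_space_action act by unfold_locales (rule assms(1))
  show ?thesis
    using n_measure_exists[OF assms(2)]
    by (elim ex_ex1I) (rule n_measure_unique, auto)
qed

end
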